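(* Let $p$ be a prime and let $G=\prod_{k=1}^s G_k$, where $s\ge1$ and each $G_k$ is a cyclic group of order $p^{m_k}$ with $m_k\ge1$. Let $M$ be a non-trivial irreducible $G$-lattice. Then for all $n\ge0$ $$H_n(G,M)\simeq(\mathbb{Z}/p\mathbb{Z})^{\nu(n,s)},\qquad\text{where}\quad \nu(n,s)=(-1)^n\sum_{i=0}^{n}\binom{-s}{i}.$$
   Context: A $G$-lattice is a $\mathbb{Z}G$-module whose underlying abelian group is free of finite rank. A $G$-lattice $M$ is irreducible if $\mathbb{Q}\otimes_{\mathbb{Z}}M$ is a simple $\mathbb{Q}G$-module (equivalently, $M\neq0$ and there is no proper submodule $0\neq N\subset M$ with $M/N$ torsion free). Non-trivial means that $G$ does not act trivially on $M$. $H_n(G,M)$ is ordinary group homology. $\binom{-s}{i}=(-s)(-s-1)\cdots(-s-i+1)/i!$ is the generalized binomial coefficient. *)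

theory Defs
  imports
    "HOL-Algebra.Bij"
    "HOL-Algebra.Elementary_Groups"
    "HOL-Algebra.Product_Groups"
    "HOL-Algebra.Free_Abelian_Groups"
    "HOL-Computational_Algebra.Primes"
begin

text \<open>Abelian groups are written multiplicatively, as commutative groups in the sense of
  HOL-Algebra.\<close>

section \<open>Lattices over a group\<close>

text \<open>A module over the integral group ring of \<open>G\<close> is an abelian group \<open>M\<close> with a homomorphism
  from \<open>G\<close> to the automorphism group of \<open>M\<close>.\<close>

locale G_module = G?: group G + M?: comm_group M
  for G :: "('g, 'c) monoid_scheme" (structure) and M :: "('m, 'd) monoid_scheme" +
  fixes \<phi> :: "'g \<Rightarrow> 'm \<Rightarrow> 'm"
  assumes action_hom: "\<phi> \<in> hom G (AutoGroup M)"

locale G_lattice = G_module +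
  assumes free_finite_rank: "\<exists>r::nat. M \<cong> free_Abelian_group {..<r}"

definition nontrivial_action ::
    "('g, 'c) monoid_scheme \<Rightarrow> ('m, 'd) monoid_scheme \<Rightarrow> ('g \<Rightarrow> 'm \<Rightarrow> 'm) \<Rightarrow> bool" where
  "nontrivial_action G M \<phi> \<longleftrightarrow> (\<exists>g \<in> carrier G. \<exists>x \<in> carrier M. \<phi> g x \<noteq> x)"

section \<open>Tensor products of abelian groups and extension of scalars to the rationals\<close>

text \<open>The tensor product over the integers: the free abelian group on all pairs, modulo the
  subgroup generated by the biadditivity relations.\<close>

definition tensor_relators ::
    "('a, 'c) monoid_scheme \<Rightarrow> ('b, 'd) monoid_scheme \<Rightarrow> ('a \<times> 'b \<Rightarrow>\<^sub>0 int) set" where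
  "tensor_relators A B =
     {frag_of (a \<otimes>\<^bsub>A\<^esub> a', b) - frag_of (a, b) - frag_of (a', b) | a a' b.
        a \<in> carrier A \<and> a' \<in> carrier A \<and> b \<in> carrier B} \<union>
     {frag_of (a, b \<otimes>\<^bsub>B\<^esub> b') - frag_of (a, b) - frag_of (a, b') | a b b'.
        a \<in> carrier A \<and> b \<in> carrier B \<and> b' \<in> carrier B}"

definition tensor_null ::
    "('a, 'c) monoid_scheme \<Rightarrow> ('b, 'd) monoid_scheme \<Rightarrow> ('a \<times> 'b \<Rightarrow>\<^sub>0 int) set" where
  "tensor_null A B = generate (free_Abelian_group (carrier A \<times> carrier B)) (tensor_relators A B)"

definition tensor_group ::
    "('a, 'c) monoid_scheme \<Rightarrow> ('b, 'd) monoid_scheme \<Rightarrow> ('a \<times> 'b \<Rightarrow>\<^sub>0 int) set monoid" where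
  "tensor_group A B = free_Abelian_group (carrier A \<times> carrier B) Mod tensor_null A B"

text \<open>The endomorphism of the tensor product induced by endomorphisms \<open>f\<close> and \<open>h\<close> of the factors.
  An element \<open>T\<close> of the tensor product is a coset; its elementwise image lies in a single coset,
  which is recovered by multiplying with the subgroup of relations.\<close>

definition tensor_map ::
    "('a, 'c) monoid_scheme \<Rightarrow> ('b, 'd) monoid_scheme \<Rightarrow> ('a \<Rightarrow> 'a) \<Rightarrow> ('b \<Rightarrow> 'b)
      \<Rightarrow> ('a \<times> 'b \<Rightarrow>\<^sub>0 int) set \<Rightarrow> ('a \<times> 'b \<Rightarrow>\<^sub>0 int) set" where
  "tensor_map A B f h T =
     tensor_null A B <#>\<^bsub>free_Abelian_group (carrier A \<times> carrier B)\<^esub>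
       (frag_extend (frag_of \<circ> map_prod f h) ` T)"

definition rat_group :: "rat monoid" where
  "rat_group = \<lparr>carrier = UNIV, monoid.mult = (+), one = 0\<rparr>"

text \<open>Simplicity of a module \<open>V\<close> over the rational group algebra of \<open>G\<close>, given by its scalar
  multiplication \<open>\<sigma>\<close> and the action \<open>\<rho>\<close> of \<open>G\<close>.\<close>

definition simple_QG_module ::
    "('g, 'c) monoid_scheme \<Rightarrow> ('v, 'd) monoid_scheme \<Rightarrow> (rat \<Rightarrow> 'v \<Rightarrow> 'v) \<Rightarrow> ('g \<Rightarrow> 'v \<Rightarrow> 'v) \<Rightarrow> bool" where
  "simple_QG_module G V \<sigma> \<rho> \<longleftrightarrow>
     carrier V \<noteq> {\<one>\<^bsub>V\<^esub>} \<and>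
     (\<forall>N. subgroup N V \<and> (\<forall>q. \<forall>x \<in> N. \<sigma> q x \<in> N) \<and> (\<forall>g \<in> carrier G. \<forall>x \<in> N. \<rho> g x \<in> N)
        \<longrightarrow> N = {\<one>\<^bsub>V\<^esub>} \<or> N = carrier V)"

definition irreducible_lattice ::
    "('g, 'c) monoid_scheme \<Rightarrow> ('m, 'd) monoid_scheme \<Rightarrow> ('g \<Rightarrow> 'm \<Rightarrow> 'm) \<Rightarrow> bool" where
  "irreducible_lattice G M \<phi> \<longleftrightarrow> G_lattice G M \<phi> \<and>
     simple_QG_module G (tensor_group rat_group M)
       (\<lambda>q. tensor_map rat_group M (\<lambda>r. q * r) (\<lambda>x. x))
       (\<lambda>g. tensor_map rat_group M (\<lambda>r. r) (\<phi> g))"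

section \<open>Group homology\<close>

text \<open>Homology of the complex obtained by tensoring the (inhomogeneous, unnormalised) bar resolution
  of the trivial module over the group ring with \<open>M\<close>. In degree \<open>n\<close> it is a direct sum of copies
  of \<open>M\<close> indexed by \<open>n\<close>-tuples in \<open>G\<close>, and with additive notation for \<open>M\<close> the differential is

  \<open>[g\<^sub>1|...|g\<^sub>n] m \<mapsto> [g\<^sub>2|...|g\<^sub>n] (g\<^sub>1\<inverse> m)
      + (\<Sum>0<i<n. (-1)\<^sup>i [g\<^sub>1|...|g\<^sub>i g\<^sub>i\<^sub>+\<^sub>1|...|g\<^sub>n] m) + (-1)\<^sup>n [g\<^sub>1|...|g\<^sub>n\<^sub>-\<^sub>1] m\<close>.

  The inverse in the first term appears because left modules are tensored over the group ring
  after turning one of them into a right module by inversion.\<close>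

definition tuples :: "nat \<Rightarrow> ('g, 'c) monoid_scheme \<Rightarrow> 'g list set" where
  "tuples n G = {xs. length xs = n \<and> set xs \<subseteq> carrier G}"

definition bar_chains ::
    "('g, 'c) monoid_scheme \<Rightarrow> ('m, 'd) monoid_scheme \<Rightarrow> nat \<Rightarrow> ('g list \<Rightarrow> 'm) monoid" where
  "bar_chains G M n = sum_group (tuples n G) (\<lambda>_. M)"

definition bar_single ::
    "('g, 'c) monoid_scheme \<Rightarrow> ('m, 'd) monoid_scheme \<Rightarrow> nat \<Rightarrow> 'g list \<Rightarrow> 'm \<Rightarrow> 'g list \<Rightarrow> 'm" where
  "bar_single G M n xs m = (\<lambda>ys \<in> tuples n G. if ys = xs then m else \<one>\<^bsub>M\<^esub>)"

definition bar_face :: "('g, 'c) monoid_scheme \<Rightarrow> nat \<Rightarrow> 'g list \<Rightarrow> 'g list" where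
  "bar_face G i xs =
     (if i = 0 then tl xs
      else if i = length xs then butlast xs
      else take (i - 1) xs @ [xs ! (i - 1) \<otimes>\<^bsub>G\<^esub> xs ! i] @ drop (i + 1) xs)"

text \<open>The differential from degree \<open>n + 1\<close> to degree \<open>n\<close>.\<close>

definition bar_boundary ::
    "('g, 'c) monoid_scheme \<Rightarrow> ('m, 'd) monoid_scheme \<Rightarrow> ('g \<Rightarrow> 'm \<Rightarrow> 'm) \<Rightarrow> nat
      \<Rightarrow> ('g list \<Rightarrow> 'm) \<Rightarrow> 'g list \<Rightarrow> 'm" where
  "bar_boundary G M \<phi> n c =
     gfinprod (bar_chains G M n)
       (\<lambda>xs. finprod (bar_chains G M n)
          (\<lambda>i. bar_single G M n (bar_face G i xs) (if i = 0 then \<phi> (inv\<^bsub>G\<^esub> (hd xs)) (c xs) else c xs)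
                 [^]\<^bsub>bar_chains G M n\<^esub> ((-1) ^ i :: int))
          {0..Suc n})
       (tuples (Suc n) G)"

definition bar_cycles ::
    "('g, 'c) monoid_scheme \<Rightarrow> ('m, 'd) monoid_scheme \<Rightarrow> ('g \<Rightarrow> 'm \<Rightarrow> 'm) \<Rightarrow> nat \<Rightarrow> ('g list \<Rightarrow> 'm) set" where
  "bar_cycles G M \<phi> n =
     (case n of 0 \<Rightarrow> carrier (bar_chains G M 0)
      | Suc k \<Rightarrow> kernel (bar_chains G M (Suc k)) (bar_chains G M k) (bar_boundary G M \<phi> k))"

definition group_homology ::
    "nat \<Rightarrow> ('g, 'c) monoid_scheme \<Rightarrow> ('m, 'd) monoid_scheme \<Rightarrow> ('g \<Rightarrow> 'm \<Rightarrow> 'm)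
      \<Rightarrow> ('g list \<Rightarrow> 'm) set monoid" where
  "group_homology n G M \<phi> =
     subgroup_generated (bar_chains G M n) (bar_cycles G M \<phi> n)
       Mod (bar_boundary G M \<phi> n ` carrier (bar_chains G M (Suc n)))"

section \<open>The exponent\<close>

definition nu :: "nat \<Rightarrow> nat \<Rightarrow> rat" where
  "nu n s = (-1) ^ n * (\<Sum>i = 0..n. (- of_nat s) gchoose i)"

end

theory Submission
  imports Defs "HOL-Computational_Algebra.Polynomial"
begin

text \<open>Some element \<open>t\<^sub>0\<close> of \<open>G\<close> acts on \<open>M\<close> with exact order \<open>p\<^sup>a > 1\<close>, and by irreducibility every element
  of \<open>G\<close> acts as a power of \<open>t\<^sub>0\<close>. Put \<open>\<pi> = t\<^sub>0 - 1\<close>. It is injective on \<open>M\<close>, the image of each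
  \<open>g - 1\<close> and of \<open>p\<close> lies in \<open>\<pi> M\<close>, and \<open>M / \<pi> M\<close> has order \<open>p\<close>. The tensor product of the periodic
  resolutions of the cyclic factors has all its differentials divisible by \<open>\<pi>\<close> on \<open>M\<close>, while
  multiplication by \<open>\<pi>\<close> is null-homotopic, so the boundaries in degree \<open>n\<close> are \<open>\<pi>\<close> times the cycles.
  Hence the homology is elementary abelian, and comparing cycles \<open>Z\<^sub>n\<close> with chains gives
  \<open>|H\<^sub>n| |H\<^sub>n\<^sub>-\<^sub>1| = p\<^sup>d\<close> where \<open>d\<close> is the rank of the resolution in degree \<open>n\<close>. This recursion is
  solved by \<open>\<nu>\<close>.\<close>

section \<open>Free modules over a group ring\<close>

text \<open>As \<open>G\<close> is abelian and the rational module simple, the operators from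
  \<open>G\<close> generate a field, in which \<open>t\<^sub>0\<close> is a primitive root of unity
  of order \<open>p ^ a\<close>; \<open>M\<close> has rank one over the cyclotomic ring and \<pi>
  generates its prime above \<open>p\<close>, whence the order of \<open>M / \<pi> M\<close>.
  Neither field nor ring is constructed. Irreducibility enters only through its consequence that
  nonzero stable subgroups have torsion quotient; together with integer polynomials in
  \<open>t\<^sub>0\<close>, Bezout, and the absence of nonzero vectors divisible by all powers of
  \<open>p\<close>, it replaces the number theory. The other obstacle is that homology is defined by
  the bar complex, whose ranks do not show the answer. So the comparison theorem is proved for
  arbitrary free resolutions, and order and exponent of the homology are carried over. For this the
  lattice moves into a type of integer vectors, where orders of quotients are counted by coset
  representatives; quotient groups return only at the end. The recursion for the orders comes from
  the differential \<open>d\<close> from chains \<open>C\<close> onto \<open>\<pi> Z'\<close>, where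
  \<open>Z'\<close> are the cycles one degree lower: it maps \<open>\<pi> C\<close> onto
  \<open>\<pi> \<pi> Z'\<close>, and the two kernels are the cycles \<open>Z\<close> and
  \<open>\<pi> Z\<close>.\<close>

text \<open>A pair \<open>(g, x)\<close> stands for the translate of the basis element
  \<open>x\<close> by \<open>g\<close>; elements of the module are integer combinations of pairs, so
  no type for the group ring is needed.\<close>

definition free_module :: "('g, 'c) monoid_scheme \<Rightarrow> 'x set \<Rightarrow> ('g \<times> 'x \<Rightarrow>\<^sub>0 int) set" where
  "free_module G X = {c. Poly_Mapping.keys c \<subseteq> carrier G \<times> X}"

definition translate ::
    "('g, 'c) monoid_scheme \<Rightarrow> 'g \<Rightarrow> ('g \<times> 'x \<Rightarrow>\<^sub>0 int) \<Rightarrow> ('g \<times> 'x \<Rightarrow>\<^sub>0 int)" where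
  "translate G h = frag_extend (\<lambda>(g, x). frag_of (h \<otimes>\<^bsub>G\<^esub> g, x))"

definition lin_extend ::
    "('g, 'c) monoid_scheme \<Rightarrow> ('x \<Rightarrow> ('g \<times> 'y \<Rightarrow>\<^sub>0 int)) \<Rightarrow> ('g \<times> 'x \<Rightarrow>\<^sub>0 int) \<Rightarrow> ('g \<times> 'y \<Rightarrow>\<^sub>0 int)" where
  "lin_extend G A = frag_extend (\<lambda>(g, x). translate G g (A x))"

text \<open>The integers appear as the free group on one point, so that the augmentation is a
  \<open>frag_extend\<close> and inherits its lemmas. The argument may be any integer combination,
  because the product complex below is augmented before it is related to \<open>G\<close>.\<close>

definition augment :: "('a \<Rightarrow>\<^sub>0 int) \<Rightarrow> (unit \<Rightarrow>\<^sub>0 int)" where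
  "augment = frag_extend (\<lambda>_. frag_of ())"

lemma augment_simps [simp]:
  "augment 0 = 0" "augment (frag_of x) = frag_of ()"
  "augment (c - c') = augment c - augment c'" "augment (c + c') = augment c + augment c'"
  "augment (- c) = - augment c" "augment (frag_cmul k c) = frag_cmul k (augment c)"
  by (auto simp: augment_def frag_extend_diff frag_extend_add frag_extend_minus frag_extend_cmul)

lemma translate_simps [simp]:
  "translate G h 0 = 0" "translate G h (frag_of (g, x)) = frag_of (h \<otimes>\<^bsub>G\<^esub> g, x)"
  "translate G h (c - c') = translate G h c - translate G h c'"
  "translate G h (c + c') = translate G h c + translate G h c'"
  "translate G h (- c) = - translate G h c"
  "translate G h (frag_cmul k c) = frag_cmul k (translate G h c)"
  by (auto simp: translate_def frag_extend_diff frag_extend_add frag_extend_minus frag_extend_cmul)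

lemma translate_sum: "finite I \<Longrightarrow> translate G h (sum f I) = (\<Sum>i\<in>I. translate G h (f i))"
  by (simp add: translate_def frag_extend_sum)

lemma lin_extend_simps [simp]:
  "lin_extend G A 0 = 0" "lin_extend G A (frag_of (g, x)) = translate G g (A x)"
  "lin_extend G A (c - c') = lin_extend G A c - lin_extend G A c'"
  "lin_extend G A (c + c') = lin_extend G A c + lin_extend G A c'"
  "lin_extend G A (- c) = - lin_extend G A c"
  "lin_extend G A (frag_cmul k c) = frag_cmul k (lin_extend G A c)"
  by (auto simp: lin_extend_def frag_extend_diff frag_extend_add frag_extend_minus frag_extend_cmul)

lemma lin_extend_sum: "finite I \<Longrightarrow> lin_extend G A (sum f I) = (\<Sum>i\<in>I. lin_extend G A (f i))"
  by (simp add: lin_extend_def frag_extend_sum)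

lemma augment_translate [simp]: "augment (translate G h c) = augment c"
proof -
  have "Poly_Mapping.keys c \<subseteq> UNIV" by simp
  then show ?thesis by (induction c rule: frag_induction) auto
qed

lemma free_module_closed [simp, intro]:
  "0 \<in> free_module G X"
  "c \<in> free_module G X \<Longrightarrow> c' \<in> free_module G X \<Longrightarrow> c - c' \<in> free_module G X"
  "c \<in> free_module G X \<Longrightarrow> c' \<in> free_module G X \<Longrightarrow> c + c' \<in> free_module G X"
  "c \<in> free_module G X \<Longrightarrow> - c \<in> free_module G X"
  "c \<in> free_module G X \<Longrightarrow> frag_cmul k c \<in> free_module G X"
  unfolding free_module_def using keys_diff[of c c'] keys_add[of c c'] keys_cmul[of k c] by auto

lemma frag_of_in_free_module [simp]: "frag_of (g, x) \<in> free_module G X \<longleftrightarrow> g \<in> carrier G \<and> x \<in> X"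
  by (simp add: free_module_def)

lemma sum_in_free_module: "(\<And>i. i \<in> I \<Longrightarrow> f i \<in> free_module G X) \<Longrightarrow> sum f I \<in> free_module G X"
  by (induction I rule: infinite_finite_induct) auto

lemma free_module_induct [consumes 1, case_names zero one diff]:
  assumes "c \<in> free_module G X" "P 0" "\<And>g x. g \<in> carrier G \<Longrightarrow> x \<in> X \<Longrightarrow> P (frag_of (g, x))"
    "\<And>a b. a \<in> free_module G X \<Longrightarrow> b \<in> free_module G X \<Longrightarrow> P a \<Longrightarrow> P b \<Longrightarrow> P (a - b)"
  shows "P c"
proof -
  have "Poly_Mapping.keys c \<subseteq> carrier G \<times> X" using assms(1) by (simp add: free_module_def)
  then have "c \<in> free_module G X \<and> P c"
    by (induction c rule: frag_induction) (use assms in auto)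
  then show ?thesis ..
qed

context group
begin

lemma translate_closed:
  assumes "h \<in> carrier G" "c \<in> free_module G X" shows "translate G h c \<in> free_module G X"
  using assms(2) by (induction c rule: free_module_induct) (use assms in auto)

lemma lin_extend_closed:
  assumes "\<And>x. x \<in> X \<Longrightarrow> A x \<in> free_module G Y" "c \<in> free_module G X"
  shows "lin_extend G A c \<in> free_module G Y"
  using assms(2) by (induction c rule: free_module_induct) (use assms in \<open>auto intro: translate_closed\<close>)

lemma translate_translate:
  assumes "h \<in> carrier G" "h' \<in> carrier G" "c \<in> free_module G X"
  shows "translate G h (translate G h' c) = translate G (h \<otimes> h') c"
  using assms(3) by (induction c rule: free_module_induct) (use assms in \<open>auto simp: m_assoc\<close>)

lemma translate_one [simp]:
  assumes "c \<in> free_module G X" shows "translate G \<one> c = c"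
  using assms by (induction c rule: free_module_induct) auto

lemma lin_extend_translate:
  assumes "\<And>x. x \<in> X \<Longrightarrow> A x \<in> free_module G Y" "h \<in> carrier G" "c \<in> free_module G X"
  shows "lin_extend G A (translate G h c) = translate G h (lin_extend G A c)"
  using assms(3)
  by (induction c rule: free_module_induct) (use assms in \<open>auto simp: translate_translate[of _ _ _ Y]\<close>)

lemma lin_extend_compose:
  assumes "\<And>x. x \<in> X \<Longrightarrow> A x \<in> free_module G Y" "\<And>y. y \<in> Y \<Longrightarrow> B y \<in> free_module G Z"
    "c \<in> free_module G X"
  shows "lin_extend G B (lin_extend G A c) = lin_extend G (\<lambda>x. lin_extend G B (A x)) c"
  using assms(3)
  by (induction c rule: free_module_induct)
    (use assms in \<open>auto simp: lin_extend_translate[of Y B Z]\<close>)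

lemma lin_extend_diff_fun:
  assumes "c \<in> free_module G X"
  shows "lin_extend G (\<lambda>x. A x - B x) c = lin_extend G A c - lin_extend G B c"
  using assms by (induction c rule: free_module_induct) auto

lemma lin_extend_cong:
  assumes "\<And>x. x \<in> X \<Longrightarrow> A x = B x" "c \<in> free_module G X"
  shows "lin_extend G A c = lin_extend G B c"
  using assms(2) by (induction c rule: free_module_induct) (use assms in auto)

lemma lin_extend_frag_of_one [simp]:
  assumes "c \<in> free_module G X"
  shows "lin_extend G (\<lambda>x. frag_of (\<one>, x)) c = c"
  using assms by (induction c rule: free_module_induct) auto

lemma augment_lin_extend:
  assumes "\<And>x. x \<in> X \<Longrightarrow> augment (A x) = frag_of ()" "c \<in> free_module G X"
  shows "augment (lin_extend G A c) = augment c"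
  using assms(2) by (induction c rule: free_module_induct) (use assms in auto)

end

section \<open>Free resolutions of the trivial module\<close>

text \<open>Degree \<open>n\<close> is free on \<open>X n\<close>; the augmentation of degree \<open>0\<close> is the sum of the coefficients.\<close>

locale resolution = group G for G :: "('g, 'c) monoid_scheme" (structure) +
  fixes X :: "nat \<Rightarrow> 'x set" and d :: "'x \<Rightarrow> ('g \<times> 'x \<Rightarrow>\<^sub>0 int)"
  assumes d_0: "\<And>x. x \<in> X 0 \<Longrightarrow> d x = 0"
    and d_closed: "\<And>n x. x \<in> X (Suc n) \<Longrightarrow> d x \<in> free_module G (X n)"
    and d_d: "\<And>n x. x \<in> X (Suc (Suc n)) \<Longrightarrow> lin_extend G d (d x) = 0"
    and augment_d: "\<And>x. x \<in> X (Suc 0) \<Longrightarrow> augment (d x) = 0"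
    and exact: "\<And>n c. c \<in> free_module G (X (Suc n)) \<Longrightarrow> lin_extend G d c = 0 \<Longrightarrow>
                  \<exists>e \<in> free_module G (X (Suc (Suc n))). lin_extend G d e = c"
    and exact_0: "\<And>c. c \<in> free_module G (X 0) \<Longrightarrow> augment c = 0 \<Longrightarrow>
                  \<exists>e \<in> free_module G (X (Suc 0)). lin_extend G d e = c"
begin

text \<open>In degree 0 the augmentation plays the part of the differential; this merges
  \<open>exact\<close> and \<open>exact_0\<close> into the single statement
  \<open>cycle_exact\<close>.\<close>

definition cycle :: "nat \<Rightarrow> ('g \<times> 'x \<Rightarrow>\<^sub>0 int) \<Rightarrow> bool" where
  "cycle n c \<longleftrightarrow> c \<in> free_module G (X n) \<and> (if n = 0 then augment c = 0 else lin_extend G d c = 0)"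

lemma cycle_d: "x \<in> X (Suc n) \<Longrightarrow> cycle n (d x)"
  by (cases n) (auto simp: cycle_def d_closed d_d augment_d)

lemma cycle_exact: "cycle n c \<Longrightarrow> \<exists>e \<in> free_module G (X (Suc n)). lin_extend G d e = c"
  by (cases n) (auto simp: cycle_def exact exact_0)

end

section \<open>The comparison theorem for free resolutions\<close>

locale two_resolutions = P: resolution G X d + Q: resolution G Y e
  for G :: "('g, 'c) monoid_scheme" (structure) and X :: "nat \<Rightarrow> 'x set" and d
    and Y :: "nat \<Rightarrow> 'y set" and e
begin

text \<open>The values on basis elements of a chain map that lifts the identity of the trivial
  module.\<close>

definition chain_map :: "(nat \<Rightarrow> 'x \<Rightarrow> ('g \<times> 'y \<Rightarrow>\<^sub>0 int)) \<Rightarrow> bool" where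
  "chain_map f \<longleftrightarrow> (\<forall>n. \<forall>x \<in> X n. f n x \<in> free_module G (Y n)) \<and>
     (\<forall>x \<in> X 0. augment (f 0 x) = frag_of ()) \<and>
     (\<forall>n. \<forall>x \<in> X (Suc n). lin_extend G e (f (Suc n) x) = lin_extend G (f n) (d x))"

lemma chain_map_cycle:
  assumes "\<And>x. x \<in> X (Suc n) \<Longrightarrow> f x \<in> free_module G (Y (Suc n))"
    "\<And>x. x \<in> X n \<Longrightarrow> f' x \<in> free_module G (Y n)"
    "\<And>x. x \<in> X (Suc n) \<Longrightarrow> lin_extend G e (f x) = lin_extend G f' (d x)"
    "P.cycle (Suc n) c"
  shows "Q.cycle (Suc n) (lin_extend G f c)"
proof -
  have c: "c \<in> free_module G (X (Suc n))" "lin_extend G d c = 0"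
    using assms(4) by (auto simp: P.cycle_def)
  have "lin_extend G e (lin_extend G f c) = lin_extend G (\<lambda>x. lin_extend G e (f x)) c"
    by (rule P.lin_extend_compose[where Y = "Y (Suc n)" and Z = "Y n"]) (use assms c Q.d_closed in auto)
  also have "\<dots> = lin_extend G (\<lambda>x. lin_extend G f' (d x)) c"
    by (rule P.lin_extend_cong) (use assms c in auto)
  also have "\<dots> = lin_extend G f' (lin_extend G d c)"
    by (rule P.lin_extend_compose[where Y = "X n" and Z = "Y n", symmetric]) (use assms c P.d_closed in auto)
  finally show ?thesis
    using P.lin_extend_closed[OF assms(1) c(1)] by (simp add: Q.cycle_def c)
qed

text \<open>Existence half of the comparison theorem: the image of \<open>d x\<close> is a cycle,
  exactness of the target supplies a preimage, and freeness allows it to be prescribed as the value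
  at \<open>x\<close>.\<close>

lemma chain_map_exists:
  assumes "Y 0 \<noteq> {}"
  shows "\<exists>f. chain_map f"
proof -
  obtain y0 where y0: "y0 \<in> Y 0" using assms by blast
  \<comment> \<open>The last clause of \<open>R\<close>, that cycles go to cycles, is the invariant
    that makes the next choice possible; it spares any reference to earlier degrees.\<close>
  define R where "R n f \<longleftrightarrow> (\<forall>x \<in> X n. f x \<in> free_module G (Y n)) \<and>
     (n = 0 \<longrightarrow> (\<forall>x \<in> X 0. augment (f x) = frag_of ())) \<and>
     (\<forall>c. P.cycle n c \<longrightarrow> Q.cycle n (lin_extend G f c))" for n and f :: "'x \<Rightarrow> ('g \<times> 'y \<Rightarrow>\<^sub>0 int)"
  define S where "S n f f' \<longleftrightarrow> (\<forall>x \<in> X (Suc n). lin_extend G e (f' x) = lin_extend G f (d x))"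
    for n and f f' :: "'x \<Rightarrow> ('g \<times> 'y \<Rightarrow>\<^sub>0 int)"
  have "\<exists>f. \<forall>n. R n (f n) \<and> S n (f n) (f (Suc n))"
  proof (rule dependent_nat_choice)
    \<comment> \<open>Sending every basis element to one and the same \<open>y0\<close> preserves
      the augmentation, which is all that is required in degree 0.\<close>
    have "R 0 (\<lambda>x. frag_of (\<one>, y0))"
      using y0 by (auto simp: R_def P.cycle_def Q.cycle_def P.augment_lin_extend[where X = "X 0"]
          intro!: P.lin_extend_closed[where X = "X 0"])
    then show "\<exists>f. R 0 f" by blast
  next
    fix f n assume R: "R n f"
    have "Q.cycle n (lin_extend G f (d x))" if "x \<in> X (Suc n)" for x
      using R P.cycle_d[OF that] by (simp add: R_def)
    then have "\<forall>x. \<exists>z. x \<in> X (Suc n) \<longrightarrow> z \<in> free_module G (Y (Suc n)) \<and> lin_extend G e z = lin_extend G f (d x)"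
      using Q.cycle_exact by blast
    then obtain f' where f': "\<And>x. x \<in> X (Suc n) \<Longrightarrow> f' x \<in> free_module G (Y (Suc n))"
        "\<And>x. x \<in> X (Suc n) \<Longrightarrow> lin_extend G e (f' x) = lin_extend G f (d x)"
      by metis
    then have "R (Suc n) f'"
      using R chain_map_cycle[of n f' f] by (auto simp: R_def)
    with f' show "\<exists>f'. R (Suc n) f' \<and> S n f f'" by (auto simp: S_def)
  qed
  then obtain f where "\<And>n. R n (f n)" "\<And>n. S n (f n) (f (Suc n))" by blast
  then show ?thesis by (intro exI[of _ f]) (auto simp: R_def S_def chain_map_def)
qed

text \<open>Uniqueness half of the comparison theorem. The homotopy is again built by choosing
  preimages of cycles, now of \<open>u x - v x - h (d x)\<close>.\<close>

lemma chain_map_homotopy: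
  assumes u: "chain_map u" and v: "chain_map v"
  shows "\<exists>h. (\<forall>n. \<forall>x \<in> X n. h n x \<in> free_module G (Y (Suc n))) \<and>
     (\<forall>x \<in> X 0. lin_extend G e (h 0 x) = u 0 x - v 0 x) \<and>
     (\<forall>n. \<forall>x \<in> X (Suc n). lin_extend G e (h (Suc n) x) + lin_extend G (h n) (d x) = u (Suc n) x - v (Suc n) x)"
proof -
  have uv: "\<And>n x. x \<in> X n \<Longrightarrow> u n x \<in> free_module G (Y n)" "\<And>n x. x \<in> X n \<Longrightarrow> v n x \<in> free_module G (Y n)"
    using u v by (auto simp: chain_map_def)
  have uv0: "\<And>x. x \<in> X 0 \<Longrightarrow> Q.cycle 0 (u 0 x - v 0 x)"
    using u v uv by (auto simp: chain_map_def Q.cycle_def)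
  \<comment> \<open>The last clause of \<open>R\<close> is the homotopy identity on cycles, where
    the summand through \<open>d\<close> vanishes. Applied to the cycle \<open>d x\<close>, it shows
    that the element to be lifted in the next degree is a cycle.\<close>
  define R where "R n h \<longleftrightarrow> (\<forall>x \<in> X n. h x \<in> free_module G (Y (Suc n))) \<and>
     (n = 0 \<longrightarrow> (\<forall>x \<in> X 0. lin_extend G e (h x) = u 0 x - v 0 x)) \<and>
     (\<forall>c. P.cycle n c \<longrightarrow> lin_extend G e (lin_extend G h c) = lin_extend G (u n) c - lin_extend G (v n) c)"
    for n and h :: "'x \<Rightarrow> ('g \<times> 'y \<Rightarrow>\<^sub>0 int)"
  define S where "S n h h' \<longleftrightarrow> (\<forall>x \<in> X (Suc n). lin_extend G e (h' x) + lin_extend G h (d x) = u (Suc n) x - v (Suc n) x)"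
    for n and h h' :: "'x \<Rightarrow> ('g \<times> 'y \<Rightarrow>\<^sub>0 int)"
  have "\<exists>h. \<forall>n. R n (h n) \<and> S n (h n) (h (Suc n))"
  proof (rule dependent_nat_choice)
    have "\<forall>x. \<exists>z. x \<in> X 0 \<longrightarrow> z \<in> free_module G (Y (Suc 0)) \<and> lin_extend G e z = u 0 x - v 0 x"
      using uv0 Q.cycle_exact by blast
    then obtain h where h: "\<And>x. x \<in> X 0 \<Longrightarrow> h x \<in> free_module G (Y (Suc 0))"
        "\<And>x. x \<in> X 0 \<Longrightarrow> lin_extend G e (h x) = u 0 x - v 0 x"
      by metis
    have "lin_extend G e (lin_extend G h c) = lin_extend G (u 0) c - lin_extend G (v 0) c"
      if "c \<in> free_module G (X 0)" for c
    proof -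
      have "lin_extend G e (lin_extend G h c) = lin_extend G (\<lambda>x. lin_extend G e (h x)) c"
        by (rule P.lin_extend_compose[where Y = "Y (Suc 0)" and Z = "Y 0"]) (use that h Q.d_closed in auto)
      also have "\<dots> = lin_extend G (\<lambda>x. u 0 x - v 0 x) c"
        by (rule P.lin_extend_cong) (use h that in auto)
      finally show ?thesis using that by (simp add: P.lin_extend_diff_fun)
    qed
    with h have "R 0 h" by (simp add: R_def P.cycle_def)
    then show "\<exists>h. R 0 h" by blast
  next
    fix h n assume R: "R n h"
    have "Q.cycle (Suc n) (u (Suc n) x - v (Suc n) x - lin_extend G h (d x))" if x: "x \<in> X (Suc n)" for x
    proof -
      have "lin_extend G h (d x) \<in> free_module G (Y (Suc n))"
        by (rule P.lin_extend_closed[where X = "X n"]) (use R x P.d_closed in \<open>auto simp: R_def\<close>)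
      then show ?thesis
        using R x uv u v P.cycle_d[OF x] by (auto simp: Q.cycle_def R_def chain_map_def)
    qed
    then have "\<forall>x. \<exists>z. x \<in> X (Suc n) \<longrightarrow> z \<in> free_module G (Y (Suc (Suc n))) \<and>
        lin_extend G e z = u (Suc n) x - v (Suc n) x - lin_extend G h (d x)"
      using Q.cycle_exact by blast
    then obtain h' where h': "\<And>x. x \<in> X (Suc n) \<Longrightarrow> h' x \<in> free_module G (Y (Suc (Suc n)))"
        "\<And>x. x \<in> X (Suc n) \<Longrightarrow> lin_extend G e (h' x) = u (Suc n) x - v (Suc n) x - lin_extend G h (d x)"
      by metis
    have "lin_extend G e (lin_extend G h' c) = lin_extend G (u (Suc n)) c - lin_extend G (v (Suc n)) c"
      if "P.cycle (Suc n) c" for c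
    proof -
      have c: "c \<in> free_module G (X (Suc n))" "lin_extend G d c = 0" using that by (auto simp: P.cycle_def)
      have "lin_extend G e (lin_extend G h' c) = lin_extend G (\<lambda>x. lin_extend G e (h' x)) c"
        by (rule P.lin_extend_compose[where Y = "Y (Suc (Suc n))" and Z = "Y (Suc n)"]) (use c h' Q.d_closed in auto)
      also have "\<dots> = lin_extend G (\<lambda>x. (u (Suc n) x - v (Suc n) x) - lin_extend G h (d x)) c"
        by (rule P.lin_extend_cong) (use h' c in auto)
      also have "\<dots> = lin_extend G (u (Suc n)) c - lin_extend G (v (Suc n)) c - lin_extend G (\<lambda>x. lin_extend G h (d x)) c"
        using c by (simp add: P.lin_extend_diff_fun)
      also have "lin_extend G (\<lambda>x. lin_extend G h (d x)) c = lin_extend G h (lin_extend G d c)"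
        by (rule P.lin_extend_compose[where Y = "X n" and Z = "Y (Suc n)", symmetric]) (use R c P.d_closed in \<open>auto simp: R_def\<close>)
      finally show ?thesis by (simp add: c)
    qed
    then have "R (Suc n) h'" using h' by (simp add: R_def)
    moreover have "S n h h'" using h' by (simp add: S_def)
    ultimately show "\<exists>h'. R (Suc n) h' \<and> S n h h'" by blast
  qed
  then obtain h where "\<And>n. R n (h n)" "\<And>n. S n (h n) (h (Suc n))" by blast
  then show ?thesis by (intro exI[of _ h]) (auto simp: R_def S_def)
qed

end

section \<open>Index of subgroups\<close>

definition add_subgroup :: "'a::ab_group_add set \<Rightarrow> bool" where
  "add_subgroup A \<longleftrightarrow> 0 \<in> A \<and> (\<forall>x \<in> A. \<forall>y \<in> A. x - y \<in> A)"

lemma add_subgroupD: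
  assumes "add_subgroup A"
  shows "0 \<in> A" "x \<in> A \<Longrightarrow> y \<in> A \<Longrightarrow> x - y \<in> A" "x \<in> A \<Longrightarrow> - x \<in> A"
    "x \<in> A \<Longrightarrow> y \<in> A \<Longrightarrow> x + y \<in> A"
proof -
  show "0 \<in> A" and d: "x \<in> A \<Longrightarrow> y \<in> A \<Longrightarrow> x - y \<in> A" for x y
    using assms by (auto simp: add_subgroup_def)
  then show m: "x \<in> A \<Longrightarrow> - x \<in> A" for x by (metis diff_0)
  show "x \<in> A \<Longrightarrow> y \<in> A \<Longrightarrow> x + y \<in> A" by (metis d m diff_minus_eq_add)
qed

lemma add_subgroup_sum: "add_subgroup A \<Longrightarrow> (\<And>i. i \<in> I \<Longrightarrow> f i \<in> A) \<Longrightarrow> sum f I \<in> A"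
  by (induction I rule: infinite_finite_induct) (auto simp: add_subgroupD)

lemma add_subgroup_of_int:
  fixes x :: "'a::ring_1" shows "add_subgroup A \<Longrightarrow> x \<in> A \<Longrightarrow> of_int k * x \<in> A"
  by (induction k rule: int_induct[of _ 0]) (auto simp: add_subgroupD algebra_simps)

definition transversal :: "'a::ab_group_add set \<Rightarrow> 'a set \<Rightarrow> 'a set \<Rightarrow> bool" where
  "transversal A B T \<longleftrightarrow> T \<subseteq> A \<and> (\<forall>a \<in> A. \<exists>!t. t \<in> T \<and> a - t \<in> B)"

text \<open>Counting representatives instead of forming a quotient keeps all subgroups inside one
  additive type. Finiteness is demanded because an infinite set has \<open>card\<close> equal to
  0.\<close>

definition has_index :: "'a::ab_group_add set \<Rightarrow> 'a set \<Rightarrow> nat \<Rightarrow> bool" where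
  "has_index A B n \<longleftrightarrow> (\<exists>T. transversal A B T \<and> finite T \<and> card T = n)"

lemma transversal_exists:
  assumes "add_subgroup B" shows "\<exists>T. transversal A B T"
proof -
  define r where "r a = (SOME b. b \<in> A \<and> a - b \<in> B)" for a
  have r: "r a \<in> A \<and> a - r a \<in> B" if "a \<in> A" for a
    unfolding r_def by (rule someI[of _ a]) (use that assms in \<open>auto simp: add_subgroupD\<close>)
  \<comment> \<open>The predicate under the choice operator depends only on the coset of
    \<open>a\<close>, hence so does the chosen element.\<close>
  have eq: "r a = r a'" if "a - a' \<in> B" for a a'
  proof -
    have "a - b \<in> B \<longleftrightarrow> a' - b \<in> B" for b
      using add_subgroupD(2)[OF assms, of "a - b" "a - a'"] add_subgroupD(4)[OF assms, of "a' - b" "a - a'"] that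
      by (auto simp: algebra_simps)
    then show ?thesis unfolding r_def by simp
  qed
  have "transversal A B (r ` A)"
    unfolding transversal_def
  proof (intro conjI ballI)
    show "r ` A \<subseteq> A" using r by auto
    fix a assume a: "a \<in> A"
    show "\<exists>!t. t \<in> r ` A \<and> a - t \<in> B"
    proof (rule ex1I[of _ "r a"])
      show "r a \<in> r ` A \<and> a - r a \<in> B" using r a by auto
      fix t assume "t \<in> r ` A \<and> a - t \<in> B"
      then obtain a' where a': "a' \<in> A" "t = r a'" "a - r a' \<in> B" by auto
      then have "a - a' \<in> B"
        using r[of a'] add_subgroupD(2)[OF assms, of "a - r a'" "a' - r a'"] by simp
      with a' eq[of a a'] show "t = r a" by simp
    qed
  qed
  then show ?thesis by blast
qed

text \<open>Used in both directions, this makes the index independent of the transversal.\<close>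

lemma transversal_card_le:
  assumes "add_subgroup B" "transversal A B T" "transversal A B T'" "finite T'"
  shows "finite T \<and> card T \<le> card T'"
proof -
  have "\<forall>t. \<exists>t'. t \<in> T \<longrightarrow> t' \<in> T' \<and> t - t' \<in> B"
    using assms(2,3) unfolding transversal_def by (meson subsetD)
  then obtain f where f: "\<And>t. t \<in> T \<Longrightarrow> f t \<in> T'" "\<And>t. t \<in> T \<Longrightarrow> t - f t \<in> B" by metis
  have inj: "inj_on f T"
  proof (rule inj_onI)
    fix x y assume xy: "x \<in> T" "y \<in> T" "f x = f y"
    then have "x - y \<in> B"
      using add_subgroupD(2)[OF assms(1) f(2)[OF xy(1)] f(2)[OF xy(2)]] by simp
    moreover have "x - x \<in> B" "x \<in> A" using assms xy by (auto simp: add_subgroupD transversal_def)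
    ultimately show "x = y" using xy assms(2) unfolding transversal_def by blast
  qed
  show ?thesis
    using card_inj_on_le[OF inj _ assms(4)] inj_on_finite[OF inj _ assms(4)] f by blast
qed

lemma has_index_transversal:
  assumes "add_subgroup B" "has_index A B n" "transversal A B T"
  shows "finite T \<and> card T = n"
  using assms transversal_card_le[of B A] unfolding has_index_def by (metis le_antisym)

text \<open>Condition \<open>eq\<close> makes the induced map on cosets well defined and injective,
  \<open>surj\<close> makes it surjective. It serves both for chain maps between resolutions and for
  multiplication by \<pi>.\<close>

lemma has_index_transfer:
  assumes "has_index A B n" "f ` A \<subseteq> A'" "add_subgroup B'"
    and eq: "\<And>x y. x \<in> A \<Longrightarrow> y \<in> A \<Longrightarrow> f x - f y \<in> B' \<longleftrightarrow> x - y \<in> B"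
    and surj: "\<And>y. y \<in> A' \<Longrightarrow> \<exists>x \<in> A. y - f x \<in> B'"
  shows "has_index A' B' n"
proof -
  obtain T where T: "T \<subseteq> A" "\<And>a. a \<in> A \<Longrightarrow> \<exists>!t. t \<in> T \<and> a - t \<in> B" "finite T" "card T = n"
    using assms(1) by (auto simp: has_index_def transversal_def)
  have inj: "inj_on f T"
  proof (rule inj_onI)
    fix x y assume xy: "x \<in> T" "y \<in> T" "f x = f y"
    then have "f x - f y \<in> B'" "f x - f x \<in> B'" using assms(3) by (auto simp: add_subgroupD)
    then have "x - y \<in> B" "x - x \<in> B" using eq xy T(1) by blast+
    then show "x = y" using T(2)[of x] T(1) xy by blast
  qed
  have "transversal A' B' (f ` T)"
    unfolding transversal_def
  proof (intro conjI ballI)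
    show "f ` T \<subseteq> A'" using T(1) assms(2) by blast
    fix a' assume "a' \<in> A'"
    then obtain a where a: "a \<in> A" "a' - f a \<in> B'" using surj by blast
    have iff: "a' - f t \<in> B' \<longleftrightarrow> a - t \<in> B" if "t \<in> T" for t
    proof -
      have "a' - f t \<in> B' \<longleftrightarrow> f a - f t \<in> B'"
        using add_subgroupD(2)[OF assms(3), of "a' - f t" "a' - f a"] add_subgroupD(4)[OF assms(3), of "f a - f t" "a' - f a"] a(2)
        by (auto simp: algebra_simps)
      then show ?thesis using eq a(1) that T(1) by auto
    qed
    show "\<exists>!t. t \<in> f ` T \<and> a' - t \<in> B'"
      using T(2)[OF a(1)] iff by blast
  qed
  then show ?thesis
    using T(3,4) card_image[OF inj] by (auto simp: has_index_def)
qed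

text \<open>Multiplicativity of the index along \<open>D\<close>: the induced map from
  \<open>A / B\<close> onto \<open>D\<close> A / D \<open>B\<close> has as kernel the cycles in
  \<open>A\<close> modulo those in \<open>B\<close>.\<close>

lemma has_index_kernel:
  assumes A: "add_subgroup A" and B: "add_subgroup B" "B \<subseteq> A"
    and D: "\<And>x y. D (x - y) = D x - D y"
    and AB: "has_index A B n" and DAB: "has_index (D ` A) (D ` B) k" and k: "k > 0"
  shows "\<exists>z. has_index {a \<in> A. D a = 0} {b \<in> B. D b = 0} z \<and> k * z = n"
proof -
  let ?Z = "{a \<in> A. D a = 0}" and ?BZ = "{b \<in> B. D b = 0}"
  have D0: "D 0 = 0" using D[of 0 0] by simp
  have BZ: "add_subgroup ?BZ" using B D D0 by (auto simp: add_subgroup_def)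
  obtain U where U: "transversal ?Z ?BZ U" using transversal_exists[OF BZ] by blast
  obtain T where T: "transversal (D ` A) (D ` B) T" "finite T" "card T = k"
    using DAB by (auto simp: has_index_def)
  have "\<forall>t. \<exists>a. t \<in> T \<longrightarrow> a \<in> A \<and> D a = t" using T(1) unfolding transversal_def by blast
  then obtain l where l: "\<And>t. t \<in> T \<Longrightarrow> l t \<in> A" "\<And>t. t \<in> T \<Longrightarrow> D (l t) = t" by metis
  have UA: "u \<in> A" "D u = 0" if "u \<in> U" for u using U that by (auto simp: transversal_def)
  \<comment> \<open>Representatives of \<open>A\<close> modulo \<open>B\<close> are sums of a lifted
    representative of the image and a representative of the kernel.\<close>
  define s where "s = (\<lambda>(t, u). l t + u)"
  have Dadd: "D (x + y) = D x + D y" for x y using D[of "x + y" y] by simp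
  have uniq: "t = t' \<and> u = u'"
    if tu: "t \<in> T" "u \<in> U" "t' \<in> T" "u' \<in> U" "a \<in> A" "a - (l t + u) \<in> B" "a - (l t' + u') \<in> B" for a t u t' u'
  proof -
    have "D a - t = D (a - (l t + u))" "D a - t' = D (a - (l t' + u'))"
      using tu l UA by (auto simp: D Dadd)
    then have "D a - t \<in> D ` B" "D a - t' \<in> D ` B" using tu by auto
    then have t: "t = t'" using T(1) tu unfolding transversal_def by blast
    have "(a - (l t' + u')) - (a - (l t + u)) \<in> B" by (rule add_subgroupD(2)[OF B(1) tu(7,6)])
    then have "u - u' \<in> ?BZ" using t UA tu by (auto simp: D)
    moreover have "u - u \<in> ?BZ" using D0 B by (auto simp: add_subgroupD)
    moreover have "u \<in> ?Z" using UA tu by auto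
    ultimately have "u = u'" using U tu unfolding transversal_def by blast
    with t show ?thesis by simp
  qed
  have "transversal A B (s ` (T \<times> U))"
    unfolding transversal_def
  proof (intro conjI ballI)
    show "s ` (T \<times> U) \<subseteq> A" using l UA A by (auto simp: s_def intro: add_subgroupD)
    fix a assume a: "a \<in> A"
    then obtain t where t: "t \<in> T" "D a - t \<in> D ` B" using T(1) unfolding transversal_def by blast
    then obtain b where b: "b \<in> B" "D a - t = D b" by auto
    \<comment> \<open>Subtracting \<open>b\<close> moves \<open>a - l t\<close> into the kernel of
      \<open>D\<close> without changing its class modulo \<open>B\<close>.\<close>
    have "a - l t - b \<in> ?Z" using a t b l A B by (auto simp: D intro!: add_subgroupD)
    then obtain u where u: "u \<in> U" "a - l t - b - u \<in> ?BZ" using U unfolding transversal_def by blast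
    have "(a - l t - b - u) + b \<in> B" using u b by (intro add_subgroupD(4)[OF B(1)]) auto
    then have *: "a - (l t + u) \<in> B" by (simp add: algebra_simps)
    show "\<exists>!x. x \<in> s ` (T \<times> U) \<and> a - x \<in> B"
    proof (rule ex1I[of _ "s (t, u)"])
      show "s (t, u) \<in> s ` (T \<times> U) \<and> a - s (t, u) \<in> B" using t u * by (auto simp: s_def)
      fix x assume "x \<in> s ` (T \<times> U) \<and> a - x \<in> B"
      then obtain t' u' where x: "t' \<in> T" "u' \<in> U" "x = s (t', u')" "a - (l t' + u') \<in> B"
        by (auto simp: s_def)
      show "x = s (t, u)" using uniq[OF x(1,2) t(1) u(1) a x(4) *] x(3) by simp
    qed
  qed
  then have fin: "finite (s ` (T \<times> U))" "card (s ` (T \<times> U)) = n"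
    using has_index_transversal[OF B(1) AB] by auto
  have inj: "inj_on s (T \<times> U)"
  proof (rule inj_onI, clarify)
    fix t u t' u' assume *: "t \<in> T" "u \<in> U" "t' \<in> T" "u' \<in> U" "s (t, u) = s (t', u')"
    show "t = t' \<and> u = u'"
      by (rule uniq[of t u t' u' "s (t, u)"]) (use * l UA A B in \<open>auto simp: s_def intro: add_subgroupD\<close>)
  qed
  \<comment> \<open>As \<open>k > 0\<close>, the set \<open>T\<close> is nonempty, and finiteness of
    the product passes to \<open>U\<close>.\<close>
  have "finite U"
    using finite_imageD[OF fin(1) inj] k T(3) finite_cartesian_productD2[of T U] by fastforce
  then have "has_index ?Z ?BZ (card U)" using U by (auto simp: has_index_def)
  moreover have "k * card U = n" using fin(2) card_image[OF inj] T(3) by (simp add: card_cartesian_product)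
  ultimately show ?thesis by blast
qed

section \<open>Extension of coefficients\<close>

text \<open>\<open>tensor \<rho> m c\<close> is the image of \<open>m \<otimes> c\<close> under the identification of the tensor product of the
  coefficients with the free module on \<open>Y\<close> over the group ring with finitely supported functions
  on \<open>Y\<close>.\<close>

definition tensor ::
    "('g \<Rightarrow> 'b \<Rightarrow> 'b::comm_ring_1) \<Rightarrow> 'b \<Rightarrow> ('g \<times> 'y \<Rightarrow>\<^sub>0 int) \<Rightarrow> ('y \<Rightarrow>\<^sub>0 'b)" where
  "tensor \<rho> m c = (\<Sum>k\<in>Poly_Mapping.keys c. Poly_Mapping.single (snd k) (of_int (Poly_Mapping.lookup c k) * \<rho> (fst k) m))"

definition extend_coeffs ::
    "('g \<Rightarrow> 'b \<Rightarrow> 'b::comm_ring_1) \<Rightarrow> ('x \<Rightarrow> ('g \<times> 'y \<Rightarrow>\<^sub>0 int)) \<Rightarrow> ('x \<Rightarrow>\<^sub>0 'b) \<Rightarrow> ('y \<Rightarrow>\<^sub>0 'b)" where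
  "extend_coeffs \<rho> A c = (\<Sum>x\<in>Poly_Mapping.keys c. tensor \<rho> (Poly_Mapping.lookup c x) (A x))"

definition module_chains :: "'b::comm_ring_1 set \<Rightarrow> 'x set \<Rightarrow> ('x \<Rightarrow>\<^sub>0 'b) set" where
  "module_chains L X = {c. Poly_Mapping.keys c \<subseteq> X \<and> (\<forall>x. Poly_Mapping.lookup c x \<in> L)}"

lemma tensor_superset:
  assumes "finite S" "Poly_Mapping.keys c \<subseteq> S"
  shows "tensor \<rho> m c = (\<Sum>k\<in>S. Poly_Mapping.single (snd k) (of_int (Poly_Mapping.lookup c k) * \<rho> (fst k) m))"
  unfolding tensor_def by (rule sum.mono_neutral_left) (use assms in \<open>auto simp: in_keys_iff\<close>)

lemma tensor_simps [simp]:
  "tensor \<rho> m 0 = 0" "tensor \<rho> m (frag_of (g, y)) = Poly_Mapping.single y (\<rho> g m)"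
  "tensor \<rho> m (c + c') = tensor \<rho> m c + tensor \<rho> m c'"
  "tensor \<rho> m (- c) = - tensor \<rho> m c"
  "tensor \<rho> m (c - c') = tensor \<rho> m c - tensor \<rho> m c'"
proof -
  show "tensor \<rho> m 0 = 0" "tensor \<rho> m (frag_of (g, y)) = Poly_Mapping.single y (\<rho> g m)"
    by (simp_all add: tensor_def)
  show add: "tensor \<rho> m (c + c') = tensor \<rho> m c + tensor \<rho> m c'" for c c'
  proof -
    let ?S = "Poly_Mapping.keys c \<union> Poly_Mapping.keys c'"
    have "tensor \<rho> m (c + c') = (\<Sum>k\<in>?S. Poly_Mapping.single (snd k) (of_int (Poly_Mapping.lookup (c + c') k) * \<rho> (fst k) m))"
      by (rule tensor_superset) (auto simp: keys_add)
    also have "\<dots> = tensor \<rho> m c + tensor \<rho> m c'"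
      by (simp add: tensor_superset[of ?S] lookup_add distrib_right single_add sum.distrib)
    finally show ?thesis .
  qed
  show minus: "tensor \<rho> m (- c) = - tensor \<rho> m c" for c
    using add[of "- c" c] by (simp add: tensor_def eq_neg_iff_add_eq_0)
  show "tensor \<rho> m (c - c') = tensor \<rho> m c - tensor \<rho> m c'"
    using add[of c "- c'"] by (simp add: minus)
qed

lemma tensor_sum: "finite I \<Longrightarrow> tensor \<rho> m (sum f I) = (\<Sum>i\<in>I. tensor \<rho> m (f i))"
  by (induction I rule: finite_induct) auto

lemma module_chains_add_subgroup: "add_subgroup L \<Longrightarrow> add_subgroup (module_chains L X)"
  unfolding add_subgroup_def module_chains_def
proof (intro conjI ballI CollectI)
  fix c c' assume "c \<in> {c. Poly_Mapping.keys c \<subseteq> X \<and> (\<forall>x. Poly_Mapping.lookup c x \<in> L)}"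
    "c' \<in> {c. Poly_Mapping.keys c \<subseteq> X \<and> (\<forall>x. Poly_Mapping.lookup c x \<in> L)}" "0 \<in> L \<and> (\<forall>x\<in>L. \<forall>y\<in>L. x - y \<in> L)"
  then show "Poly_Mapping.keys (c - c') \<subseteq> X" "\<forall>x. Poly_Mapping.lookup (c - c') x \<in> L"
    using keys_diff[of c c'] by (auto simp: lookup_minus)
qed auto

lemma single_in_chains: "add_subgroup L \<Longrightarrow> x \<in> X \<Longrightarrow> m \<in> L \<Longrightarrow> Poly_Mapping.single x m \<in> module_chains L X"
  by (auto simp: module_chains_def lookup_single when_def add_subgroupD)

lemma poly_mapping_sum_single: "c = (\<Sum>x\<in>Poly_Mapping.keys c. Poly_Mapping.single x (Poly_Mapping.lookup c x))"
  by (rule poly_mapping_eqI) (auto simp: lookup_sum lookup_single when_def in_keys_iff)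

text \<open>The ring structure on the type of \<open>L\<close> serves only to write integer
  multiples as products. The laws for \<rho> are demanded on the whole type, so that identities
  between tensors need no membership conditions.\<close>

locale coefficients = group G for G :: "('g, 'c) monoid_scheme" (structure) +
  fixes \<rho> :: "'g \<Rightarrow> 'b \<Rightarrow> 'b::comm_ring_1" and L :: "'b set"
  assumes rho_diff: "\<And>g x y. \<rho> g (x - y) = \<rho> g x - \<rho> g y"
    and rho_mult: "\<And>g h x. g \<in> carrier G \<Longrightarrow> h \<in> carrier G \<Longrightarrow> \<rho> (g \<otimes> h) x = \<rho> g (\<rho> h x)"
    and rho_one [simp]: "\<And>x. \<rho> \<one> x = x"
    and L: "add_subgroup L"
    and rho_L: "\<And>g x. g \<in> carrier G \<Longrightarrow> x \<in> L \<Longrightarrow> \<rho> g x \<in> L"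
begin

lemma rho_simps [simp]: "\<rho> g 0 = 0" "\<rho> g (x - y) = \<rho> g x - \<rho> g y" "\<rho> g (- x) = - \<rho> g x"
    "\<rho> g (x + y) = \<rho> g x + \<rho> g y"
  by (metis rho_diff diff_self, rule rho_diff, metis rho_diff diff_self diff_0,
      metis rho_diff add_diff_cancel diff_add_cancel)

lemma rho_of_int [simp]: "\<rho> g (of_int k * x) = of_int k * \<rho> g x"
  by (induction k rule: int_induct[of _ 0]) (auto simp: algebra_simps)

lemma rho_sum: "\<rho> g (sum f I) = (\<Sum>i\<in>I. \<rho> g (f i))"
  by (induction I rule: infinite_finite_induct) auto

lemma tensor_add [simp]: "tensor \<rho> (m + m') c = tensor \<rho> m c + tensor \<rho> m' c"
  by (simp add: tensor_def single_add sum.distrib distrib_left)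

lemma tensor_0 [simp]: "tensor \<rho> 0 c = 0"
  by (simp add: tensor_def)

lemma extend_coeffs_superset:
  assumes "finite S" "Poly_Mapping.keys c \<subseteq> S"
  shows "extend_coeffs \<rho> A c = (\<Sum>x\<in>S. tensor \<rho> (Poly_Mapping.lookup c x) (A x))"
  unfolding extend_coeffs_def by (rule sum.mono_neutral_left) (use assms in \<open>auto simp: in_keys_iff\<close>)

lemma extend_coeffs_simps [simp]:
  "extend_coeffs \<rho> A 0 = 0"
  "extend_coeffs \<rho> A (Poly_Mapping.single x m) = tensor \<rho> m (A x)"
  "extend_coeffs \<rho> A (c + c') = extend_coeffs \<rho> A c + extend_coeffs \<rho> A c'"
  "extend_coeffs \<rho> A (- c) = - extend_coeffs \<rho> A c"
  "extend_coeffs \<rho> A (c - c') = extend_coeffs \<rho> A c - extend_coeffs \<rho> A c'"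
proof -
  show 0: "extend_coeffs \<rho> A 0 = 0" by (simp add: extend_coeffs_def)
  show "extend_coeffs \<rho> A (Poly_Mapping.single x m) = tensor \<rho> m (A x)"
    by (subst extend_coeffs_superset[of "{x}"]) auto
  show add: "extend_coeffs \<rho> A (c + c') = extend_coeffs \<rho> A c + extend_coeffs \<rho> A c'" for c c'
  proof -
    let ?S = "Poly_Mapping.keys c \<union> Poly_Mapping.keys c'"
    have "extend_coeffs \<rho> A (c + c') = (\<Sum>x\<in>?S. tensor \<rho> (Poly_Mapping.lookup (c + c') x) (A x))"
      by (rule extend_coeffs_superset) (auto simp: keys_add)
    also have "\<dots> = extend_coeffs \<rho> A c + extend_coeffs \<rho> A c'"
      by (simp add: extend_coeffs_superset[of ?S] lookup_add sum.distrib)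
    finally show ?thesis .
  qed
  show minus: "extend_coeffs \<rho> A (- c) = - extend_coeffs \<rho> A c" for c
    using add[of "- c" c] 0 by (simp add: eq_neg_iff_add_eq_0)
  show "extend_coeffs \<rho> A (c - c') = extend_coeffs \<rho> A c - extend_coeffs \<rho> A c'"
    using add[of c "- c'"] by (simp add: minus)
qed

lemma extend_coeffs_sum: "extend_coeffs \<rho> A (sum f I) = (\<Sum>i\<in>I. extend_coeffs \<rho> A (f i))"
  by (induction I rule: infinite_finite_induct) auto

lemma extend_coeffs_diff_fun:
  "extend_coeffs \<rho> (\<lambda>x. A x - B x) c = extend_coeffs \<rho> A c - extend_coeffs \<rho> B c"
  by (simp add: extend_coeffs_def sum_subtractf)

lemma extend_coeffs_add_fun:
  "extend_coeffs \<rho> (\<lambda>x. A x + B x) c = extend_coeffs \<rho> A c + extend_coeffs \<rho> B c"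
  by (simp add: extend_coeffs_def sum.distrib)

lemma extend_coeffs_cong:
  "c \<in> module_chains L X \<Longrightarrow> (\<And>x. x \<in> X \<Longrightarrow> A x = B x) \<Longrightarrow> extend_coeffs \<rho> A c = extend_coeffs \<rho> B c"
  unfolding extend_coeffs_def module_chains_def by (intro sum.cong) auto

lemma extend_coeffs_one [simp]: "extend_coeffs \<rho> (\<lambda>x. frag_of (\<one>, x)) c = c"
  by (simp add: extend_coeffs_def poly_mapping_sum_single[symmetric])

text \<open>Moving \<open>g\<close> across the tensor product reverses the order of the two group
  elements, and commutativity restores it: the left action \<rho> has to serve as a right
  action.\<close>

lemma tensor_translate:
  assumes "comm_group G" "g \<in> carrier G" "c \<in> free_module G X"
  shows "tensor \<rho> m (translate G g c) = tensor \<rho> (\<rho> g m) c"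
  using assms(3)
proof (induction c rule: free_module_induct)
  case (one h x)
  then have "\<rho> (g \<otimes> h) m = \<rho> h (\<rho> g m)"
    using assms by (metis comm_groupE(4) rho_mult)
  then show ?case by simp
qed auto

lemma extend_coeffs_tensor:
  assumes "comm_group G" "c \<in> free_module G X" "\<And>x. x \<in> X \<Longrightarrow> A x \<in> free_module G Y"
  shows "extend_coeffs \<rho> A (tensor \<rho> m c) = tensor \<rho> m (lin_extend G A c)"
  using assms(2) by (induction c rule: free_module_induct) (use assms tensor_translate[where X = Y] in auto)

text \<open>Functoriality of tensoring with the coefficients; through it every identity between maps
  of free modules becomes one between maps of chains.\<close>

lemma extend_coeffs_compose:
  assumes "comm_group G" "\<And>x. x \<in> X \<Longrightarrow> A x \<in> free_module G Y"
    "\<And>y. y \<in> Y \<Longrightarrow> B y \<in> free_module G Z" "c \<in> module_chains L X"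
  shows "extend_coeffs \<rho> B (extend_coeffs \<rho> A c) = extend_coeffs \<rho> (\<lambda>x. lin_extend G B (A x)) c"
proof -
  have "extend_coeffs \<rho> B (extend_coeffs \<rho> A c) =
      (\<Sum>x\<in>Poly_Mapping.keys c. extend_coeffs \<rho> B (tensor \<rho> (Poly_Mapping.lookup c x) (A x)))"
    by (simp add: extend_coeffs_def[of _ A] extend_coeffs_sum)
  also have "\<dots> = (\<Sum>x\<in>Poly_Mapping.keys c. tensor \<rho> (Poly_Mapping.lookup c x) (lin_extend G B (A x)))"
  proof (rule sum.cong[OF refl])
    fix x assume "x \<in> Poly_Mapping.keys c"
    then have "x \<in> X" using assms(4) by (auto simp: module_chains_def)
    then show "extend_coeffs \<rho> B (tensor \<rho> (Poly_Mapping.lookup c x) (A x)) =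
        tensor \<rho> (Poly_Mapping.lookup c x) (lin_extend G B (A x))"
      by (intro extend_coeffs_tensor[OF assms(1) assms(2) assms(3)])
  qed
  finally show ?thesis by (simp add: extend_coeffs_def)
qed

lemma tensor_in_chains:
  assumes "c \<in> free_module G X" "m \<in> L" shows "tensor \<rho> m c \<in> module_chains L X"
  using assms(1)
proof (induction c rule: free_module_induct)
  case (one g x)
  then show ?case using assms by (auto intro!: single_in_chains L rho_L)
qed (use add_subgroupD(1,2)[OF module_chains_add_subgroup[OF L]] in auto)

lemma extend_coeffs_in_chains:
  assumes "c \<in> module_chains L X" "\<And>x. x \<in> X \<Longrightarrow> A x \<in> free_module G Y"
  shows "extend_coeffs \<rho> A c \<in> module_chains L Y"
  unfolding extend_coeffs_def
proof (rule add_subgroup_sum[OF module_chains_add_subgroup[OF L]])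
  fix x assume "x \<in> Poly_Mapping.keys c"
  then have "x \<in> X" "Poly_Mapping.lookup c x \<in> L" using assms(1) by (auto simp: module_chains_def)
  then show "tensor \<rho> (Poly_Mapping.lookup c x) (A x) \<in> module_chains L Y"
    by (intro tensor_in_chains assms(2))
qed

end

section \<open>Cycles and boundaries with coefficients\<close>

locale resolution_with_coefficients = resolution G X d + coefficients G \<rho> L
  for G :: "('g, 'c) monoid_scheme" (structure) and X :: "nat \<Rightarrow> 'x set" and d
    and \<rho> :: "'g \<Rightarrow> 'b \<Rightarrow> 'b::comm_ring_1" and L +
  assumes comm: "comm_group G"
begin

text \<open>One formula covers all degrees, because \<open>d_0\<close> lets the differential vanish
  on \<open>X 0\<close>, so that all chains of degree 0 are cycles.\<close>

definition cycles :: "nat \<Rightarrow> ('x \<Rightarrow>\<^sub>0 'b) set" where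
  "cycles n = {c \<in> module_chains L (X n). extend_coeffs \<rho> d c = 0}"

definition boundaries :: "nat \<Rightarrow> ('x \<Rightarrow>\<^sub>0 'b) set" where
  "boundaries n = extend_coeffs \<rho> d ` module_chains L (X (Suc n))"

lemma boundary_in_chains: "c \<in> module_chains L (X (Suc n)) \<Longrightarrow> extend_coeffs \<rho> d c \<in> module_chains L (X n)"
  by (rule extend_coeffs_in_chains) (auto intro: d_closed)

lemma boundary_0: "c \<in> module_chains L (X 0) \<Longrightarrow> extend_coeffs \<rho> d c = 0"
  using extend_coeffs_cong[of c "X 0" d "\<lambda>_. 0"] d_0 by (simp add: extend_coeffs_def)

lemma boundary_boundary:
  assumes "c \<in> module_chains L (X (Suc n))"
  shows "extend_coeffs \<rho> d (extend_coeffs \<rho> d c) = 0"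
proof (cases n)
  case 0
  then show ?thesis using boundary_0 boundary_in_chains assms by blast
next
  case (Suc k)
  have "extend_coeffs \<rho> d (extend_coeffs \<rho> d c) = extend_coeffs \<rho> (\<lambda>x. lin_extend G d (d x)) c"
    by (rule extend_coeffs_compose[OF comm, where Y = "X n" and Z = "X k" and X = "X (Suc n)"])
      (use assms Suc d_closed in auto)
  also have "\<dots> = extend_coeffs \<rho> (\<lambda>x. 0) c"
    by (rule extend_coeffs_cong[OF assms]) (use Suc d_d in auto)
  finally show ?thesis by (simp add: extend_coeffs_def)
qed

lemma boundaries_subset: "boundaries n \<subseteq> cycles n"
  using boundary_in_chains boundary_boundary by (auto simp: boundaries_def cycles_def)

lemma add_subgroup_cycles: "add_subgroup (cycles n)"
  using add_subgroupD(1,2)[OF module_chains_add_subgroup[OF L]] by (auto simp: add_subgroup_def cycles_def)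

lemma add_subgroup_boundaries: "add_subgroup (boundaries n)"
  unfolding add_subgroup_def
proof (intro conjI ballI)
  note sub = add_subgroupD(1,2)[OF module_chains_add_subgroup[OF L, of "X (Suc n)"]]
  show "0 \<in> boundaries n" using sub by (auto simp: boundaries_def image_iff intro!: bexI[of _ 0])
  fix x y assume "x \<in> boundaries n" "y \<in> boundaries n"
  then obtain a b where "a \<in> module_chains L (X (Suc n))" "b \<in> module_chains L (X (Suc n))"
      "x = extend_coeffs \<rho> d a" "y = extend_coeffs \<rho> d b" by (auto simp: boundaries_def)
  then show "x - y \<in> boundaries n"
    using sub(2) by (auto simp: boundaries_def image_iff intro!: bexI[of _ "a - b"])
qed

end

locale two_resolutions_with_coefficients = two_resolutions G X d Y e + coefficients G \<rho> L
  for G :: "('g, 'c) monoid_scheme" (structure) and X :: "nat \<Rightarrow> 'x set" and d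
    and Y :: "nat \<Rightarrow> 'y set" and e
    and \<rho> :: "'g \<Rightarrow> 'b \<Rightarrow> 'b::comm_ring_1" and L +
  assumes comm: "comm_group G"
begin

sublocale PC: resolution_with_coefficients G X d \<rho> L by unfold_locales (rule comm_groupE(4)[OF comm])
sublocale QC: resolution_with_coefficients G Y e \<rho> L by unfold_locales (rule comm_groupE(4)[OF comm])

lemma chain_map_in_chains:
  "chain_map u \<Longrightarrow> c \<in> module_chains L (X n) \<Longrightarrow> extend_coeffs \<rho> (u n) c \<in> module_chains L (Y n)"
  by (rule extend_coeffs_in_chains) (auto simp: chain_map_def)

lemma chain_map_boundary:
  assumes "chain_map u" "c \<in> module_chains L (X (Suc n))"
  shows "extend_coeffs \<rho> e (extend_coeffs \<rho> (u (Suc n)) c) = extend_coeffs \<rho> (u n) (extend_coeffs \<rho> d c)"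
proof -
  have "extend_coeffs \<rho> e (extend_coeffs \<rho> (u (Suc n)) c) = extend_coeffs \<rho> (\<lambda>x. lin_extend G e (u (Suc n) x)) c"
    by (rule extend_coeffs_compose[OF comm, where Y = "Y (Suc n)" and Z = "Y n" and X = "X (Suc n)"])
      (use assms Q.d_closed in \<open>auto simp: chain_map_def\<close>)
  also have "\<dots> = extend_coeffs \<rho> (\<lambda>x. lin_extend G (u n) (d x)) c"
    by (rule extend_coeffs_cong[OF assms(2)]) (use assms in \<open>auto simp: chain_map_def\<close>)
  also have "\<dots> = extend_coeffs \<rho> (u n) (extend_coeffs \<rho> d c)"
    by (rule extend_coeffs_compose[OF comm, where Y = "X n" and Z = "Y n" and X = "X (Suc n)", symmetric])
      (use assms P.d_closed in \<open>auto simp: chain_map_def\<close>)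
  finally show ?thesis .
qed

lemma chain_map_cycles:
  assumes "chain_map u" "c \<in> PC.cycles n" shows "extend_coeffs \<rho> (u n) c \<in> QC.cycles n"
proof (cases n)
  case 0
  then show ?thesis using assms chain_map_in_chains QC.boundary_0 by (auto simp: PC.cycles_def QC.cycles_def)
next
  case (Suc k)
  then show ?thesis
    using assms chain_map_in_chains chain_map_boundary[of u c k] by (auto simp: PC.cycles_def QC.cycles_def)
qed

lemma chain_map_boundaries:
  assumes "chain_map u" "c \<in> PC.boundaries n" shows "extend_coeffs \<rho> (u n) c \<in> QC.boundaries n"
  using assms chain_map_boundary[of u _ n, symmetric] chain_map_in_chains[of u _ "Suc n"]
  by (auto simp: PC.boundaries_def QC.boundaries_def)

text \<open>On a cycle the summand of the homotopy that passes through \<open>d\<close> vanishes,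
  and what remains is a boundary; in degree 0 that summand is absent.\<close>

lemma chain_map_unique:
  assumes u: "chain_map u" and v: "chain_map v" and c: "c \<in> PC.cycles n"
  shows "extend_coeffs \<rho> (u n) c - extend_coeffs \<rho> (v n) c \<in> QC.boundaries n"
proof -
  obtain h where h: "\<And>n x. x \<in> X n \<Longrightarrow> h n x \<in> free_module G (Y (Suc n))"
    "\<And>x. x \<in> X 0 \<Longrightarrow> lin_extend G e (h 0 x) = u 0 x - v 0 x"
    "\<And>n x. x \<in> X (Suc n) \<Longrightarrow> lin_extend G e (h (Suc n) x) + lin_extend G (h n) (d x) = u (Suc n) x - v (Suc n) x"
    using chain_map_homotopy[OF u v] by metis
  have cX: "c \<in> module_chains L (X n)" "extend_coeffs \<rho> d c = 0" using c by (auto simp: PC.cycles_def)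
  have hc: "extend_coeffs \<rho> (h n) c \<in> module_chains L (Y (Suc n))"
    by (rule extend_coeffs_in_chains[OF cX(1)]) (rule h)
  have eh: "extend_coeffs \<rho> e (extend_coeffs \<rho> (h n) c) = extend_coeffs \<rho> (\<lambda>x. lin_extend G e (h n x)) c"
    by (rule extend_coeffs_compose[OF comm, where Y = "Y (Suc n)" and Z = "Y n" and X = "X n"])
      (use h cX Q.d_closed in auto)
  have "extend_coeffs \<rho> e (extend_coeffs \<rho> (h n) c) = extend_coeffs \<rho> (\<lambda>x. u n x - v n x) c"
  proof (cases n)
    case 0
    then show ?thesis
      unfolding eh by (intro extend_coeffs_cong[OF cX(1)]) (use h in auto)
  next
    case (Suc k)
    have "extend_coeffs \<rho> (\<lambda>x. lin_extend G (h k) (d x)) c = extend_coeffs \<rho> (h k) (extend_coeffs \<rho> d c)"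
      by (rule extend_coeffs_compose[OF comm, where Y = "X k" and Z = "Y n" and X = "X n", symmetric])
        (use Suc h cX P.d_closed in auto)
    also have "\<dots> = 0" by (simp add: cX)
    finally have "extend_coeffs \<rho> e (extend_coeffs \<rho> (h n) c) =
        extend_coeffs \<rho> (\<lambda>x. lin_extend G e (h n x) + lin_extend G (h k) (d x)) c"
      by (simp add: eh extend_coeffs_add_fun)
    also have "\<dots> = extend_coeffs \<rho> (\<lambda>x. u n x - v n x) c"
      by (rule extend_coeffs_cong[OF cX(1)]) (use h(3) Suc in auto)
    finally show ?thesis .
  qed
  then have "extend_coeffs \<rho> (u n) c - extend_coeffs \<rho> (v n) c = extend_coeffs \<rho> e (extend_coeffs \<rho> (h n) c)"
    by (simp add: extend_coeffs_diff_fun)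
  then show ?thesis using hc unfolding QC.boundaries_def by blast
qed

end

section \<open>Independence of homology from the resolution\<close>

text \<open>The composite of comparison maps there and back lifts the identity of the trivial
  module, and so does the identity; uniqueness for the resolution compared with itself does the
  rest.\<close>

lemma (in two_resolutions_with_coefficients) chain_equivalence:
  assumes "X 0 \<noteq> {}" "Y 0 \<noteq> {}"
  shows "\<exists>u v. chain_map u \<and> two_resolutions.chain_map G Y e X d v \<and>
     (\<forall>n. \<forall>c \<in> PC.cycles n. extend_coeffs \<rho> (v n) (extend_coeffs \<rho> (u n) c) - c \<in> PC.boundaries n)"
proof -
  interpret R: two_resolutions G Y e X d by unfold_locales
  interpret S: two_resolutions_with_coefficients G X d X d \<rho> L by unfold_locales (rule comm_groupE(4)[OF comm])
  obtain u where u: "chain_map u" using chain_map_exists assms by blast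
  obtain v where v: "R.chain_map v" using R.chain_map_exists assms by blast
  have uX: "u n x \<in> free_module G (Y n)" if "x \<in> X n" for n x using u that by (simp add: chain_map_def)
  have vY: "v n x \<in> free_module G (X n)" if "x \<in> Y n" for n x using v that by (simp add: R.chain_map_def)
  let ?w = "\<lambda>n x. lin_extend G (v n) (u n x)"
  have w: "S.chain_map ?w"
    unfolding S.chain_map_def
  proof (intro conjI allI ballI)
    fix n x assume "x \<in> X n"
    then show "?w n x \<in> free_module G (X n)"
      by (intro P.lin_extend_closed[of "Y n"]) (auto intro: uX vY)
  next
    fix x assume "x \<in> X 0"
    then show "augment (?w 0 x) = frag_of ()"
      using u v uX by (subst P.augment_lin_extend[of "Y 0"]) (auto simp: chain_map_def R.chain_map_def)
  next
    fix n x assume x: "x \<in> X (Suc n)"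
    have "lin_extend G d (?w (Suc n) x) = lin_extend G (\<lambda>y. lin_extend G d (v (Suc n) y)) (u (Suc n) x)"
      by (rule P.lin_extend_compose[of "Y (Suc n)" _ "X (Suc n)" _ "X n"]) (use x uX vY P.d_closed in auto)
    also have "\<dots> = lin_extend G (\<lambda>y. lin_extend G (v n) (e y)) (u (Suc n) x)"
      by (rule P.lin_extend_cong[of "Y (Suc n)"]) (use x uX v in \<open>auto simp: R.chain_map_def\<close>)
    also have "\<dots> = lin_extend G (v n) (lin_extend G e (u (Suc n) x))"
      by (rule P.lin_extend_compose[of "Y (Suc n)" _ "Y n" _ "X n", symmetric]) (use x uX vY Q.d_closed in auto)
    also have "lin_extend G e (u (Suc n) x) = lin_extend G (u n) (d x)"
      using u x by (simp add: chain_map_def)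
    also have "lin_extend G (v n) (lin_extend G (u n) (d x)) = lin_extend G (?w n) (d x)"
      by (rule P.lin_extend_compose[of "X n" _ "Y n" _ "X n"]) (use x uX vY P.d_closed in auto)
    finally show "lin_extend G d (?w (Suc n) x) = lin_extend G (?w n) (d x)" .
  qed
  have id: "S.chain_map (\<lambda>n x. frag_of (\<one>, x))"
    using P.d_closed P.translate_one P.lin_extend_frag_of_one by (fastforce simp: S.chain_map_def)
  have "extend_coeffs \<rho> (v n) (extend_coeffs \<rho> (u n) c) - c \<in> PC.boundaries n" if c: "c \<in> PC.cycles n" for n c
  proof -
    have "extend_coeffs \<rho> (v n) (extend_coeffs \<rho> (u n) c) = extend_coeffs \<rho> (?w n) c"
      by (rule extend_coeffs_compose[OF comm, where Y = "Y n" and Z = "X n" and X = "X n"])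
        (use c uX vY in \<open>auto simp: PC.cycles_def\<close>)
    then show ?thesis using S.chain_map_unique[OF w id c] by simp
  qed
  with u v show ?thesis by blast
qed

text \<open>Order and annihilation by \<open>q\<close> are the two properties that later determine
  the group. The \<open>q\<close>-fold multiple is written as a constant sum, which makes sense in
  every additive group.\<close>

lemma (in two_resolutions_with_coefficients) homology_transfer:
  assumes "X 0 \<noteq> {}" "Y 0 \<noteq> {}"
  shows "has_index (PC.cycles n) (PC.boundaries n) k \<Longrightarrow> has_index (QC.cycles n) (QC.boundaries n) k"
    and "(\<And>c. c \<in> PC.cycles n \<Longrightarrow> (\<Sum>i<q::nat. c) \<in> PC.boundaries n) \<Longrightarrow>
      c' \<in> QC.cycles n \<Longrightarrow> (\<Sum>i<q. c') \<in> QC.boundaries n"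
proof -
  interpret R: two_resolutions_with_coefficients G Y e X d \<rho> L by unfold_locales (rule comm_groupE(4)[OF comm])
  interpret S: two_resolutions_with_coefficients G X d X d \<rho> L by unfold_locales (rule comm_groupE(4)[OF comm])
  interpret S': two_resolutions_with_coefficients G Y e Y e \<rho> L by unfold_locales (rule comm_groupE(4)[OF comm])
  obtain u v where u: "chain_map u" and v: "R.chain_map v"
    and vu: "\<And>n c. c \<in> PC.cycles n \<Longrightarrow> extend_coeffs \<rho> (v n) (extend_coeffs \<rho> (u n) c) - c \<in> PC.boundaries n"
    using chain_equivalence[OF assms] by blast
  \<comment> \<open>The equivalence taken from the other side brings its own maps \<open>v'\<close>
    and \<open>u'\<close>; since lifts are unique up to boundaries, they can be exchanged for
    \<open>v\<close> and \<open>u\<close>.\<close>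
  obtain v' u' where v': "R.chain_map v'" and u': "chain_map u'"
    and uv': "\<And>n c. c \<in> QC.cycles n \<Longrightarrow> extend_coeffs \<rho> (u' n) (extend_coeffs \<rho> (v' n) c) - c \<in> QC.boundaries n"
    using R.chain_equivalence[OF assms(2,1)] by blast
  note B = add_subgroupD[OF PC.add_subgroup_boundaries] and B' = add_subgroupD[OF QC.add_subgroup_boundaries]
  have uv: "extend_coeffs \<rho> (u n) (extend_coeffs \<rho> (v n) c) - c \<in> QC.boundaries n" if c: "c \<in> QC.cycles n" for c
  proof -
    have vc: "extend_coeffs \<rho> (v n) c \<in> PC.cycles n" using R.chain_map_cycles[OF v c] .
    have 1: "extend_coeffs \<rho> (u n) (extend_coeffs \<rho> (v n) c) - extend_coeffs \<rho> (u' n) (extend_coeffs \<rho> (v n) c) \<in> QC.boundaries n"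
      by (rule chain_map_unique[OF u u' vc])
    have 2: "extend_coeffs \<rho> (u' n) (extend_coeffs \<rho> (v n) c - extend_coeffs \<rho> (v' n) c) \<in> QC.boundaries n"
      by (rule chain_map_boundaries[OF u' R.chain_map_unique[OF v v' c]])
    from B'(4)[OF B'(4)[OF 1 2] uv'[OF c]] show ?thesis by simp
  qed
  show "has_index (QC.cycles n) (QC.boundaries n) k" if "has_index (PC.cycles n) (PC.boundaries n) k"
  proof (rule has_index_transfer[OF that])
    show "extend_coeffs \<rho> (u n) ` PC.cycles n \<subseteq> QC.cycles n" using chain_map_cycles[OF u] by blast
    show "add_subgroup (QC.boundaries n)" by (rule QC.add_subgroup_boundaries)
    fix x y assume xy: "x \<in> PC.cycles n" "y \<in> PC.cycles n"
    have xyc: "x - y \<in> PC.cycles n" using add_subgroupD(2)[OF PC.add_subgroup_cycles xy] .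
    show "extend_coeffs \<rho> (u n) x - extend_coeffs \<rho> (u n) y \<in> QC.boundaries n \<longleftrightarrow> x - y \<in> PC.boundaries n"
    proof
      assume "extend_coeffs \<rho> (u n) x - extend_coeffs \<rho> (u n) y \<in> QC.boundaries n"
      then have "extend_coeffs \<rho> (v n) (extend_coeffs \<rho> (u n) (x - y)) \<in> PC.boundaries n"
        using R.chain_map_boundaries[OF v, of "extend_coeffs \<rho> (u n) (x - y)"] by simp
      from B(2)[OF this vu[OF xyc]] show "x - y \<in> PC.boundaries n" by simp
    next
      assume "x - y \<in> PC.boundaries n"
      from chain_map_boundaries[OF u this]
      show "extend_coeffs \<rho> (u n) x - extend_coeffs \<rho> (u n) y \<in> QC.boundaries n" by simp
    qed
  next
    fix y assume y: "y \<in> QC.cycles n"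
    show "\<exists>x\<in>PC.cycles n. y - extend_coeffs \<rho> (u n) x \<in> QC.boundaries n"
      using B'(3)[OF uv[OF y]] R.chain_map_cycles[OF v y] by auto
  qed
  show "(\<Sum>i<q. c') \<in> QC.boundaries n"
    if P: "\<And>c. c \<in> PC.cycles n \<Longrightarrow> (\<Sum>i<q. c) \<in> PC.boundaries n" and c: "c' \<in> QC.cycles n"
  proof -
    let ?s = "\<Sum>i<q. c'"
    have s: "?s \<in> QC.cycles n" by (rule add_subgroup_sum[OF QC.add_subgroup_cycles]) (rule c)
    have "(\<Sum>i<q. extend_coeffs \<rho> (v n) c') \<in> PC.boundaries n"
      by (rule P) (rule R.chain_map_cycles[OF v c])
    then have "extend_coeffs \<rho> (v n) ?s \<in> PC.boundaries n" by (simp only: extend_coeffs_sum)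
    from B'(2)[OF chain_map_boundaries[OF u this] uv[OF s]] show ?thesis by simp
  qed
qed

text \<open>Collapsing all basis elements to \<open>e\<close> depends only on the sum of the
  coefficients, so it kills every element of augmentation zero. This settles degree 0 of both
  explicit resolutions.\<close>

lemma frag_extend_const: "frag_extend (\<lambda>_. e) c = frag_extend (\<lambda>_. e) (augment c)"
proof -
  have "Poly_Mapping.keys c \<subseteq> UNIV" by simp
  then show ?thesis by (induction c rule: frag_induction) (auto simp: frag_extend_diff)
qed

section \<open>The bar resolution\<close>

text \<open>Only the face that drops the first entry carries a group element, namely that entry; the
  index is shifted so that the sum runs over the remaining faces. Signs are those of
  \<open>bar_boundary\<close>.\<close>

definition bar_d :: "('g, 'c) monoid_scheme \<Rightarrow> 'g list \<Rightarrow> ('g \<times> 'g list \<Rightarrow>\<^sub>0 int)" where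
  "bar_d G xs = (if xs = [] then 0 else frag_of (hd xs, tl xs) +
     (\<Sum>i<length xs. frag_cmul ((-1) ^ Suc i) (frag_of (\<one>\<^bsub>G\<^esub>, bar_face G (Suc i) xs))))"

text \<open>The contracting homotopy of the bar resolution: the coefficient becomes a new first
  entry. It is additive, but not linear over the group ring.\<close>

definition bar_contraction ::
    "('g, 'c) monoid_scheme \<Rightarrow> ('g \<times> 'g list \<Rightarrow>\<^sub>0 int) \<Rightarrow> ('g \<times> 'g list \<Rightarrow>\<^sub>0 int)" where
  "bar_contraction G = frag_extend (\<lambda>(g, xs). frag_of (\<one>\<^bsub>G\<^esub>, g # xs))"

lemma bar_contraction_simps [simp]:
  "bar_contraction G 0 = 0" "bar_contraction G (frag_of (g, xs)) = frag_of (\<one>\<^bsub>G\<^esub>, g # xs)"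
  "bar_contraction G (c - c') = bar_contraction G c - bar_contraction G c'"
  "bar_contraction G (c + c') = bar_contraction G c + bar_contraction G c'"
  "bar_contraction G (- c) = - bar_contraction G c"
  "bar_contraction G (frag_cmul k c) = frag_cmul k (bar_contraction G c)"
  by (auto simp: bar_contraction_def frag_extend_diff frag_extend_add frag_extend_minus frag_extend_cmul)

lemma bar_contraction_sum: "finite I \<Longrightarrow> bar_contraction G (sum f I) = (\<Sum>i\<in>I. bar_contraction G (f i))"
  by (simp add: bar_contraction_def frag_extend_sum)

lemma bar_face_Cons: "i < length xs \<Longrightarrow> bar_face G (Suc (Suc i)) (x # xs) = x # bar_face G (Suc i) xs"
  by (auto simp: bar_face_def)

context group
begin

lemma bar_face_in_tuples:
  assumes "xs \<in> tuples (Suc n) G" "i \<le> Suc n" shows "bar_face G i xs \<in> tuples n G"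
proof (cases "i = 0 \<or> i = Suc n")
  case True
  then show ?thesis
    using assms by (auto simp: bar_face_def tuples_def dest: in_set_butlastD list.set_sel(2)[rotated])
next
  case False
  then have "xs ! (i - 1) \<in> carrier G" "xs ! i \<in> carrier G"
    using assms by (auto simp: tuples_def subset_iff)
  then show ?thesis
    using False assms by (auto simp: bar_face_def tuples_def dest: in_set_takeD in_set_dropD)
qed

lemma bar_d_closed:
  assumes "xs \<in> tuples (Suc n) G" shows "bar_d G xs \<in> free_module G (tuples n G)"
proof -
  have "xs \<noteq> []" "length xs = Suc n" using assms by (auto simp: tuples_def)
  moreover have "frag_of (hd xs, tl xs) \<in> free_module G (tuples n G)"
    using assms by (cases xs) (auto simp: tuples_def)
  ultimately show ?thesis
    using assms unfolding bar_d_def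
    by (auto intro!: free_module_closed(3,5) sum_in_free_module simp: bar_face_in_tuples)
qed

lemma bar_contraction_closed:
  assumes "c \<in> free_module G (tuples n G)" shows "bar_contraction G c \<in> free_module G (tuples (Suc n) G)"
  using assms by (induction c rule: free_module_induct) (auto simp: tuples_def)

lemma bar_d_singleton: "bar_d G [x] = frag_of (x, []) - frag_of (\<one>, [])"
  by (simp add: bar_d_def bar_face_def)

text \<open>Apart from the first, the faces of \<open>x # xs\<close> arise by letting
  \<open>x\<close> act on the boundary of \<open>xs\<close> and turning the resulting coefficient
  into a first entry; the face that multiplies two entries comes from the action on the leading
  term. The homotopy identity is this recursion in another form.\<close>

lemma bar_d_Cons:
  assumes "x \<in> carrier G" "xs \<noteq> []"
  shows "bar_d G (x # xs) = frag_of (x, xs) - bar_contraction G (translate G x (bar_d G xs))"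
proof -
  obtain y ys where xs: "xs = y # ys" using assms by (cases xs) auto
  have "bar_face G (Suc 0) (x # xs) = (x \<otimes> y) # ys" by (simp add: bar_face_def xs)
  moreover have "(\<Sum>i<length xs. frag_cmul ((-1) ^ Suc (Suc i)) (frag_of (\<one>, bar_face G (Suc (Suc i)) (x # xs)))) =
      (\<Sum>i<length xs. frag_cmul ((-1) ^ Suc (Suc i)) (frag_of (\<one>, x # bar_face G (Suc i) xs)))"
    by (intro sum.cong) (auto simp: bar_face_Cons)
  moreover have "(\<Sum>i<length xs. frag_cmul ((-1) ^ Suc (Suc i)) (frag_of (\<one>, x # bar_face G (Suc i) xs))) =
      - (\<Sum>i<length xs. frag_cmul ((-1) ^ Suc i) (frag_of (\<one>, x # bar_face G (Suc i) xs)))"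
    by (simp add: sum_negf[symmetric])
  ultimately show ?thesis
    using assms unfolding bar_d_def
    by (simp add: sum.lessThan_Suc_shift translate_sum bar_contraction_sum xs del: sum.lessThan_Suc power_Suc)
qed

lemma bar_contraction_homotopy:
  assumes "c \<in> free_module G (tuples (Suc n) G)"
  shows "lin_extend G (bar_d G) (bar_contraction G c) + bar_contraction G (lin_extend G (bar_d G) c) = c"
  using assms
proof (induction c rule: free_module_induct)
  case (one g xs)
  then have "g # xs \<in> tuples (Suc (Suc n)) G" "xs \<noteq> []" by (auto simp: tuples_def)
  then have "lin_extend G (bar_d G) (bar_contraction G (frag_of (g, xs))) = bar_d G (g # xs)"
    by (simp add: translate_one[OF bar_d_closed])
  then show ?case using one \<open>xs \<noteq> []\<close> by (simp add: bar_d_Cons)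
next
  case (diff a b)
  have "lin_extend G (bar_d G) (bar_contraction G (a - b)) + bar_contraction G (lin_extend G (bar_d G) (a - b)) =
      (lin_extend G (bar_d G) (bar_contraction G a) + bar_contraction G (lin_extend G (bar_d G) a)) -
      (lin_extend G (bar_d G) (bar_contraction G b) + bar_contraction G (lin_extend G (bar_d G) b))"
    by simp
  then show ?case by (simp only: diff)
qed auto

lemma bar_contraction_homotopy_0:
  assumes "c \<in> free_module G (tuples 0 G)"
  shows "lin_extend G (bar_d G) (bar_contraction G c) = c - frag_extend (\<lambda>_. frag_of (\<one>, [])) c"
  using assms
proof (induction c rule: free_module_induct)
  case (one g xs)
  then have "xs = []" by (auto simp: tuples_def)
  then show ?case using one by (simp add: bar_d_singleton)
qed (auto simp: frag_extend_diff)

lemma augment_bar_d: "xs \<in> tuples (Suc 0) G \<Longrightarrow> augment (bar_d G xs) = 0"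
  by (auto simp: tuples_def length_Suc_conv bar_d_singleton)

text \<open>By the recursion and the homotopy identity, applying the differential twice to
  \<open>x # ys\<close> gives the contraction of \<open>x\<close> times the double differential of
  \<open>ys\<close>. In the lowest degree the augmentation of \<open>bar_d G ys\<close> takes the
  place of the latter.\<close>

lemma bar_d_d: "xs \<in> tuples (Suc (Suc n)) G \<Longrightarrow> lin_extend G (bar_d G) (bar_d G xs) = 0"
proof (induction n arbitrary: xs)
  case 0
  then obtain x ys where xs: "xs = x # ys" "x \<in> carrier G" "ys \<in> tuples (Suc 0) G" "ys \<noteq> []"
    by (auto simp: tuples_def length_Suc_conv)
  have w: "translate G x (bar_d G ys) \<in> free_module G (tuples 0 G)"
    by (rule translate_closed[OF xs(2) bar_d_closed[OF xs(3)]])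
  have "frag_extend (\<lambda>_. frag_of (\<one>, [])) (translate G x (bar_d G ys)) = 0"
    by (subst frag_extend_const) (simp add: augment_bar_d[OF xs(3)])
  then show ?case using xs bar_contraction_homotopy_0[OF w] by (simp add: bar_d_Cons)
next
  case (Suc n)
  then obtain x ys where xs: "xs = x # ys" "x \<in> carrier G" "ys \<in> tuples (Suc (Suc n)) G" "ys \<noteq> []"
    by (auto simp: tuples_def length_Suc_conv)
  have w: "translate G x (bar_d G ys) \<in> free_module G (tuples (Suc n) G)"
    by (rule translate_closed[OF xs(2) bar_d_closed[OF xs(3)]])
  have "lin_extend G (bar_d G) (translate G x (bar_d G ys)) = translate G x (lin_extend G (bar_d G) (bar_d G ys))"
    by (rule lin_extend_translate[OF bar_d_closed xs(2) bar_d_closed[OF xs(3)]])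
  also have "\<dots> = 0" by (simp add: Suc.IH[OF xs(3)])
  finally show ?case using xs bar_contraction_homotopy[OF w] by (simp add: bar_d_Cons)
qed

lemma bar_resolution: "resolution G (\<lambda>n. tuples n G) (bar_d G)"
proof unfold_locales
  fix n c assume "c \<in> free_module G (tuples (Suc n) G)" "lin_extend G (bar_d G) c = 0"
  then show "\<exists>e\<in>free_module G (tuples (Suc (Suc n)) G). lin_extend G (bar_d G) e = c"
    using bar_contraction_homotopy[of c n] bar_contraction_closed[of c "Suc n"] by auto
next
  fix c assume "c \<in> free_module G (tuples 0 G)" "augment c = 0"
  then show "\<exists>e\<in>free_module G (tuples (Suc 0) G). lin_extend G (bar_d G) e = c"
    using bar_contraction_homotopy_0[of c] bar_contraction_closed[of c 0] frag_extend_const[of _ c]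
    by (intro bexI[of _ "bar_contraction G c"]) simp_all
qed (simp_all add: bar_d_closed bar_d_d augment_bar_d, simp add: tuples_def bar_d_def)

end

section \<open>The tensor product of periodic resolutions\<close>

text \<open>The resolution of a cyclic group of order \<open>N\<close> has the basis elements \<open>(i, a)\<close>, standing for the
  translate by the \<open>i\<close>-th power of the generator of the basis element in degree \<open>a\<close>. In the tensor
  product over a list of cyclic groups the basis elements are lists of such pairs.\<close>

definition cyc_d :: "nat \<Rightarrow> nat \<times> nat \<Rightarrow> (nat \<times> nat \<Rightarrow>\<^sub>0 int)" where
  "cyc_d N = (\<lambda>(i, a). if a = 0 then 0
     else if odd a then frag_of (Suc i mod N, a - 1) - frag_of (i, a - 1)
     else (\<Sum>j<N. frag_of (j, a - 1)))"

text \<open>A contracting homotopy over the integers. On even degree it sends the power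
  \<open>i\<close> to a geometric sum, which inverts the difference of consecutive powers; on odd
  degree only the last power has a nonzero value, at the point where exponents wrap around.\<close>

definition cyc_s :: "nat \<Rightarrow> nat \<times> nat \<Rightarrow> (nat \<times> nat \<Rightarrow>\<^sub>0 int)" where
  "cyc_s N = (\<lambda>(i, a). if even a then (\<Sum>j<i. frag_of (j, Suc a))
     else if Suc i = N then frag_of (0, Suc a) else 0)"

text \<open>The augmentation followed by its section at \<open>(0, 0)\<close>: the complex is
  contracted onto this basis element.\<close>

definition cyc_e :: "nat \<times> nat \<Rightarrow> (nat \<times> nat \<Rightarrow>\<^sub>0 int)" where
  "cyc_e = (\<lambda>(i, a). if a = 0 then frag_of (0, 0) else 0)"

text \<open>The Koszul sign that arises when the differential passes the first tensor
  factor.\<close>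

definition cyc_sign :: "nat \<times> nat \<Rightarrow> (nat \<times> nat \<Rightarrow>\<^sub>0 int)" where
  "cyc_sign = (\<lambda>(i, a). frag_cmul ((-1) ^ a) (frag_of (i, a)))"

text \<open>The tensor product of a chain of the first factor with a chain of the remaining ones, on
  the basis of lists.\<close>

definition pcat :: "('a \<Rightarrow>\<^sub>0 int) \<Rightarrow> ('a list \<Rightarrow>\<^sub>0 int) \<Rightarrow> ('a list \<Rightarrow>\<^sub>0 int)" where
  "pcat u y = frag_extend (\<lambda>x. frag_extend (\<lambda>l. frag_of (x # l)) y) u"

fun prod_d :: "nat list \<Rightarrow> (nat \<times> nat) list \<Rightarrow> ((nat \<times> nat) list \<Rightarrow>\<^sub>0 int)" where
  "prod_d (N # Ns) (x # l) =
     pcat (cyc_d N x) (frag_of l) + pcat (cyc_sign x) (prod_d Ns l)"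
| "prod_d _ _ = 0"

text \<open>The usual contraction of a tensor product: contract the first factor and, where it has
  been projected to its base point, the rest. The second summand needs no sign, since
  \<open>cyc_e\<close> lives in degree 0.\<close>

fun prod_s :: "nat list \<Rightarrow> (nat \<times> nat) list \<Rightarrow> ((nat \<times> nat) list \<Rightarrow>\<^sub>0 int)" where
  "prod_s (N # Ns) (x # l) = pcat (cyc_s N x) (frag_of l) + pcat (cyc_e x) (prod_s Ns l)"
| "prod_s _ _ = 0"

fun prod_e :: "(nat \<times> nat) list \<Rightarrow> ((nat \<times> nat) list \<Rightarrow>\<^sub>0 int)" where
  "prod_e (x # l) = pcat (cyc_e x) (prod_e l)"
| "prod_e [] = frag_of []"

lemma frag_extend_cmul_fun: "frag_extend (\<lambda>x. frag_cmul k (f x)) c = frag_cmul k (frag_extend f c)"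
  by (simp add: frag_extend_def frag_cmul_sum mult.commute)

lemma frag_extend_add_fun: "frag_extend (\<lambda>x. f x + g x) c = frag_extend f c + frag_extend g c"
  by (simp add: frag_extend_def frag_cmul_distrib2 sum.distrib)

lemma frag_induct: "P 0 \<Longrightarrow> (\<And>x. P (frag_of x)) \<Longrightarrow> (\<And>a b. P a \<Longrightarrow> P b \<Longrightarrow> P (a - b)) \<Longrightarrow> P c"
  using frag_induction[of c UNIV P] by auto

lemma pcat_simps [simp]:
  "pcat 0 y = 0" "pcat u 0 = 0" "pcat (frag_of x) (frag_of l) = frag_of (x # l)"
  "pcat (u + u') y = pcat u y + pcat u' y" "pcat (u - u') y = pcat u y - pcat u' y"
  "pcat (- u) y = - pcat u y" "pcat (frag_cmul k u) y = frag_cmul k (pcat u y)"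
  "pcat u (y + y') = pcat u y + pcat u y'" "pcat u (y - y') = pcat u y - pcat u y'"
  "pcat u (- y) = - pcat u y" "pcat u (frag_cmul k y) = frag_cmul k (pcat u y)"
proof -
  show 1: "pcat u 0 = 0" by (simp add: pcat_def frag_extend_eq_0)
  show 2: "pcat u (y + y') = pcat u y + pcat u y'" for y y'
    by (simp add: pcat_def frag_extend_add frag_extend_add_fun)
  show 3: "pcat u (- y) = - pcat u y" for y using 1 2[of "- y" y] by (simp add: eq_neg_iff_add_eq_0)
  show "pcat u (y - y') = pcat u y - pcat u y'" using 2[of y "- y'"] 3 by simp
  show "pcat u (frag_cmul k y) = frag_cmul k (pcat u y)"
    by (simp add: pcat_def frag_extend_cmul frag_extend_cmul_fun)
qed (auto simp: pcat_def frag_extend_diff frag_extend_add frag_extend_minus frag_extend_cmul)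

lemma sum_Suc_mod:
  fixes f :: "nat \<Rightarrow> 'a::ab_group_add" shows "(\<Sum>j<N. f (Suc j mod N)) = (\<Sum>j<N. f j)"
proof (cases N)
  case (Suc k)
  have "(\<Sum>j<k. f (Suc j mod N)) = (\<Sum>j<k. f (Suc j))" by (intro sum.cong) (auto simp: Suc)
  then show ?thesis by (simp add: Suc sum.lessThan_Suc_shift[of f k] add.commute del: sum.lessThan_Suc)
     (simp add: Suc sum.lessThan_Suc add.commute)
qed simp

context
  fixes N :: nat
  notes frag_extend_simps = frag_extend_diff frag_extend_add frag_extend_sum frag_extend_minus frag_extend_cmul
begin

lemma cyc_d_d: "frag_extend (cyc_d N) (cyc_d N x) = 0"
proof (cases x)
  case (Pair i a)
  consider "a = 0" | "a = 1" | b where "a = Suc (Suc b)" by (metis One_nat_def not0_implies_Suc)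
  then show ?thesis
  proof cases
    case 3
    then show ?thesis
      using sum_Suc_mod[of "\<lambda>j. frag_of (j, b)" N]
      by (cases "even b") (simp_all add: Pair cyc_d_def frag_extend_simps sum_subtractf)
  qed (auto simp: Pair cyc_d_def frag_extend_simps)
qed

text \<open>For even \<open>a\<close> the first summand telescopes to the difference of
  \<open>(i, a)\<close> and \<open>(0, a)\<close>; the second returns \<open>(0, a)\<close> unless
  \<open>a = 0\<close>, where \<open>cyc_e\<close> accounts for it. For odd \<open>a\<close> the
  norm enters only at the last power.\<close>

lemma cyc_d_s:
  assumes "i < N"
  shows "frag_extend (cyc_d N) (cyc_s N (i, a)) + frag_extend (cyc_s N) (cyc_d N (i, a)) = frag_of (i, a) - cyc_e (i, a)"
proof (cases "even a")
  case True
  have "frag_extend (cyc_d N) (cyc_s N (i, a)) = (\<Sum>j<i. frag_of (Suc j mod N, a) - frag_of (j, a))"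
    using True by (simp add: cyc_s_def cyc_d_def frag_extend_simps)
  also have "\<dots> = (\<Sum>j<i. frag_of (Suc j, a) - frag_of (j, a))"
    by (intro sum.cong) (use assms in auto)
  also have "\<dots> = frag_of (i, a) - frag_of (0, a)"
    by (rule sum_lessThan_telescope)
  finally have 1: "frag_extend (cyc_d N) (cyc_s N (i, a)) = frag_of (i, a) - frag_of (0, a)" .
  have "frag_extend (cyc_s N) (cyc_d N (i, a)) = (if a = 0 then 0 else frag_of (0, a))"
  proof (cases "a = 0")
    case False
    then obtain b where b: "a = Suc b" by (cases a) auto
    have "frag_extend (cyc_s N) (cyc_d N (i, a)) = (\<Sum>j<N. if Suc j = N then frag_of (0, a) else 0)"
      using True unfolding b by (simp add: cyc_s_def cyc_d_def frag_extend_simps)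
    also have "\<dots> = (\<Sum>j<N. if j = N - 1 then frag_of (0, a) else 0)"
      by (intro sum.cong) (use assms in auto)
    finally show ?thesis using False assms by simp
  qed (simp add: cyc_d_def)
  with 1 show ?thesis by (auto simp: cyc_e_def)
next
  case False
  then have a: "a \<noteq> 0" by (metis even_zero)
  show ?thesis
  proof (cases "Suc i = N")
    case True
    have "(\<Sum>j<N. frag_of (j, a)) = (\<Sum>j<i. frag_of (j, a)) + frag_of (i, a)"
      unfolding True[symmetric] by simp
    then show ?thesis using True False a by (simp add: cyc_s_def cyc_d_def cyc_e_def frag_extend_simps)
  next
    case False
    then have "Suc i mod N = Suc i" using assms by simp
    then show ?thesis
      using False \<open>odd a\<close> a by (simp add: cyc_s_def cyc_d_def cyc_e_def frag_extend_simps)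
  qed
qed

lemma cyc_d_e: "frag_extend (cyc_d N) (cyc_e x) = 0"
  by (cases x) (auto simp: cyc_d_def cyc_e_def)

lemma cyc_e_d: "frag_extend cyc_e (cyc_d N x) = 0"
  by (cases x) (auto simp: cyc_d_def cyc_e_def frag_extend_simps dest: odd_pos)

lemma cyc_sign_d: "frag_extend cyc_sign (cyc_d N (i, a)) = - frag_cmul ((-1) ^ a) (cyc_d N (i, a))"
  by (cases a) (auto simp: cyc_d_def cyc_sign_def frag_extend_simps frag_cmul_sum frag_cmul_diff_distrib)

lemma cyc_sign_s: "frag_extend cyc_sign (cyc_s N (i, a)) = - frag_cmul ((-1) ^ a) (cyc_s N (i, a))"
  by (auto simp: cyc_s_def cyc_sign_def frag_extend_simps frag_cmul_sum sum_negf)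

lemma cyc_sign_e: "frag_extend cyc_sign (cyc_e x) = cyc_e x"
  by (cases x) (auto simp: cyc_e_def cyc_sign_def)

lemma cyc_s_sign: "frag_extend (cyc_s N) (cyc_sign (i, a)) = frag_cmul ((-1) ^ a) (cyc_s N (i, a))"
  by (simp add: cyc_sign_def frag_extend_simps)

lemma cyc_d_sign: "frag_extend (cyc_d N) (cyc_sign (i, a)) = frag_cmul ((-1) ^ a) (cyc_d N (i, a))"
  by (simp add: cyc_sign_def frag_extend_simps)

lemma cyc_e_sign: "frag_extend cyc_e (cyc_sign x) = cyc_e x"
  by (cases x) (auto simp: cyc_e_def cyc_sign_def frag_extend_simps)

lemma prod_d_pcat:
  "frag_extend (prod_d (N # Ns)) (pcat u y) =
    pcat (frag_extend (cyc_d N) u) y + pcat (frag_extend cyc_sign u) (frag_extend (prod_d Ns) y)"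
proof (induction u rule: frag_induct)
  case (2 x)
  show ?case by (induction y rule: frag_induct) (auto simp: frag_extend_simps)
qed (auto simp: frag_extend_simps)

lemma prod_s_pcat:
  "frag_extend (prod_s (N # Ns)) (pcat u y) =
    pcat (frag_extend (cyc_s N) u) y + pcat (frag_extend cyc_e u) (frag_extend (prod_s Ns) y)"
proof (induction u rule: frag_induct)
  case (2 x)
  show ?case by (induction y rule: frag_induct) (auto simp: frag_extend_simps)
qed (auto simp: frag_extend_simps)

end

abbreviation valid :: "nat list \<Rightarrow> (nat \<times> nat) list \<Rightarrow> bool" where
  "valid \<equiv> list_all2 (\<lambda>N x. fst x < N)"

lemma prod_d_d: "frag_extend (prod_d Ns) (prod_d Ns l) = 0"
proof (induction Ns l rule: prod_d.induct)
  case (1 N Ns x l)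
  then show ?case
    by (cases x) (simp add: frag_extend_add prod_d_pcat cyc_d_d cyc_sign_d cyc_d_sign del: minus_frag_cmul)
qed auto

lemma prod_d_s:
  "valid Ns l \<Longrightarrow> frag_extend (prod_d Ns) (prod_s Ns l) + frag_extend (prod_s Ns) (prod_d Ns l) = frag_of l - prod_e l"
proof (induction Ns l rule: prod_d.induct)
  case (1 N Ns x l)
  obtain i a where x: "x = (i, a)" by (cases x)
  have i: "i < N" and l: "valid Ns l" using 1(2) x by auto
  \<comment> \<open>The mixed terms cancel: \<open>cyc_sign\<close> anticommutes with
    \<open>cyc_s\<close>, and \<open>cyc_d\<close> and \<open>cyc_e\<close> compose to zero in both
    orders. What remains are the homotopy identities of the factors.\<close>
  have "frag_extend (prod_d (N # Ns)) (prod_s (N # Ns) (x # l)) + frag_extend (prod_s (N # Ns)) (prod_d (N # Ns) (x # l))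
    = pcat (frag_extend (cyc_d N) (cyc_s N x) + frag_extend (cyc_s N) (cyc_d N x)) (frag_of l) +
      pcat (cyc_e x) (frag_extend (prod_d Ns) (prod_s Ns l) + frag_extend (prod_s Ns) (prod_d Ns l))"
    by (simp add: frag_extend_add prod_d_pcat prod_s_pcat cyc_d_e cyc_e_d cyc_sign_e cyc_e_sign x cyc_sign_s cyc_s_sign del: minus_frag_cmul)
  also have "\<dots> = pcat (frag_of x - cyc_e x) (frag_of l) + pcat (cyc_e x) (frag_of l - prod_e l)"
    using cyc_d_s[OF i, of a] 1(1)[OF l] by (simp only: x)
  finally show ?case by simp
qed auto

section \<open>Degrees and exactness of the product complex\<close>

definition frags :: "'a set \<Rightarrow> ('a \<Rightarrow>\<^sub>0 int) set" where
  "frags S = {c. Poly_Mapping.keys c \<subseteq> S}"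

lemma frags_closed [simp, intro]:
  "0 \<in> frags S" "c \<in> frags S \<Longrightarrow> c' \<in> frags S \<Longrightarrow> c - c' \<in> frags S"
  "c \<in> frags S \<Longrightarrow> c' \<in> frags S \<Longrightarrow> c + c' \<in> frags S" "c \<in> frags S \<Longrightarrow> frag_cmul k c \<in> frags S"
  unfolding frags_def using keys_diff[of c c'] keys_add[of c c'] keys_cmul[of k c] by auto

lemma frag_of_in_frags [simp]: "frag_of x \<in> frags S \<longleftrightarrow> x \<in> S"
  by (simp add: frags_def)

lemma sum_in_frags: "(\<And>i. i \<in> I \<Longrightarrow> f i \<in> frags S) \<Longrightarrow> sum f I \<in> frags S"
  by (induction I rule: infinite_finite_induct) auto

lemma frags_induct [consumes 1, case_names zero one diff]:
  assumes "c \<in> frags S" "P 0" "\<And>x. x \<in> S \<Longrightarrow> P (frag_of x)"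
    "\<And>a b. P a \<Longrightarrow> P b \<Longrightarrow> P (a - b)"
  shows "P c"
proof -
  have "Poly_Mapping.keys c \<subseteq> S" using assms(1) by (simp add: frags_def)
  then show ?thesis by (induction c rule: frag_induction) (use assms in auto)
qed

lemma frag_extend_in_frags:
  assumes "c \<in> frags S" "\<And>x. x \<in> S \<Longrightarrow> f x \<in> frags T" shows "frag_extend f c \<in> frags T"
  using assms(1) by (induction c rule: frags_induct) (use assms in \<open>auto simp: frag_extend_diff\<close>)

lemma frag_extend_cong_frags:
  assumes "c \<in> frags S" "\<And>x. x \<in> S \<Longrightarrow> f x = g x" shows "frag_extend f c = frag_extend g c"
  using assms(1) by (induction c rule: frags_induct) (use assms in \<open>auto simp: frag_extend_diff\<close>)

lemma frag_extend_frag_extend: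
  "frag_extend f (frag_extend g c) = frag_extend (\<lambda>x. frag_extend f (g x)) c"
  by (induction c rule: frag_induct) (auto simp: frag_extend_diff)

lemma pcat_in_frags:
  assumes "u \<in> frags S" "y \<in> frags T" "\<And>x l. x \<in> S \<Longrightarrow> l \<in> T \<Longrightarrow> x # l \<in> U"
  shows "pcat u y \<in> frags U"
  unfolding pcat_def
  by (rule frag_extend_in_frags[OF assms(1)], rule frag_extend_in_frags[OF assms(2)]) (simp add: assms(3))

definition valid_deg :: "nat list \<Rightarrow> nat \<Rightarrow> (nat \<times> nat) list set" where
  "valid_deg Ns n = {l. valid Ns l \<and> sum_list (map snd l) = n}"

lemma prod_d_in_frags:
  "valid Ns l \<Longrightarrow> prod_d Ns l \<in> frags {l'. valid Ns l' \<and> Suc (sum_list (map snd l')) = sum_list (map snd l)}"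
proof (induction Ns l rule: prod_d.induct)
  case (1 N Ns x l)
  obtain i a where x: "x = (i, a)" by (cases x)
  have i: "i < N" and l: "valid Ns l" using 1(2) x by auto
  have d: "cyc_d N x \<in> frags {(j, b). j < N \<and> Suc b = a}"
    using i by (auto simp: x cyc_d_def intro!: sum_in_frags frags_closed(2))
  have s: "cyc_sign x \<in> frags {x}" by (auto simp: x cyc_sign_def)
  show ?case
    unfolding prod_d.simps
    by (intro frags_closed(3) pcat_in_frags[OF d, of _ "{l}"] pcat_in_frags[OF s 1(1)[OF l]])
      (use i l x in auto)
qed auto

lemma prod_s_in_frags:
  "valid Ns l \<Longrightarrow> prod_s Ns l \<in> frags {l'. valid Ns l' \<and> sum_list (map snd l') = Suc (sum_list (map snd l))}"
proof (induction Ns l rule: prod_s.induct)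
  case (1 N Ns x l)
  obtain i a where x: "x = (i, a)" by (cases x)
  have i: "i < N" and l: "valid Ns l" using 1(2) x by auto
  have s: "cyc_s N x \<in> frags {(j, b). j < N \<and> b = Suc a}"
    using i by (auto simp: x cyc_s_def intro!: sum_in_frags)
  have e: "cyc_e x \<in> frags {y. y = (0, 0) \<and> a = 0}" by (auto simp: x cyc_e_def)
  show ?case
    unfolding prod_s.simps
    by (intro frags_closed(3) pcat_in_frags[OF s, of _ "{l}"] pcat_in_frags[OF e 1(1)[OF l]])
      (use i l x in auto)
qed auto

lemma prod_e_0: "sum_list (map snd l) = 0 \<Longrightarrow> prod_e l = frag_of (map (\<lambda>_. (0, 0)) l)"
proof (induction l)
  case (Cons x l)
  then show ?case by (cases x) (simp add: cyc_e_def)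
qed auto

lemma prod_e_pos: "sum_list (map snd l) \<noteq> 0 \<Longrightarrow> prod_e l = 0"
proof (induction l)
  case (Cons x l)
  then show ?case by (cases x; cases "snd x = 0") (auto simp: cyc_e_def simp del: sum_list_eq_0_iff)
qed auto

lemma prod_d_0: "sum_list (map snd l) = 0 \<Longrightarrow> prod_d Ns l = 0"
  by (induction Ns l rule: prod_d.induct) (auto simp: cyc_d_def split: prod.splits)

lemma prod_exact:
  assumes c: "c \<in> frags (valid_deg Ns (Suc n))" and d: "frag_extend (prod_d Ns) c = 0"
  shows "\<exists>b \<in> frags (valid_deg Ns (Suc (Suc n))). frag_extend (prod_d Ns) b = c"
proof
  show "frag_extend (prod_s Ns) c \<in> frags (valid_deg Ns (Suc (Suc n)))"
  proof (rule frag_extend_in_frags[OF c])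
    fix l assume "l \<in> valid_deg Ns (Suc n)"
    then show "prod_s Ns l \<in> frags (valid_deg Ns (Suc (Suc n)))"
      using prod_s_in_frags[of Ns l] unfolding valid_deg_def mem_Collect_eq by (auto simp only:)
  qed
  have "frag_extend (prod_d Ns) (frag_extend (prod_s Ns) c) + frag_extend (prod_s Ns) (frag_extend (prod_d Ns) c) =
      frag_extend (\<lambda>l. frag_extend (prod_d Ns) (prod_s Ns l) + frag_extend (prod_s Ns) (prod_d Ns l)) c"
    by (simp add: frag_extend_frag_extend frag_extend_add_fun)
  also have "\<dots> = frag_extend frag_of c"
    by (rule frag_extend_cong_frags[OF c]) (simp add: valid_deg_def prod_d_s prod_e_pos)
  finally show "frag_extend (prod_d Ns) (frag_extend (prod_s Ns) c) = c"
    by (simp add: d frag_expansion[symmetric])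
qed

text \<open>In degree 0 \<open>prod_e\<close> sends every basis element to the same list of zeros,
  so the error term of the homotopy is the augmentation times that list.\<close>

lemma prod_exact_0:
  assumes c: "c \<in> frags (valid_deg Ns 0)" and aug: "augment c = 0"
  shows "\<exists>b \<in> frags (valid_deg Ns (Suc 0)). frag_extend (prod_d Ns) b = c"
proof
  show "frag_extend (prod_s Ns) c \<in> frags (valid_deg Ns (Suc 0))"
  proof (rule frag_extend_in_frags[OF c])
    fix l assume "l \<in> valid_deg Ns 0"
    then show "prod_s Ns l \<in> frags (valid_deg Ns (Suc 0))"
      using prod_s_in_frags[of Ns l] unfolding valid_deg_def mem_Collect_eq by (auto simp only:)
  qed
  have "frag_extend (prod_d Ns) (frag_extend (prod_s Ns) c) =
      frag_extend (\<lambda>l. frag_of l + frag_cmul (-1) (frag_of (map (\<lambda>_. (0, 0)) Ns))) c"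
    unfolding frag_extend_frag_extend
  proof (rule frag_extend_cong_frags[OF c])
    fix l assume "l \<in> valid_deg Ns 0"
    then have l: "valid Ns l" "sum_list (map snd l) = 0" "length l = length Ns"
      by (auto simp: valid_deg_def dest: list_all2_lengthD)
    then show "frag_extend (prod_d Ns) (prod_s Ns l) = frag_of l + frag_cmul (-1) (frag_of (map (\<lambda>_. (0, 0)) Ns))"
      using prod_d_s[OF l(1)] by (simp add: prod_d_0 prod_e_0 map_replicate_const)
  qed
  also have "\<dots> = frag_extend frag_of c - frag_extend (\<lambda>_. frag_of (map (\<lambda>_. (0, 0)) Ns)) c"
    by (simp add: frag_extend_add_fun frag_extend_cmul_fun del: frag_cmul_minus_one) simp
  also have "frag_extend (\<lambda>_. frag_of (map (\<lambda>_. (0, 0)) Ns)) c = 0"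
    by (subst frag_extend_const) (simp add: aug)
  finally show "frag_extend (prod_d Ns) (frag_extend (prod_s Ns) c) = c"
    by (simp add: frag_expansion[symmetric])
qed

section \<open>The Koszul resolution of a finite abelian group\<close>

fun power_product :: "('g, 'c) monoid_scheme \<Rightarrow> ('g \<times> nat) list \<Rightarrow> nat list \<Rightarrow> 'g" where
  "power_product G ((t, N) # ts) (i # is) = t [^]\<^bsub>G\<^esub> i \<otimes>\<^bsub>G\<^esub> power_product G ts is"
| "power_product G _ _ = \<one>\<^bsub>G\<^esub>"

definition cons_frag :: "nat \<Rightarrow> ('g \<times> nat list \<Rightarrow>\<^sub>0 int) \<Rightarrow> ('g \<times> nat list \<Rightarrow>\<^sub>0 int)" where
  "cons_frag a = frag_extend (\<lambda>(g, \<beta>). frag_of (g, a # \<beta>))"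

text \<open>The form of \<open>prod_d\<close> over the group ring: a basis element is a
  multi-degree, and exponents have become group coefficients. The first factor contributes
  \<open>t - 1\<close> or the norm of \<open>t\<close>, the others follow with the Koszul
  sign.\<close>

fun koszul_d :: "('g, 'c) monoid_scheme \<Rightarrow> ('g \<times> nat) list \<Rightarrow> nat list \<Rightarrow> ('g \<times> nat list \<Rightarrow>\<^sub>0 int)" where
  "koszul_d G ((t, N) # ts) (a # \<alpha>) =
     (if a = 0 then 0
      else if odd a then frag_of (t, (a - 1) # \<alpha>) - frag_of (\<one>\<^bsub>G\<^esub>, (a - 1) # \<alpha>)
      else (\<Sum>j<N. frag_of (t [^]\<^bsub>G\<^esub> j, (a - 1) # \<alpha>)))
     + frag_cmul ((-1) ^ a) (cons_frag a (koszul_d G ts \<alpha>))"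
| "koszul_d G _ _ = 0"

definition multidegrees :: "nat \<Rightarrow> nat \<Rightarrow> nat list set" where
  "multidegrees s n = {\<alpha>. length \<alpha> = s \<and> sum_list \<alpha> = n}"

lemma cons_frag_simps [simp]:
  "cons_frag a 0 = 0" "cons_frag a (frag_of (g, \<beta>)) = frag_of (g, a # \<beta>)"
  "cons_frag a (c - c') = cons_frag a c - cons_frag a c'" "cons_frag a (c + c') = cons_frag a c + cons_frag a c'"
  "cons_frag a (- c) = - cons_frag a c" "cons_frag a (frag_cmul k c) = frag_cmul k (cons_frag a c)"
  by (auto simp: cons_frag_def frag_extend_diff frag_extend_add frag_extend_minus frag_extend_cmul)

lemma cons_frag_closed:
  assumes "c \<in> free_module G X" "\<And>x. x \<in> X \<Longrightarrow> a # x \<in> Y" shows "cons_frag a c \<in> free_module G Y"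
  using assms(1) by (induction c rule: free_module_induct) (use assms(2) in auto)

lemma augment_cons_frag [simp]: "augment (cons_frag a c) = augment c"
  by (induction c rule: frag_induct) auto

lemma koszul_d_0: "sum_list \<alpha> = 0 \<Longrightarrow> koszul_d G ts \<alpha> = 0"
  by (induction G ts \<alpha> rule: koszul_d.induct) auto

lemma augment_koszul_d: "sum_list \<alpha> = Suc 0 \<Longrightarrow> augment (koszul_d G ts \<alpha>) = 0"
proof (induction G ts \<alpha> rule: koszul_d.induct)
  case (1 G t N ts a \<alpha>)
  then consider "a = 0" "sum_list \<alpha> = Suc 0" | "a = Suc 0" "sum_list \<alpha> = 0" by fastforce
  then show ?case by cases (use 1 in \<open>simp_all add: koszul_d_0\<close>)
qed auto

text \<open>The group is the internal direct product of cyclic subgroups; \<open>bij\<close>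
  expresses this by unique exponents below the orders, which matches the bound in
  \<open>valid\<close>.\<close>

locale abelian_generators = comm_group G for G :: "('g, 'c) monoid_scheme" (structure) +
  fixes ts :: "('g \<times> nat) list"
  assumes ts: "\<And>t N. (t, N) \<in> set ts \<Longrightarrow> t \<in> carrier G \<and> t [^] N = \<one>"
    and bij: "bij_betw (power_product G ts) {is. list_all2 (\<lambda>x i. i < snd x) ts is} (carrier G)"
begin

lemma power_product_closed:
  "set us \<subseteq> set ts \<Longrightarrow> power_product G us is \<in> carrier G"
proof (induction us arbitrary: "is")
  case (Cons x us)
  then show ?case using ts by (cases x; cases "is") auto
qed auto

lemma nat_pow_mod:
  assumes "(t, N) \<in> set ts" shows "t [^] (i mod N) = t [^] i"
proof -
  have t: "t \<in> carrier G" "t [^] N = \<one>" using ts assms by auto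
  have "t [^] i = t [^] (N * (i div N) + i mod N)" by simp
  also have "\<dots> = t [^] (i mod N)"
    using t by (simp only: nat_pow_mult[symmetric] nat_pow_pow[symmetric] nat_pow_one) simp
  finally show ?thesis by simp
qed

text \<open>Exponents are multiplied out to a group element and degrees are kept. Along this
  bijection of bases the product complex, exact over the integers, becomes a complex over the group
  ring.\<close>

definition to_group :: "('g \<times> nat) list \<Rightarrow> (nat \<times> nat) list \<Rightarrow> 'g \<times> nat list" where
  "to_group us l = (power_product G us (map fst l), map snd l)"

lemma to_group_pcat:
  "frag_extend (frag_of \<circ> to_group ((t, N) # us)) (pcat u y) =
   frag_extend (\<lambda>(i, a). frag_extend (\<lambda>(g, \<beta>). frag_of (t [^] i \<otimes> g, a # \<beta>)) (frag_extend (frag_of \<circ> to_group us) y)) u"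
proof (induction u rule: frag_induct)
  case (2 x)
  show ?case
    by (induction y rule: frag_induct) (cases x, auto simp: frag_extend_diff to_group_def split: prod.splits)
qed (auto simp: frag_extend_diff)

lemma koszul_d_closed:
  "set us \<subseteq> set ts \<Longrightarrow> length \<alpha> = length us \<Longrightarrow> sum_list \<alpha> = Suc n \<Longrightarrow>
    koszul_d G us \<alpha> \<in> free_module G (multidegrees (length us) n)"
proof (induction us arbitrary: \<alpha> n)
  case (Cons x us)
  obtain t N where x: "x = (t, N)" by (cases x)
  obtain a \<beta> where \<alpha>: "\<alpha> = a # \<beta>" using Cons by (cases \<alpha>) auto
  have t: "t \<in> carrier G" using Cons ts x by auto
  have 1: "cons_frag a (koszul_d G us \<beta>) \<in> free_module G (multidegrees (Suc (length us)) n)"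
  proof (cases "sum_list \<beta>")
    case 0
    then show ?thesis by (simp add: koszul_d_0)
  next
    case (Suc k)
    then have "koszul_d G us \<beta> \<in> free_module G (multidegrees (length us) k)"
      using Cons \<alpha> by auto
    then show ?thesis
      by (rule cons_frag_closed) (use Suc Cons \<alpha> in \<open>auto simp: multidegrees_def\<close>)
  qed
  have "a > 0 \<Longrightarrow> (a - 1) # \<beta> \<in> multidegrees (Suc (length us)) n"
    using Cons \<alpha> by (auto simp: multidegrees_def)
  then show ?case
    using t 1 unfolding x \<alpha> koszul_d.simps by (auto intro!: free_module_closed(2,3,5) sum_in_free_module)
qed auto

lemma translate_cons_frag:
  assumes "c \<in> free_module G X" "t \<in> carrier G" "g \<in> carrier G"
  shows "translate G (t \<otimes> g) (cons_frag a c) =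
    frag_extend (\<lambda>(h, \<beta>). frag_of (t \<otimes> h, a # \<beta>)) (translate G g c)"
  using assms(1) by (induction c rule: free_module_induct) (use assms in \<open>auto simp: frag_extend_diff m_assoc\<close>)

lemma sum_add_mod:
  fixes f :: "nat \<Rightarrow> 'z::ab_group_add" shows "(\<Sum>j<N. f ((i + j) mod N)) = (\<Sum>j<N. f j)"
proof (induction i)
  case 0
  then show ?case by (intro sum.cong) auto
next
  case (Suc i)
  have "(\<Sum>j<N. f ((Suc i + j) mod N)) = (\<Sum>j<N. f ((i + Suc j mod N) mod N))"
    by (simp add: mod_add_right_eq)
  also have "\<dots> = (\<Sum>j<N. f ((i + j) mod N))" by (rule sum_Suc_mod[of "\<lambda>j. f ((i + j) mod N)"])
  finally show ?case using Suc by simp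
qed

text \<open>In the first factor translation shifts the exponent modulo \<open>N\<close>, which
  permutes the terms of the norm and moves both terms of \<open>t - 1\<close> alike; so
  \<open>to_group\<close> intertwines the two differentials.\<close>

lemma koszul_d_translate:
  "set us \<subseteq> set ts \<Longrightarrow> list_all2 (\<lambda>x y. fst y < snd x) us l \<Longrightarrow>
   translate G (power_product G us (map fst l)) (koszul_d G us (map snd l)) =
   frag_extend (frag_of \<circ> to_group us) (prod_d (map snd us) l)"
proof (induction us arbitrary: l)
  case (Cons x us)
  obtain t N where x: "x = (t, N)" by (cases x)
  obtain i a l' where l: "l = (i, a) # l'" using Cons by (cases l) auto
  define g where "g = power_product G us (map fst l')"
  define \<beta> where "\<beta> = map snd l'"
  have t: "t \<in> carrier G" and tN: "(t, N) \<in> set ts" using Cons ts x by auto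
  have g: "g \<in> carrier G" using Cons unfolding g_def by (intro power_product_closed) auto
  have IH: "frag_extend (frag_of \<circ> to_group us) (prod_d (map snd us) l') = translate G g (koszul_d G us \<beta>)"
    using Cons.IH[of l'] Cons.prems l by (simp add: g_def \<beta>_def comp_def)
  have K: "koszul_d G us \<beta> \<in> free_module G UNIV"
  proof (cases "sum_list \<beta>")
    case (Suc k)
    then have "koszul_d G us \<beta> \<in> free_module G (multidegrees (length us) k)"
      using Cons l by (intro koszul_d_closed) (auto simp: \<beta>_def dest: list_all2_lengthD)
    then show ?thesis by (auto simp: free_module_def)
  qed (simp add: koszul_d_0)
  let ?\<psi> = "\<lambda>j b. frag_of (t [^] (j::nat) \<otimes> g, b # \<beta>)"
  have \<psi>: "frag_extend (frag_of \<circ> to_group ((t, N) # us)) (pcat u (frag_of l')) = frag_extend (\<lambda>(j, b). ?\<psi> j b) u" for u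
    unfolding to_group_pcat by (simp add: to_group_def g_def \<beta>_def)
  have 1: "translate G (t [^] i \<otimes> g) (if a = 0 then 0
      else if odd a then frag_of (t, (a - 1) # \<beta>) - frag_of (\<one>, (a - 1) # \<beta>)
      else (\<Sum>j<N. frag_of (t [^] j, (a - 1) # \<beta>))) = frag_extend (\<lambda>(j, b). ?\<psi> j b) (cyc_d N (i, a))"
  proof -
    have eq: "t [^] i \<otimes> g \<otimes> t [^] j = t [^] ((i + j) mod N) \<otimes> g" for j
      using t g by (simp add: nat_pow_mod[OF tN] nat_pow_mult[symmetric] m_ac)
    have "(\<Sum>j<N. frag_of (t [^] i \<otimes> g \<otimes> t [^] j, (a - 1) # \<beta>)) = (\<Sum>j<N. ?\<psi> j (a - 1))"
      unfolding eq by (rule sum_add_mod[of "\<lambda>j. ?\<psi> j (a - 1)"])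
    moreover have "t [^] i \<otimes> g \<otimes> t = t [^] (Suc i mod N) \<otimes> g"
      using eq[of 1] t by simp
    ultimately show ?thesis
      using t g by (simp add: cyc_d_def translate_sum frag_extend_sum frag_extend_diff)
  qed
  have 2: "translate G (t [^] i \<otimes> g) (frag_cmul ((-1) ^ a) (cons_frag a (koszul_d G us \<beta>))) =
      frag_extend (frag_of \<circ> to_group ((t, N) # us)) (pcat (cyc_sign (i, a)) (prod_d (map snd us) l'))"
    unfolding to_group_pcat IH
    using translate_cons_frag[OF K, of "t [^] i" g a] t g by (simp add: cyc_sign_def frag_extend_cmul)
  show ?case
    using arg_cong2[OF 1 2, of "(+)"]
    by (simp only: x l list.map fst_conv snd_conv power_product.simps koszul_d.simps prod_d.simps
        translate_simps frag_extend_add \<psi> g_def[symmetric] \<beta>_def[symmetric])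
qed simp

abbreviation "Ns \<equiv> map snd ts"

lemma valid_iff: "valid Ns l \<longleftrightarrow> list_all2 (\<lambda>x y. fst y < snd x) ts l"
  by (simp add: list_all2_map1)

lemma bij_to_group: "bij_betw (to_group ts) (valid_deg Ns n) (carrier G \<times> multidegrees (length ts) n)"
proof (rule bij_betwI')
  fix l l' assume "l \<in> valid_deg Ns n" "l' \<in> valid_deg Ns n"
  then have v: "list_all2 (\<lambda>x i. i < snd x) ts (map fst l)" "list_all2 (\<lambda>x i. i < snd x) ts (map fst l')"
    by (auto simp: valid_deg_def valid_iff list_all2_map2)
  show "to_group ts l = to_group ts l' \<longleftrightarrow> l = l'"
  proof
    assume eq: "to_group ts l = to_group ts l'"
    then have "map fst l = map fst l'" using bij_betw_imp_inj_on[OF bij] v by (auto simp: to_group_def inj_on_def)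
    moreover have "map snd l = map snd l'" using eq by (simp add: to_group_def)
    ultimately have "zip (map fst l) (map snd l) = zip (map fst l') (map snd l')" by simp
    then show "l = l'" by (simp only: zip_map_fst_snd)
  qed simp
next
  fix l assume "l \<in> valid_deg Ns n"
  then show "to_group ts l \<in> carrier G \<times> multidegrees (length ts) n"
    by (auto simp: to_group_def valid_deg_def multidegrees_def valid_iff power_product_closed dest: list_all2_lengthD)
next
  fix y assume "y \<in> carrier G \<times> multidegrees (length ts) n"
  then obtain g \<alpha> where y: "y = (g, \<alpha>)" "g \<in> carrier G" "length \<alpha> = length ts" "sum_list \<alpha> = n"
    by (auto simp: multidegrees_def)
  then have "g \<in> power_product G ts ` {is. list_all2 (\<lambda>x i. i < snd x) ts is}"
    using bij_betw_imp_surj_on[OF bij] by simp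
  then obtain "is" where i: "list_all2 (\<lambda>x i. i < snd x) ts is" "power_product G ts is = g"
    by blast
  then have len: "length is = length \<alpha>" using y by (auto dest: list_all2_lengthD)
  have "list_all2 (\<lambda>x i. i < snd x) ts (map fst (zip is \<alpha>))"
    using i(1) len by simp
  then have "list_all2 (\<lambda>x y. fst y < snd x) ts (zip is \<alpha>)"
    by (simp only: list_all2_map2)
  then show "\<exists>l\<in>valid_deg Ns n. y = to_group ts l"
    using i y len by (intro bexI[of _ "zip is \<alpha>"]) (auto simp: valid_deg_def valid_iff to_group_def)
qed

lemma koszul_lin_extend:
  assumes "c \<in> frags (valid_deg Ns n)"
  shows "lin_extend G (koszul_d G ts) (frag_extend (frag_of \<circ> to_group ts) c) =
    frag_extend (frag_of \<circ> to_group ts) (frag_extend (prod_d Ns) c)"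
  using assms
proof (induction c rule: frags_induct)
  case (one l)
  then show ?case
    using koszul_d_translate[OF subset_refl, of l]
    by (simp add: to_group_def[of ts l] valid_deg_def valid_iff comp_def)
qed (auto simp: frag_extend_diff)

lemma to_group_frag_inverse:
  assumes "c \<in> free_module G (multidegrees (length ts) n)"
  obtains c' where "c' \<in> frags (valid_deg Ns n)" "frag_extend (frag_of \<circ> to_group ts) c' = c"
proof -
  let ?T = "inv_into (valid_deg Ns n) (to_group ts)"
  have c: "c \<in> frags (carrier G \<times> multidegrees (length ts) n)"
    using assms by (simp add: frags_def free_module_def)
  have "frag_extend (frag_of \<circ> to_group ts) (frag_extend (frag_of \<circ> ?T) c) = frag_extend frag_of c"
    unfolding frag_extend_frag_extend
    by (rule frag_extend_cong_frags[OF c]) (simp add: bij_betw_inv_into_right[OF bij_to_group])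
  moreover have "frag_extend (frag_of \<circ> ?T) c \<in> frags (valid_deg Ns n)"
    using bij_betw_imp_surj_on[OF bij_to_group, of n]
    by (intro frag_extend_in_frags[OF c]) (simp add: inv_into_into)
  ultimately show ?thesis using that by (metis frag_expansion)
qed

lemma to_group_frag_inj:
  assumes "c \<in> frags (valid_deg Ns n)" "frag_extend (frag_of \<circ> to_group ts) c = 0" shows "c = 0"
proof -
  let ?T = "inv_into (valid_deg Ns n) (to_group ts)"
  have "frag_extend (frag_of \<circ> ?T) (frag_extend (frag_of \<circ> to_group ts) c) = frag_extend frag_of c"
    unfolding frag_extend_frag_extend
    by (rule frag_extend_cong_frags[OF assms(1)]) (simp add: bij_betw_inv_into_left[OF bij_to_group])
  then show ?thesis using assms(2) by (simp flip: frag_expansion)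
qed

lemma to_group_frag_closed:
  assumes "c \<in> frags (valid_deg Ns n)"
  shows "frag_extend (frag_of \<circ> to_group ts) c \<in> free_module G (multidegrees (length ts) n)"
proof -
  have "frag_extend (frag_of \<circ> to_group ts) c \<in> frags (carrier G \<times> multidegrees (length ts) n)"
    using bij_betw_imp_surj_on[OF bij_to_group, of n] by (intro frag_extend_in_frags[OF assms]) auto
  then show ?thesis by (simp add: frags_def free_module_def)
qed

lemma prod_d_frags:
  assumes "c \<in> frags (valid_deg Ns (Suc n))" shows "frag_extend (prod_d Ns) c \<in> frags (valid_deg Ns n)"
proof (rule frag_extend_in_frags[OF assms])
  fix l assume "l \<in> valid_deg Ns (Suc n)"
  then show "prod_d Ns l \<in> frags (valid_deg Ns n)"
    using prod_d_in_frags[of Ns l] by (simp add: valid_deg_def)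
qed

text \<open>Exactness concerns abelian groups only, so it passes along \<open>to_group\<close>,
  although the contraction that proves it is not compatible with the action of
  \<open>G\<close>.\<close>

lemma koszul_resolution: "resolution G (multidegrees (length ts)) (koszul_d G ts)"
proof unfold_locales
  fix x assume "x \<in> multidegrees (length ts) 0"
  then show "koszul_d G ts x = 0" by (intro koszul_d_0) (simp add: multidegrees_def)
next
  fix n x assume "x \<in> multidegrees (length ts) (Suc n)"
  then show "koszul_d G ts x \<in> free_module G (multidegrees (length ts) n)"
    by (intro koszul_d_closed) (auto simp: multidegrees_def)
next
  fix x assume "x \<in> multidegrees (length ts) (Suc 0)"
  then show "augment (koszul_d G ts x) = 0" by (intro augment_koszul_d) (simp add: multidegrees_def)
next
  fix n x assume x: "x \<in> multidegrees (length ts) (Suc (Suc n))"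
  then obtain c where c: "c \<in> frags (valid_deg Ns (Suc (Suc n)))" "frag_extend (frag_of \<circ> to_group ts) c = frag_of (\<one>, x)"
    using to_group_frag_inverse[of "frag_of (\<one>, x)" "Suc (Suc n)"] by auto
  have "koszul_d G ts x \<in> free_module G (multidegrees (length ts) (Suc n))"
    using x by (intro koszul_d_closed) (auto simp: multidegrees_def)
  then have "koszul_d G ts x = frag_extend (frag_of \<circ> to_group ts) (frag_extend (prod_d Ns) c)"
    using koszul_lin_extend[OF c(1)] by (simp add: c)
  then have "lin_extend G (koszul_d G ts) (koszul_d G ts x) =
      frag_extend (frag_of \<circ> to_group ts) (frag_extend (prod_d Ns) (frag_extend (prod_d Ns) c))"
    using koszul_lin_extend[OF prod_d_frags[OF c(1)]] by simp
  then show "lin_extend G (koszul_d G ts) (koszul_d G ts x) = 0"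
    by (simp add: frag_extend_frag_extend[of "prod_d Ns"] prod_d_d frag_extend_eq_0)
next
  fix n c assume c: "c \<in> free_module G (multidegrees (length ts) (Suc n))" "lin_extend G (koszul_d G ts) c = 0"
  obtain c' where c': "c' \<in> frags (valid_deg Ns (Suc n))" "frag_extend (frag_of \<circ> to_group ts) c' = c"
    using to_group_frag_inverse[OF c(1)] .
  then have "frag_extend (prod_d Ns) c' = 0"
    using koszul_lin_extend[OF c'(1)] c prod_d_frags[OF c'(1)] by (intro to_group_frag_inj) auto
  then obtain b where b: "b \<in> frags (valid_deg Ns (Suc (Suc n)))" "frag_extend (prod_d Ns) b = c'"
    using prod_exact[OF c'(1)] by blast
  show "\<exists>e\<in>free_module G (multidegrees (length ts) (Suc (Suc n))). lin_extend G (koszul_d G ts) e = c"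
    using to_group_frag_closed[OF b(1)] koszul_lin_extend[OF b(1)] b(2) c'(2) by (intro bexI[of _ "frag_extend (frag_of \<circ> to_group ts) b"]) simp_all
next
  fix c assume c: "c \<in> free_module G (multidegrees (length ts) 0)" "augment c = 0"
  obtain c' where c': "c' \<in> frags (valid_deg Ns 0)" "frag_extend (frag_of \<circ> to_group ts) c' = c"
    using to_group_frag_inverse[OF c(1)] .
  have "augment (frag_extend (frag_of \<circ> to_group ts) c') = augment c'"
    by (induction c' rule: frag_induct) (auto simp: frag_extend_diff)
  then have "augment c' = 0" using c c' by simp
  then obtain b where b: "b \<in> frags (valid_deg Ns (Suc 0))" "frag_extend (prod_d Ns) b = c'"
    using prod_exact_0[OF c'(1)] by blast
  show "\<exists>e\<in>free_module G (multidegrees (length ts) (Suc 0)). lin_extend G (koszul_d G ts) e = c"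
    using to_group_frag_closed[OF b(1)] koszul_lin_extend[OF b(1)] b(2) c'(2) by (intro bexI[of _ "frag_extend (frag_of \<circ> to_group ts) b"]) simp_all
qed

end

section \<open>Homology of the Koszul complex\<close>

text \<open>Raising the first exponent is a homotopy from multiplication by \<open>t\<^sub>0 - 1\<close> to zero.\<close>

fun koszul_h :: "('g, 'c) monoid_scheme \<Rightarrow> nat list \<Rightarrow> ('g \<times> nat list \<Rightarrow>\<^sub>0 int)" where
  "koszul_h G (a # \<alpha>) = (if even a then frag_of (\<one>\<^bsub>G\<^esub>, Suc a # \<alpha>) else 0)"
| "koszul_h G [] = 0"

lemma add_subgroup_image:
  assumes "add_subgroup A" "\<And>x y. f (x - y) = f x - f y" shows "add_subgroup (f ` A)"
  unfolding add_subgroup_def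
proof (intro conjI ballI)
  have "f 0 = 0" using assms(2)[of 0 0] by simp
  then show "0 \<in> f ` A" using add_subgroupD(1)[OF assms(1)] by (intro image_eqI[of _ _ 0]) simp_all
  fix x y assume "x \<in> f ` A" "y \<in> f ` A"
  then obtain a b where "a \<in> A" "b \<in> A" "x = f a" "y = f b" by blast
  then show "x - y \<in> f ` A"
    using add_subgroupD(2)[OF assms(1)] assms(2) by (intro image_eqI[of _ _ "a - b"]) simp_all
qed

section \<open>Ranks of the Koszul resolution and the numbers \<open>nu\<close>\<close>

lemma finite_multidegrees: "finite (multidegrees s n)"
  unfolding multidegrees_def
  by (rule finite_subset[OF _ finite_lists_length_eq[of "{..n}" s]]) (use member_le_sum_list in auto)

lemma card_multidegrees: "card (multidegrees s n) = (n + s - 1) choose n"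
  by (simp add: multidegrees_def card_length_sum_list)

lemma nu_0: "nu 0 s = 1"
  by (simp add: nu_def)

text \<open>Up to the sign \<open>(-1) ^ n\<close>, the binomial coefficient of \<open>- s\<close>
  over \<open>n\<close> counts the multi-degrees of total degree \<open>n\<close>; thus
  \<open>nu\<close> is the alternating sum of ranks, which is the recursion met by the orders of
  homology.\<close>

lemma nu_Suc:
  assumes "s \<ge> 1" shows "nu (Suc n) s = of_nat (card (multidegrees s (Suc n))) - nu n s"
proof -
  have "(- of_nat s gchoose Suc n :: rat) = (-1) ^ Suc n * ((of_nat s + of_nat (Suc n) - 1) gchoose Suc n)"
    by (rule gbinomial_minus)
  also have "(of_nat s + of_nat (Suc n) - 1 :: rat) = of_nat (Suc n + s - 1)"
    using assms by (simp add: of_nat_diff)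
  finally have "(-1) ^ Suc n * (- of_nat s gchoose Suc n :: rat) = of_nat (card (multidegrees s (Suc n)))"
    by (simp add: card_multidegrees binomial_gbinomial power_mult_distrib[symmetric])
  then show ?thesis by (simp add: nu_def distrib_left)
qed

lemma single_sum_distrib: "Poly_Mapping.single y (sum f I) = (\<Sum>i\<in>I. Poly_Mapping.single y (f i))"
  by (induction I rule: infinite_finite_induct) (auto simp: single_add)

lemma lookup_tensor_cons_frag:
  "Poly_Mapping.lookup (tensor \<rho> m (cons_frag a c)) (b # \<beta>) = (if b = a then Poly_Mapping.lookup (tensor \<rho> m c) \<beta> else 0)"
  "Poly_Mapping.lookup (tensor \<rho> m (cons_frag a c)) [] = 0"
proof -
  show "Poly_Mapping.lookup (tensor \<rho> m (cons_frag a c)) (b # \<beta>) = (if b = a then Poly_Mapping.lookup (tensor \<rho> m c) \<beta> else 0)"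
  proof (induction c rule: frag_induct)
    case (2 x) then show ?case by (cases x) (simp add: lookup_single when_def)
  qed (auto simp: lookup_minus)
  show "Poly_Mapping.lookup (tensor \<rho> m (cons_frag a c)) [] = 0"
  proof (induction c rule: frag_induct)
    case (2 x) then show ?case by (cases x) (simp add: lookup_single when_def)
  qed (auto simp: lookup_minus)
qed

text \<open>The arithmetic of the lattice is abstracted into properties of \<pi>. The generator
  \<open>t\<^sub>0\<close> stands first in \<open>ts\<close> because \<open>koszul_h\<close> works
  on the first exponent, and \<open>p_dvd\<close> is what makes the norms divisible by
  \<pi>.\<close>

locale koszul_coefficients = abelian_generators G ts + coefficients G \<rho> L
  for G :: "('g, 'c) monoid_scheme" (structure) and ts :: "('g \<times> nat) list"
    and \<rho> :: "'g \<Rightarrow> 'b \<Rightarrow> 'b::comm_ring_1" and L +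
  fixes p :: nat and t\<^sub>0 :: 'g and N\<^sub>0 :: nat and us :: "('g \<times> nat) list" and \<pi> :: "'b \<Rightarrow> 'b"
  defines "\<pi> \<equiv> \<lambda>x. \<rho> t\<^sub>0 x - x"
  assumes ts_Cons: "ts = (t\<^sub>0, N\<^sub>0) # us"
    and p_dvd: "\<And>t N. (t, N) \<in> set ts \<Longrightarrow> p dvd N"
    and pi_inj: "\<And>x. x \<in> L \<Longrightarrow> \<pi> x = 0 \<Longrightarrow> x = 0"
    and rho_pi: "\<And>g x. g \<in> carrier G \<Longrightarrow> x \<in> L \<Longrightarrow> \<rho> g x - x \<in> \<pi> ` L"
    and p_pi: "\<And>x. x \<in> L \<Longrightarrow> of_nat p * x \<in> \<pi> ` L"
    and index_pi: "has_index L (\<pi> ` L) p"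
    and p_gt_1: "p > 1"
begin

abbreviation "s \<equiv> length ts"
abbreviation "X \<equiv> multidegrees s"
abbreviation "d \<equiv> koszul_d G ts"
text \<open>Multiplication by \<pi> on chains, induced by a map of free modules, so that the
  composition lemmas apply; \<open>lookup_pi_map\<close> shows that it acts on each
  coordinate.\<close>

abbreviation "pi_map \<equiv> extend_coeffs \<rho> (\<lambda>x. frag_of (t\<^sub>0, x) - frag_of (\<one>, x))"

sublocale K: resolution_with_coefficients G "multidegrees (length ts)" "koszul_d G ts" \<rho> L
  using koszul_resolution
  by (intro resolution_with_coefficients.intro resolution_with_coefficients_axioms.intro coefficients_axioms comm_group_axioms)

lemma t0: "t\<^sub>0 \<in> carrier G"
  using ts[of t\<^sub>0 N\<^sub>0] by (simp add: ts_Cons)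

lemma pi_simps [simp]: "\<pi> 0 = 0" "\<pi> (x - y) = \<pi> x - \<pi> y" "\<pi> (x + y) = \<pi> x + \<pi> y"
  by (simp_all add: \<pi>_def)

lemma add_subgroup_pi_L: "add_subgroup (\<pi> ` L)"
  by (rule add_subgroup_image[OF L pi_simps(2)])

lemma lookup_pi_map: "Poly_Mapping.lookup (pi_map c) x = \<pi> (Poly_Mapping.lookup c x)"
proof -
  have "pi_map c = (\<Sum>y\<in>Poly_Mapping.keys c. Poly_Mapping.single y (\<pi> (Poly_Mapping.lookup c y)))"
    by (simp add: extend_coeffs_def \<pi>_def single_diff)
  then show ?thesis
    by (auto simp: lookup_sum lookup_single when_def in_keys_iff)
qed

lemma pi_map_image: "pi_map ` module_chains L Y = module_chains (\<pi> ` L) Y"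
proof (intro equalityI subsetI)
  fix c assume "c \<in> pi_map ` module_chains L Y"
  then obtain b where b: "b \<in> module_chains L Y" "c = pi_map b" by blast
  have "x \<in> Y" if "x \<in> Poly_Mapping.keys c" for x
  proof -
    have "Poly_Mapping.lookup b x \<noteq> 0" using that by (auto simp: b lookup_pi_map in_keys_iff)
    then show ?thesis using b by (auto simp: module_chains_def in_keys_iff)
  qed
  then show "c \<in> module_chains (\<pi> ` L) Y" using b by (auto simp: module_chains_def lookup_pi_map)
next
  fix c assume c: "c \<in> module_chains (\<pi> ` L) Y"
  then have "\<forall>x. \<exists>y. y \<in> L \<and> Poly_Mapping.lookup c x = \<pi> y" by (auto simp: module_chains_def)
  then obtain f where f: "\<And>x. f x \<in> L" "\<And>x. Poly_Mapping.lookup c x = \<pi> (f x)" by metis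
  define b where "b = (\<Sum>x\<in>Poly_Mapping.keys c. Poly_Mapping.single x (f x))"
  have "b \<in> module_chains L Y"
    unfolding b_def using c f
    by (intro add_subgroup_sum[OF module_chains_add_subgroup[OF L]] single_in_chains[OF L]) (auto simp: module_chains_def)
  moreover have "pi_map b = c"
  proof (rule poly_mapping_eqI)
    fix x
    have "Poly_Mapping.lookup b x = (if x \<in> Poly_Mapping.keys c then f x else 0)"
      by (simp add: b_def lookup_sum lookup_single when_def)
    then show "Poly_Mapping.lookup (pi_map b) x = Poly_Mapping.lookup c x"
      by (auto simp: lookup_pi_map f(2)[symmetric] in_keys_iff)
  qed
  ultimately show "c \<in> pi_map ` module_chains L Y" by blast
qed

lemma pi_map_inj: "c \<in> module_chains L Y \<Longrightarrow> pi_map c = 0 \<Longrightarrow> c = 0"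
proof (rule poly_mapping_eqI)
  fix x assume c: "c \<in> module_chains L Y" "pi_map c = 0"
  have "\<pi> (Poly_Mapping.lookup c x) = 0" using lookup_pi_map[of c x] c(2) by simp
  then show "Poly_Mapping.lookup c x = Poly_Mapping.lookup 0 x"
    using c(1) pi_inj by (simp add: module_chains_def)
qed

lemma koszul_d_free: "\<alpha> \<in> X n \<Longrightarrow> d \<alpha> \<in> free_module G UNIV"
proof (cases n)
  case 0
  assume "\<alpha> \<in> X n" then show ?thesis using 0 by (simp add: K.d_0)
next
  case (Suc k)
  assume "\<alpha> \<in> X n" then show ?thesis using Suc K.d_closed by (auto simp: free_module_def)
qed

lemma koszul_d_free_us: "length \<beta> = length us \<Longrightarrow> koszul_d G us \<beta> \<in> free_module G UNIV"
proof (cases "sum_list \<beta>")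
  case (Suc k)
  assume "length \<beta> = length us"
  then have "koszul_d G us \<beta> \<in> free_module G (multidegrees (length us) k)"
    using Suc by (intro koszul_d_closed) (auto simp: ts_Cons)
  then show ?thesis by (auto simp: free_module_def)
qed (simp add: koszul_d_0)

lemma koszul_h_free: "koszul_h G \<alpha> \<in> free_module G UNIV"
  by (cases \<alpha>) auto

lemma koszul_h_closed: "\<alpha> \<in> X n \<Longrightarrow> koszul_h G \<alpha> \<in> free_module G (X (Suc n))"
  by (cases \<alpha>) (auto simp: multidegrees_def)

lemma lin_extend_koszul_h_cons:
  assumes "c \<in> free_module G UNIV"
  shows "lin_extend G (koszul_h G) (cons_frag a c) = (if even a then cons_frag (Suc a) c else 0)"
  using assms by (induction c rule: free_module_induct) auto

text \<open>In the first factor the differential from odd to even degree is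
  \<open>t\<^sub>0 - 1\<close>. For even \<open>a\<close> it is met after raising the degree, for
  odd \<open>a\<close> before; the terms of the other factors cancel or vanish, by the sign and by
  the parity in \<open>koszul_h\<close>.\<close>

lemma koszul_homotopy:
  assumes "\<alpha> \<in> X n"
  shows "lin_extend G d (koszul_h G \<alpha>) + lin_extend G (koszul_h G) (d \<alpha>) = frag_of (t\<^sub>0, \<alpha>) - frag_of (\<one>, \<alpha>)"
proof -
  obtain a \<beta> where \<alpha>: "\<alpha> = a # \<beta>" "length \<beta> = length us"
    using assms by (cases \<alpha>) (auto simp: multidegrees_def ts_Cons)
  note K = koszul_d_free_us[OF \<alpha>(2)]
  show ?thesis
  proof (cases "even a")
    case True
    have "Suc a # \<beta> \<in> X (Suc n)" using assms \<alpha> by (auto simp: multidegrees_def)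
    then have "lin_extend G d (koszul_h G \<alpha>) = d (Suc a # \<beta>)"
      using True \<alpha> K.d_closed by (simp add: translate_one[OF koszul_d_free[of _ "Suc n"]])
    moreover have "lin_extend G (koszul_h G) (d \<alpha>) = cons_frag (Suc a) (koszul_d G us \<beta>)"
    proof (cases "a = 0")
      case False
      then have "odd (a - 1)" using True by simp
      then show ?thesis
        using True t0 by (simp add: ts_Cons \<alpha> lin_extend_koszul_h_cons[OF K] lin_extend_sum)
    qed (simp add: ts_Cons \<alpha> lin_extend_koszul_h_cons[OF K])
    ultimately show ?thesis
      using True by (simp add: ts_Cons \<alpha>)
  next
    case False
    then have "Suc (a - Suc 0) = a" "even (a - 1)" "a \<noteq> 0" by (auto elim: oddE)
    then show ?thesis
      using False t0 by (simp add: ts_Cons \<alpha> lin_extend_koszul_h_cons[OF K])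
  qed
qed

lemma pi_map_cycle:
  assumes "z \<in> K.cycles n"
  shows "pi_map z = extend_coeffs \<rho> d (extend_coeffs \<rho> (koszul_h G) z)"
proof -
  have z: "z \<in> module_chains L (X n)" "extend_coeffs \<rho> d z = 0" using assms by (auto simp: K.cycles_def)
  have "pi_map z = extend_coeffs \<rho> (\<lambda>x. lin_extend G d (koszul_h G x) + lin_extend G (koszul_h G) (d x)) z"
    by (rule extend_coeffs_cong[OF z(1)]) (use koszul_homotopy in simp)
  also have "\<dots> = extend_coeffs \<rho> (\<lambda>x. lin_extend G d (koszul_h G x)) z + extend_coeffs \<rho> (\<lambda>x. lin_extend G (koszul_h G) (d x)) z"
    by (rule extend_coeffs_add_fun)
  also have "extend_coeffs \<rho> (\<lambda>x. lin_extend G d (koszul_h G x)) z = extend_coeffs \<rho> d (extend_coeffs \<rho> (koszul_h G) z)"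
    by (rule extend_coeffs_compose[OF comm_group_axioms, where X = "X n" and Y = "X (Suc n)" and Z = "X n", symmetric])
      (use z koszul_h_closed K.d_closed in auto)
  also have "extend_coeffs \<rho> (\<lambda>x. lin_extend G (koszul_h G) (d x)) z = extend_coeffs \<rho> (koszul_h G) (extend_coeffs \<rho> d z)"
    by (rule extend_coeffs_compose[OF comm_group_axioms, where X = "X n" and Y = UNIV and Z = UNIV, symmetric])
      (use z koszul_h_free koszul_d_free in auto)
  finally show ?thesis by (simp add: z)
qed

text \<open>Since \<open>G\<close> is commutative, \<open>t\<^sub>0 - 1\<close> is an endomorphism
  of the resolution.\<close>

lemma pi_map_boundary:
  assumes "c \<in> module_chains L (X n)"
  shows "extend_coeffs \<rho> d (pi_map c) = pi_map (extend_coeffs \<rho> d c)"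
proof (cases n)
  case 0
  have "pi_map c \<in> module_chains L (X 0)"
    by (rule extend_coeffs_in_chains) (use assms 0 t0 in auto)
  then show ?thesis using assms 0 K.boundary_0 by simp
next
  case (Suc k)
  have d: "d x \<in> free_module G (X k)" if "x \<in> X n" for x using that Suc K.d_closed by simp
  have P: "lin_extend G (\<lambda>x. frag_of (t\<^sub>0, x) - frag_of (\<one>, x)) c = translate G t\<^sub>0 c - c"
    if "c \<in> free_module G Y" for c :: "'g \<times> nat list \<Rightarrow>\<^sub>0 int" and Y
    using that by (induction c rule: free_module_induct) (use t0 in \<open>auto simp: m_comm\<close>)
  have "extend_coeffs \<rho> d (pi_map c) = extend_coeffs \<rho> (\<lambda>x. lin_extend G d (frag_of (t\<^sub>0, x) - frag_of (\<one>, x))) c"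
    by (rule extend_coeffs_compose[OF comm_group_axioms, where X = "X n" and Y = "X n" and Z = "X k"])
      (use assms d t0 in auto)
  also have "\<dots> = extend_coeffs \<rho> (\<lambda>x. lin_extend G (\<lambda>x. frag_of (t\<^sub>0, x) - frag_of (\<one>, x)) (d x)) c"
    by (rule extend_coeffs_cong[OF assms]) (simp add: P[OF d] translate_one[OF d])
  also have "\<dots> = pi_map (extend_coeffs \<rho> d c)"
    by (rule extend_coeffs_compose[OF comm_group_axioms, where X = "X n" and Y = "X k" and Z = "X k", symmetric])
      (use assms d t0 in auto)
  finally show ?thesis .
qed

section \<open>Divisibility of the differential by \<pi>\<close>

definition pi_valued :: "('x \<Rightarrow>\<^sub>0 'b) set" where
  "pi_valued = {c. \<forall>x. Poly_Mapping.lookup c x \<in> \<pi> ` L}"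

lemma add_subgroup_pi_valued: "add_subgroup pi_valued"
  using add_subgroupD(1,2)[OF add_subgroup_pi_L] by (auto simp: add_subgroup_def pi_valued_def lookup_minus)

lemma single_pi_valued: "m \<in> \<pi> ` L \<Longrightarrow> Poly_Mapping.single x m \<in> pi_valued"
  using add_subgroupD(1)[OF add_subgroup_pi_L] by (auto simp: pi_valued_def lookup_single when_def)

text \<open>The coefficients \<open>t - 1\<close> are covered by \<open>rho_pi\<close>. A norm is a
  sum of terms \<open>t [^] j - 1\<close> plus the integer \<open>N\<close>, a multiple of
  \<open>p\<close>, so \<open>rho_pi\<close> and \<open>p_pi\<close> cover it as well.\<close>

lemma tensor_koszul_d:
  "set vs \<subseteq> set ts \<Longrightarrow> m \<in> L \<Longrightarrow> tensor \<rho> m (koszul_d G vs \<alpha>) \<in> pi_valued"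
proof (induction vs arbitrary: \<alpha>)
  case Nil
  then show ?case using add_subgroupD(1)[OF add_subgroup_pi_valued] by simp
next
  case (Cons x vs)
  note sub = add_subgroupD[OF add_subgroup_pi_valued] and subL = add_subgroupD[OF add_subgroup_pi_L]
  obtain t N where x: "x = (t, N)" by (cases x)
  then have t: "t \<in> carrier G" and N: "p dvd N" using Cons ts p_dvd[of t N] by auto
  show ?case
  proof (cases \<alpha>)
    case Nil
    then show ?thesis using sub(1) by simp
  next
    case (Cons a \<beta>)
    have 1: "tensor \<rho> m (cons_frag a (koszul_d G vs \<beta>)) \<in> pi_valued"
    proof -
      have "Poly_Mapping.lookup (tensor \<rho> m (cons_frag a (koszul_d G vs \<beta>))) y \<in> \<pi> ` L" for y
        using Cons.IH[of \<beta>] Cons.prems subL(1) by (cases y) (auto simp: lookup_tensor_cons_frag pi_valued_def)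
      then show ?thesis by (simp add: pi_valued_def)
    qed
    have 2: "tensor \<rho> m (frag_cmul ((-1) ^ a) (cons_frag a (koszul_d G vs \<beta>))) \<in> pi_valued"
      using 1 sub(3)[OF 1] by (cases "even a") auto
    have 3: "tensor \<rho> m (frag_of (t, y) - frag_of (\<one>, y)) \<in> pi_valued" for y :: "nat list"
      using single_pi_valued[OF rho_pi[OF t \<open>m \<in> L\<close>], of y] by (simp add: single_diff)
    have 4: "tensor \<rho> m (\<Sum>j<N. frag_of (t [^] j, y)) \<in> pi_valued" for y :: "nat list"
    proof -
      obtain k where k: "N = p * k" using N by blast
      have "(\<Sum>j<N. \<rho> (t [^] j) m) = (\<Sum>j<N. \<rho> (t [^] j) m - m) + of_int (int k) * (of_nat p * m)"
        by (simp add: sum_subtractf k mult_ac)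
      also have "\<dots> \<in> \<pi> ` L"
        using t \<open>m \<in> L\<close>
        by (intro subL(4) add_subgroup_sum[OF add_subgroup_pi_L] add_subgroup_of_int[OF add_subgroup_pi_L] rho_pi p_pi) auto
      finally have "Poly_Mapping.single y (\<Sum>j<N. \<rho> (t [^] j) m) \<in> pi_valued" by (rule single_pi_valued)
      then show ?thesis by (simp add: tensor_sum single_sum_distrib)
    qed
    show ?thesis
      using sub(4)[OF _ 2] sub(1) 2 3 4 unfolding x Cons koszul_d.simps tensor_simps(3)
      by (auto simp del: tensor_simps(2-5))
  qed
qed

lemma boundary_pi_valued:
  assumes "c \<in> module_chains L (X (Suc n))"
  shows "extend_coeffs \<rho> d c \<in> pi_map ` module_chains L (X n)"
proof -
  have "extend_coeffs \<rho> d c \<in> pi_valued"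
    unfolding extend_coeffs_def using assms
    by (intro add_subgroup_sum[OF add_subgroup_pi_valued] tensor_koszul_d) (auto simp: module_chains_def)
  moreover have "extend_coeffs \<rho> d c \<in> module_chains L (X n)" by (rule K.boundary_in_chains[OF assms])
  ultimately show ?thesis
    unfolding pi_map_image by (auto simp: pi_valued_def module_chains_def)
qed

lemma pi_map_in_boundaries: "c \<in> K.cycles n \<Longrightarrow> pi_map c \<in> K.boundaries n"
proof -
  assume c: "c \<in> K.cycles n"
  have "extend_coeffs \<rho> (koszul_h G) c \<in> module_chains L (X (Suc n))"
    by (rule extend_coeffs_in_chains) (use c koszul_h_closed in \<open>auto simp: K.cycles_def\<close>)
  then show ?thesis unfolding pi_map_cycle[OF c] K.boundaries_def by blast
qed

lemma cycle_of_pi_map: "c \<in> module_chains L (X n) \<Longrightarrow> extend_coeffs \<rho> d (pi_map c) = 0 \<Longrightarrow> c \<in> K.cycles n"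
proof -
  assume c: "c \<in> module_chains L (X n)" "extend_coeffs \<rho> d (pi_map c) = 0"
  have "extend_coeffs \<rho> d c \<in> module_chains L UNIV"
    by (rule extend_coeffs_in_chains[OF c(1)]) (rule koszul_d_free)
  moreover have "pi_map (extend_coeffs \<rho> d c) = 0" using c(2) unfolding pi_map_boundary[OF c(1)] .
  ultimately have "extend_coeffs \<rho> d c = 0" by (rule pi_map_inj)
  with c show "c \<in> K.cycles n" by (simp add: K.cycles_def)
qed

text \<open>A boundary is \<open>pi_map c\<close> by divisibility, and \<open>c\<close> is a cycle
  because \<open>pi_map\<close> is injective and commutes with the differential. The converse
  inclusion is the homotopy.\<close>

lemma boundaries_eq: "K.boundaries n = pi_map ` K.cycles n"
proof (intro equalityI subsetI)
  fix b assume "b \<in> K.boundaries n"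
  then obtain e where e: "e \<in> module_chains L (X (Suc n))" "b = extend_coeffs \<rho> d e"
    by (auto simp: K.boundaries_def)
  then obtain c where c: "c \<in> module_chains L (X n)" "b = pi_map c" using boundary_pi_valued by blast
  have "extend_coeffs \<rho> d (pi_map c) = 0"
    unfolding c(2)[symmetric] e(2) by (rule K.boundary_boundary[OF e(1)])
  then show "b \<in> pi_map ` K.cycles n"
    using cycle_of_pi_map[OF c(1)] c(2) by blast
next
  fix b assume "b \<in> pi_map ` K.cycles n"
  then show "b \<in> K.boundaries n" using pi_map_in_boundaries by blast
qed

text \<open>By \<open>p_pi\<close> the multiple is \<open>pi_map b\<close> for a chain
  \<open>b\<close>, which is a cycle by injectivity of \<open>pi_map\<close>; hence it is a
  boundary.\<close>

lemma p_cycles: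
  assumes "c \<in> K.cycles n" shows "(\<Sum>i<p. c) \<in> K.boundaries n"
proof -
  have c: "c \<in> module_chains L (X n)" "extend_coeffs \<rho> d c = 0" using assms by (auto simp: K.cycles_def)
  have "(\<Sum>i<p. c) \<in> module_chains L (X n)"
    by (rule add_subgroup_sum[OF module_chains_add_subgroup[OF L]]) (rule c)
  moreover have "Poly_Mapping.lookup (\<Sum>i<p. c) x \<in> \<pi> ` L" for x
  proof -
    have "Poly_Mapping.lookup (\<Sum>i<p. c) x = of_nat p * Poly_Mapping.lookup c x" by (simp only: lookup_sum sum_constant card_lessThan)
    then show ?thesis using p_pi c(1) by (simp add: module_chains_def)
  qed
  ultimately have "(\<Sum>i<p. c) \<in> pi_map ` module_chains L (X n)"
    unfolding pi_map_image by (simp only: module_chains_def mem_Collect_eq) blast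
  then obtain b where b: "b \<in> module_chains L (X n)" "(\<Sum>i<p. c) = pi_map b" by blast
  have "extend_coeffs \<rho> d (\<Sum>i<p. c) = 0" by (simp only: extend_coeffs_sum c sum.neutral_const)
  then have "b \<in> K.cycles n" unfolding b(2) by (rule cycle_of_pi_map[OF b(1)])
  then show ?thesis unfolding boundaries_eq b(2) by blast
qed

section \<open>Orders of the homology groups of the Koszul complex\<close>

text \<open>The quotient is a power of \<open>L / \<pi> L\<close> indexed by \<open>Y\<close>;
  representatives are chosen in each coordinate and counted as extensional functions.\<close>

lemma index_chains:
  assumes "finite Y"
  shows "has_index (module_chains L Y) (pi_map ` module_chains L Y) (p ^ card Y)"
proof -
  obtain T where T: "T \<subseteq> L" "\<And>a. a \<in> L \<Longrightarrow> \<exists>!t. t \<in> T \<and> a - t \<in> \<pi> ` L" "finite T" "card T = p"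
    using index_pi by (auto simp: has_index_def transversal_def)
  obtain r where r: "\<And>a. a \<in> L \<Longrightarrow> r a \<in> T \<and> a - r a \<in> \<pi> ` L" using T(2) by metis
  define F where "F f = (\<Sum>y\<in>Y. Poly_Mapping.single y (f y))" for f :: "_ \<Rightarrow> 'b"
  have lookup_F: "Poly_Mapping.lookup (F f) y = (if y \<in> Y then f y else 0)" for f y
    using assms by (simp add: F_def lookup_sum lookup_single when_def)
  have keys_F: "Poly_Mapping.keys (F f) \<subseteq> Y" for f
    by (auto simp: in_keys_iff lookup_F split: if_splits)
  let ?S = "F ` (Y \<rightarrow>\<^sub>E T)"
  have inj: "inj_on F (Y \<rightarrow>\<^sub>E T)"
  proof (rule inj_onI)
    fix f g assume fg: "f \<in> Y \<rightarrow>\<^sub>E T" "g \<in> Y \<rightarrow>\<^sub>E T" "F f = F g"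
    have "f y = g y" if "y \<in> Y" for y
      using that fg(3) lookup_F[of f y] lookup_F[of g y] by simp
    then show "f = g" using fg(1,2) by (intro PiE_ext)
  qed
  have "transversal (module_chains L Y) (pi_map ` module_chains L Y) ?S"
    unfolding transversal_def pi_map_image
  proof (intro conjI ballI)
    show "?S \<subseteq> module_chains L Y"
    proof (rule image_subsetI)
      fix f assume "f \<in> Y \<rightarrow>\<^sub>E T"
      then have "f y \<in> L" if "y \<in> Y" for y using that T(1) by (auto simp: PiE_iff)
      then show "F f \<in> module_chains L Y"
        using keys_F add_subgroupD(1)[OF L] by (simp add: module_chains_def lookup_F)
    qed
    fix c assume c: "c \<in> module_chains L Y"
    then have cL: "Poly_Mapping.lookup c y \<in> L" for y by (simp add: module_chains_def)
    let ?f = "\<lambda>y\<in>Y. r (Poly_Mapping.lookup c y)"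
    have keys: "Poly_Mapping.keys (c - F f) \<subseteq> Y" for f
      using c keys_F[of f] keys_diff[of c "F f"] by (auto simp: module_chains_def)
    have c0: "Poly_Mapping.lookup c y = 0" if "y \<notin> Y" for y
      using that c by (auto simp: module_chains_def in_keys_iff)
    show "\<exists>!t. t \<in> ?S \<and> c - t \<in> module_chains (\<pi> ` L) Y"
    proof (rule ex1I[of _ "F ?f"])
      have "?f \<in> Y \<rightarrow>\<^sub>E T" using r cL by auto
      moreover have "c - F ?f \<in> module_chains (\<pi> ` L) Y"
        using keys r cL c0 add_subgroupD(1)[OF add_subgroup_pi_L] by (auto simp: module_chains_def lookup_minus lookup_F)
      ultimately show "F ?f \<in> ?S \<and> c - F ?f \<in> module_chains (\<pi> ` L) Y" by blast
    next
      fix t assume "t \<in> ?S \<and> c - t \<in> module_chains (\<pi> ` L) Y"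
      then obtain f where f: "f \<in> Y \<rightarrow>\<^sub>E T" "t = F f" and l: "\<And>y. Poly_Mapping.lookup (c - F f) y \<in> \<pi> ` L"
        by (auto simp: module_chains_def)
      have "f y = r (Poly_Mapping.lookup c y)" if "y \<in> Y" for y
      proof -
        have "f y \<in> T" "Poly_Mapping.lookup c y - f y \<in> \<pi> ` L"
          using f(1) l[of y] that by (auto simp: lookup_minus lookup_F)
        then show ?thesis using T(2)[OF cL[of y]] r[OF cL[of y]] by blast
      qed
      then have "f = ?f" using f(1) by (intro extensionalityI[of _ Y]) (auto simp: PiE_iff)
      then show "t = F ?f" by (simp only: f(2))
    qed
  qed
  moreover have "finite ?S" using assms T(3) by (simp add: finite_PiE)
  moreover have "card ?S = p ^ card Y"
    using assms T(4) by (simp add: card_image[OF inj] card_PiE)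
  ultimately show ?thesis by (auto simp: has_index_def)
qed

text \<open>\<open>has_index_kernel\<close> is applied to the differential on all chains of degree
  \<open>Suc n\<close> and on the image of \<open>pi_map\<close>: the total index is a power of
  \<open>p\<close> with the rank as exponent, image and kernel contribute the homology in degrees
  \<open>n\<close> and \<open>Suc n\<close>.\<close>

lemma index_homology: "\<exists>r. of_nat r = nu n s \<and> has_index (K.cycles n) (K.boundaries n) (p ^ r)"
proof (induction n)
  case 0
  have "K.cycles 0 = module_chains L (X 0)" using K.boundary_0 by (auto simp: K.cycles_def)
  moreover have "card (X 0) = 1" by (simp add: card_multidegrees)
  ultimately show ?case
    using index_chains[OF finite_multidegrees, of s 0] nu_0[of s] unfolding boundaries_eq
    by (intro exI[of _ 1]) (simp only: of_nat_1 power_one_right)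
next
  case (Suc n)
  then obtain r where r: "of_nat r = nu n s" "has_index (K.cycles n) (K.boundaries n) (p ^ r)" by blast
  let ?A = "module_chains L (X (Suc n))" and ?D = "extend_coeffs \<rho> d"
  note subA = module_chains_add_subgroup[OF L, of "X (Suc n)"]
  have DA: "?D ` ?A = pi_map ` K.cycles n" unfolding boundaries_eq[symmetric] K.boundaries_def ..
  have DB: "?D ` pi_map ` ?A = pi_map ` pi_map ` K.cycles n"
    unfolding DA[symmetric] image_image by (rule image_cong[OF refl]) (rule pi_map_boundary)
  have cyc: "c \<in> module_chains L (X n)" if "c \<in> K.cycles n" for c
    using that by (simp add: K.cycles_def)
  have sub: "add_subgroup (pi_map ` K.cycles n)"
    unfolding boundaries_eq[symmetric] by (rule K.add_subgroup_boundaries)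
  have sub2: "add_subgroup (pi_map ` pi_map ` K.cycles n)"
    by (rule add_subgroup_image[OF sub extend_coeffs_simps(5)])
  \<comment> \<open>Being injective, \<open>pi_map\<close> carries the cycles modulo their multiples
    by \<pi>, that is the homology in degree \<open>n\<close>, isomorphically to the image part of
    the index.\<close>
  have "has_index (pi_map ` K.cycles n) (pi_map ` pi_map ` K.cycles n) (p ^ r)"
  proof (rule has_index_transfer[OF r(2)])
    fix x y assume xy: "x \<in> K.cycles n" "y \<in> K.cycles n"
    show "pi_map x - pi_map y \<in> pi_map ` pi_map ` K.cycles n \<longleftrightarrow> x - y \<in> K.boundaries n"
    proof
      assume "pi_map x - pi_map y \<in> pi_map ` pi_map ` K.cycles n"
      then obtain w where w: "w \<in> K.cycles n" "pi_map x - pi_map y = pi_map (pi_map w)" by blast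
      have "pi_map w \<in> K.cycles n" using pi_map_in_boundaries[OF w(1)] K.boundaries_subset by blast
      then have "x - y - pi_map w \<in> module_chains L (X n)"
        using cyc xy by (intro add_subgroupD(2)[OF module_chains_add_subgroup[OF L]]) auto
      moreover have "pi_map (x - y - pi_map w) = (pi_map x - pi_map y) - pi_map (pi_map w)"
        by (simp only: extend_coeffs_simps(5))
      then have "pi_map (x - y - pi_map w) = 0" unfolding w(2) diff_self .
      ultimately have "x - y - pi_map w = 0" by (rule pi_map_inj)
      then have "x - y = pi_map w" by (simp only: right_minus_eq)
      then show "x - y \<in> K.boundaries n" using w(1) unfolding boundaries_eq by blast
    next
      assume "x - y \<in> K.boundaries n"
      then have "pi_map (x - y) \<in> pi_map ` pi_map ` K.cycles n" unfolding boundaries_eq by blast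
      then show "pi_map x - pi_map y \<in> pi_map ` pi_map ` K.cycles n" unfolding extend_coeffs_simps(5) .
    qed
  next
    fix y assume "y \<in> pi_map ` K.cycles n"
    then obtain x where x: "x \<in> K.cycles n" "y = pi_map x" by blast
    have "y - pi_map x \<in> pi_map ` pi_map ` K.cycles n"
      unfolding x(2) diff_self by (rule add_subgroupD(1)[OF sub2])
    with x(1) show "\<exists>x\<in>K.cycles n. y - pi_map x \<in> pi_map ` pi_map ` K.cycles n" ..
  qed (rule subset_refl, rule sub2)
  then have i: "has_index (?D ` ?A) (?D ` pi_map ` ?A) (p ^ r)" unfolding DA DB .
  have "pi_map ` ?A \<subseteq> ?A"
    using t0 by (intro image_subsetI extend_coeffs_in_chains) auto
  moreover have "add_subgroup (pi_map ` ?A)" unfolding pi_map_image by (rule module_chains_add_subgroup[OF add_subgroup_pi_L])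
  ultimately obtain z where z: "has_index {a \<in> ?A. ?D a = 0} {b \<in> pi_map ` ?A. ?D b = 0} z"
      "p ^ r * z = p ^ card (X (Suc n))"
    using has_index_kernel[OF subA _ _ extend_coeffs_simps(5) index_chains[OF finite_multidegrees] i] p_gt_1
    by (metis (no_types, lifting) zero_less_power less_trans zero_less_one)
  \<comment> \<open>The kernel part is homology in degree \<open>Suc n\<close>: a cycle of the form
    \<open>pi_map a\<close> comes from a cycle \<open>a\<close>.\<close>
  have "{b \<in> pi_map ` ?A. ?D b = 0} = K.boundaries (Suc n)"
    unfolding boundaries_eq
  proof (intro equalityI subsetI)
    fix b assume "b \<in> {b \<in> pi_map ` ?A. ?D b = 0}"
    then obtain a where a: "a \<in> ?A" "b = pi_map a" "?D (pi_map a) = 0" by blast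
    then show "b \<in> pi_map ` K.cycles (Suc n)" using cycle_of_pi_map[OF a(1,3)] by blast
  next
    fix b assume "b \<in> pi_map ` K.cycles (Suc n)"
    then obtain a where a: "a \<in> ?A" "?D a = 0" "b = pi_map a" unfolding K.cycles_def by blast
    have "?D (pi_map a) = 0" unfolding pi_map_boundary[OF a(1)] a(2) by (rule extend_coeffs_simps(1))
    then show "b \<in> {b \<in> pi_map ` ?A. ?D b = 0}" using a(1,3) by blast
  qed
  then have hz: "has_index (K.cycles (Suc n)) (K.boundaries (Suc n)) z" using z(1) unfolding K.cycles_def by (simp only:)
  have "p ^ r dvd p ^ card (X (Suc n))" using z(2) by (metis dvd_triv_left)
  then have le: "r \<le> card (X (Suc n))" using p_gt_1 by (rule power_dvd_imp_le)
  then have "p ^ r * z = p ^ r * p ^ (card (X (Suc n)) - r)"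
    using z(2) by (simp flip: power_add)
  then have "z = p ^ (card (X (Suc n)) - r)" using p_gt_1 by simp
  moreover have "of_nat (card (X (Suc n)) - r) = nu (Suc n) s"
    using le r(1) by (simp add: nu_Suc ts_Cons of_nat_diff)
  ultimately show ?case using hz by blast
qed

end

section \<open>Irreducible lattices over abelian groups of prime power exponent\<close>

text \<open>The Frobenius congruence modulo \<open>p\<close>. With \<open>x\<close> taken as
  \<open>X - 1\<close>, where \<open>X\<close> is the polynomial variable, it compares a power of
  \<open>X - 1\<close> with \<open>X ^ (p ^ a) - 1\<close>.\<close>

lemma prime_dvd_power_add_1:
  fixes x :: "'a::comm_ring_1"
  assumes p: "Factorial_Ring.prime (p::nat)"
  shows "of_nat p dvd (x + 1) ^ (p ^ a) - x ^ (p ^ a) - 1"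
proof -
  have step: "of_nat p dvd (y + z) ^ p - y ^ p - z ^ p" for y z :: 'a
  proof -
    have p0: "p > 0" using p prime_gt_0_nat by blast
    have "{..p} = insert 0 (insert p {0<..<p})" by (auto simp: not_less)
    then have "(y + z) ^ p = z ^ p + (y ^ p + (\<Sum>k\<in>{0<..<p}. of_nat (p choose k) * y ^ k * z ^ (p - k)))"
      using p0 by (simp add: binomial_ring)
    then have "(y + z) ^ p - y ^ p - z ^ p = (\<Sum>k\<in>{0<..<p}. of_nat (p choose k) * y ^ k * z ^ (p - k))"
      by simp
    also have "of_nat p dvd \<dots>"
    proof (rule dvd_sum)
      fix k assume "k \<in> {0<..<p}"
      then have "p dvd (p choose k)" using p by (intro dvd_choose_prime) auto
      then have "(of_nat p :: 'a) dvd of_nat (p choose k)" by (auto simp: dvd_def)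
      then show "(of_nat p :: 'a) dvd of_nat (p choose k) * y ^ k * z ^ (p - k)" by (simp add: mult.assoc)
    qed
    finally show ?thesis .
  qed
  show ?thesis
  proof (induction a)
    case (Suc a)
    then obtain r where r: "(x + 1) ^ (p ^ a) - x ^ (p ^ a) - 1 = of_nat p * r" by (auto simp: dvd_def)
    then have eq: "(x + 1) ^ (p ^ a) = (x ^ (p ^ a) + 1) + of_nat p * r" by (simp add: algebra_simps)
    have "(of_nat p :: 'a) dvd (of_nat p * r) ^ p"
      using prime_gt_0_nat[OF p] by (metis dvd_power dvd_trans dvd_triv_left)
    then have "of_nat p dvd (((x ^ (p ^ a) + 1) + of_nat p * r) ^ p - (x ^ (p ^ a) + 1) ^ p - (of_nat p * r) ^ p)
        + (of_nat p * r) ^ p + ((x ^ (p ^ a) + 1) ^ p - (x ^ (p ^ a)) ^ p - 1 ^ p)"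
      (is "_ dvd ?t") by (intro dvd_add step)
    moreover have "?t = ((x + 1) ^ (p ^ a)) ^ p - (x ^ (p ^ a)) ^ p - 1" unfolding eq by simp
    ultimately have "of_nat p dvd ((x + 1) ^ (p ^ a)) ^ p - (x ^ (p ^ a)) ^ p - 1" by (simp only:)
    then show ?case unfolding power_mult[symmetric] power_Suc2[symmetric] .
  qed simp
qed

text \<open>Irreducibility is present as \<open>torsion\<close>, finite rank as
  \<open>separated\<close>. The exponent \<open>a\<close> is minimal: all powers with exponent
  \<open>p ^ a\<close> act trivially, but \<open>t\<^sub>0\<close> still acts nontrivially with
  exponent \<open>p ^ (a - 1)\<close>.\<close>

locale irreducible_coefficients = comm_group G + coefficients G \<rho> L
  for G :: "('g, 'c) monoid_scheme" (structure)
    and \<rho> :: "'g \<Rightarrow> 'b \<Rightarrow> 'b::{idom, ring_char_0}" and L +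
  fixes p a :: nat and t\<^sub>0 :: 'g
  assumes p: "Factorial_Ring.prime p"
    and torsion: "\<And>N x. add_subgroup N \<Longrightarrow> N \<subseteq> L \<Longrightarrow> N \<noteq> {0} \<Longrightarrow>
        (\<And>g y. g \<in> carrier G \<Longrightarrow> y \<in> N \<Longrightarrow> \<rho> g y \<in> N) \<Longrightarrow> x \<in> L \<Longrightarrow> \<exists>k::int. k \<noteq> 0 \<and> of_int k * x \<in> N"
    and separated: "\<And>x. x \<in> L \<Longrightarrow> (\<And>j. \<exists>y \<in> L. x = of_nat (p ^ j) * y) \<Longrightarrow> x = 0"
    and t0: "t\<^sub>0 \<in> carrier G"
    and exponent: "\<And>g x. g \<in> carrier G \<Longrightarrow> x \<in> L \<Longrightarrow> \<rho> (g [^] (p ^ a)) x = x"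
    and a: "a > 0"
    and t0_nontrivial: "\<exists>x \<in> L. \<rho> (t\<^sub>0 [^] (p ^ (a - 1))) x \<noteq> x"
begin

definition trivial :: "'g \<Rightarrow> bool" where
  "trivial g \<longleftrightarrow> (\<forall>x \<in> L. \<rho> g x = x)"

lemma trivial_power: "g \<in> carrier G \<Longrightarrow> trivial g \<Longrightarrow> trivial (g [^] (n::nat))"
  by (induction n) (auto simp: trivial_def rho_mult)

text \<open>A form of Schur's lemma: the fixed vectors of \<open>g\<close> are stable because
  \<open>G\<close> is commutative, so a multiple of each \<open>x\<close> is fixed, and the integer
  factor cancels.\<close>

lemma fixed_imp_trivial:
  assumes g: "g \<in> carrier G" and v: "v \<in> L" "v \<noteq> 0" "\<rho> g v = v" shows "trivial g"
  unfolding trivial_def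
proof
  fix x assume x: "x \<in> L"
  let ?N = "{v \<in> L. \<rho> g v = v}"
  have "\<exists>k::int. k \<noteq> 0 \<and> of_int k * x \<in> ?N"
  proof (rule torsion[OF _ _ _ _ x])
    show "add_subgroup ?N" using add_subgroupD(1,2)[OF L] by (auto simp: add_subgroup_def)
    show "?N \<noteq> {0}" using v by blast
    fix h y assume "h \<in> carrier G" "y \<in> ?N"
    then show "\<rho> h y \<in> ?N" using g rho_L rho_mult by (metis (mono_tags, lifting) m_comm mem_Collect_eq)
  qed auto
  then obtain k :: int where k: "k \<noteq> 0" "of_int k * \<rho> g x = of_int k * x" by auto
  then show "\<rho> g x = x" by simp
qed

lemma trivial_gcd:
  assumes g: "g \<in> carrier G" and "trivial (g [^] (i::nat))" "trivial (g [^] (j::nat))" and "i > 0"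
  shows "trivial (g [^] gcd i j)"
proof -
  obtain x y where xy: "i * x = j * y + gcd i j" using bezout_nat[of i j] assms by auto
  have "trivial (g [^] (i * x))" "trivial (g [^] (j * y))"
    using assms trivial_power[of "g [^] i"] trivial_power[of "g [^] j"] by (simp_all add: nat_pow_pow)
  moreover have "g [^] (i * x) = g [^] (j * y) \<otimes> g [^] gcd i j" using g by (simp add: xy nat_pow_mult)
  ultimately show ?thesis using g by (simp add: trivial_def rho_mult rho_L)
qed

definition q :: nat where "q = p ^ a"

lemma q_pos: "q > 0" using prime_gt_0_nat[OF p] by (simp add: q_def)

lemma trivial_q: "g \<in> carrier G \<Longrightarrow> trivial (g [^] q)"
  using exponent by (simp add: trivial_def q_def)

text \<open>If \<open>t\<^sub>0 [^] i\<close> acted trivially, so would the power with exponent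
  \<open>gcd i q\<close>, which is a proper divisor of \<open>q\<close> and hence divides
  \<open>p ^ (a - 1)\<close>.\<close>

lemma t0_order:
  assumes "0 < i" "i < q" shows "\<not> trivial (t\<^sub>0 [^] i)"
proof
  assume "trivial (t\<^sub>0 [^] i)"
  then have triv: "trivial (t\<^sub>0 [^] gcd i q)"
    using trivial_gcd[OF t0] trivial_q[OF t0] assms by blast
  have "gcd i q dvd p ^ a" by (simp add: q_def)
  then obtain b where b: "b \<le> a" "gcd i q = p ^ b" using divides_primepow_nat[OF p] by blast
  have "gcd i q \<le> i" using assms by (intro gcd_le1_nat) simp
  then have "p ^ b < q" using assms(2) unfolding b(2) by (rule le_less_trans)
  then have "b \<noteq> a" by (auto simp: q_def)
  then have "b \<le> a - 1" using b by simp
  then have "p ^ (a - 1) = p ^ b * p ^ (a - 1 - b)" by (metis le_add_diff_inverse power_add)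
  then have "trivial (t\<^sub>0 [^] (p ^ (a - 1)))"
    using trivial_power[OF _ triv] t0 b(2) by (simp add: nat_pow_pow)
  then show False using t0_nontrivial by (auto simp: trivial_def)
qed

text \<open>The sum is fixed by \<open>g\<close>, while an element that acts nontrivially fixes no
  nonzero vector.\<close>

lemma norm_zero:
  assumes g: "g \<in> carrier G" and n: "trivial (g [^] (n::nat))" and "\<not> trivial g" and y: "y \<in> L"
  shows "(\<Sum>j<n. \<rho> (g [^] j) y) = 0"
proof (rule ccontr)
  let ?S = "\<Sum>j<n. \<rho> (g [^] j) y"
  assume "?S \<noteq> 0"
  moreover have "?S \<in> L" using g y by (intro add_subgroup_sum[OF L] rho_L) auto
  moreover have "\<rho> g ?S = ?S"
  proof -
    have "\<rho> g ?S = (\<Sum>j<n. \<rho> (g [^] Suc j) y)"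
      unfolding rho_sum by (intro sum.cong) (use g y in \<open>auto simp: rho_mult[symmetric] m_comm\<close>)
    also have "\<dots> = (\<Sum>j<Suc n. \<rho> (g [^] j) y) - y"
      by (subst sum.lessThan_Suc_shift) simp
    also have "\<dots> = ?S" using n y by (simp add: trivial_def)
    finally show ?thesis .
  qed
  ultimately show False using fixed_imp_trivial[OF g] assms(3) by blast
qed

text \<open>The discrete Fourier transform over the powers of \<open>t\<^sub>0\<close> splits a vector into eigenvectors
  of \<open>u\<close> whose eigenvalues are powers of \<open>t\<^sub>0\<close>; one of them is nonzero.\<close>

lemma acts_as_power:
  assumes u: "u \<in> carrier G" shows "\<exists>j::nat. \<forall>x \<in> L. \<rho> u x = \<rho> (t\<^sub>0 [^] j) x"
proof -
  obtain v where v: "v \<in> L" "\<rho> (t\<^sub>0 [^] (p ^ (a - 1))) v \<noteq> v" using t0_nontrivial by blast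
  then have "v \<noteq> 0" by auto
  \<comment> \<open>The factor \<open>q - 1\<close> stands for \<open>-1\<close>: since the power
    \<open>q\<close> of \<open>t\<^sub>0\<close> acts trivially, the exponent counts as
    \<open>- i * j\<close> and stays a natural number.\<close>
  define w where "w i j = \<rho> (t\<^sub>0 [^] ((q - 1) * i * j) \<otimes> u [^] i) v" for i j :: nat
  have wL: "w i j \<in> L" for i j unfolding w_def using t0 u v by (intro rho_L) auto
  define e where "e j = (\<Sum>i<q. w i j)" for j
  have eL: "e j \<in> L" for j unfolding e_def by (intro add_subgroup_sum[OF L] wL)
  have triv: "\<rho> (g [^] (q * j)) x = x" if "g \<in> carrier G" "x \<in> L" for g x and j :: nat
    using trivial_power[OF _ trivial_q[OF that(1)], of j] that by (simp add: nat_pow_pow trivial_def)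
  have step: "\<rho> u (w i j) = \<rho> (t\<^sub>0 [^] j) (w (Suc i) j)" for i j
  proof -
    have "j + (q - 1) * Suc i * j = q * j + (q - 1) * i * j"
      using q_pos by (cases q) (auto simp: algebra_simps)
    then have "t\<^sub>0 [^] j \<otimes> t\<^sub>0 [^] ((q - 1) * Suc i * j) = t\<^sub>0 [^] (q * j) \<otimes> t\<^sub>0 [^] ((q - 1) * i * j)"
      using t0 by (simp only: nat_pow_mult)
    moreover have "A \<otimes> (B \<otimes> (U \<otimes> u)) = C \<otimes> (u \<otimes> (D \<otimes> U))"
      if "A \<otimes> B = C \<otimes> D" "A \<in> carrier G" "B \<in> carrier G" "C \<in> carrier G" "D \<in> carrier G" "U \<in> carrier G" for A B C D U
    proof -
      have "A \<otimes> (B \<otimes> (U \<otimes> u)) = (C \<otimes> D) \<otimes> (U \<otimes> u)" using that u by (simp flip: that(1) add: m_assoc)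
      also have "\<dots> = C \<otimes> (u \<otimes> (D \<otimes> U))" using that u by (simp add: m_ac)
      finally show ?thesis .
    qed
    ultimately have "t\<^sub>0 [^] j \<otimes> (t\<^sub>0 [^] ((q - 1) * Suc i * j) \<otimes> (u [^] i \<otimes> u)) = t\<^sub>0 [^] (q * j) \<otimes> (u \<otimes> (t\<^sub>0 [^] ((q - 1) * i * j) \<otimes> u [^] i))"
      using t0 u by simp
    then have "\<rho> (t\<^sub>0 [^] j) (w (Suc i) j) = \<rho> (t\<^sub>0 [^] (q * j)) (\<rho> u (w i j))"
      unfolding w_def nat_pow_Suc using t0 u by (simp only: rho_mult[symmetric] m_closed nat_pow_closed)
    then show ?thesis using triv[OF t0] rho_L[OF u wL] by simp
  qed
  \<comment> \<open>The sum over \<open>i\<close> is cyclic, as both \<open>w q j\<close> and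
    \<open>w 0 j\<close> are \<open>v\<close>; by \<open>step\<close>, applying \<open>u\<close>
    shifts it by one place and brings out a power of \<open>t\<^sub>0\<close>.\<close>
  have e_eigen: "\<rho> u (e j) = \<rho> (t\<^sub>0 [^] j) (e j)" for j
  proof -
    have "w q j = v"
      unfolding w_def using triv[OF t0, of _ "(q - 1) * j"] triv[OF u, of v 1] t0 u v rho_L
      by (simp add: rho_mult mult_ac)
    moreover have "w 0 j = v" using t0 by (simp add: w_def)
    ultimately have "(\<Sum>i<q. w (Suc i) j) = e j"
      using sum.lessThan_Suc_shift[of "\<lambda>i. w i j" q] by (simp add: e_def)
    moreover have "\<rho> u (e j) = \<rho> (t\<^sub>0 [^] j) (\<Sum>i<q. w (Suc i) j)"
      by (simp add: e_def rho_sum step)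
    ultimately show ?thesis by simp
  qed
  \<comment> \<open>Orthogonality of characters: summed over \<open>j\<close>, the terms with
    \<open>i \<noteq> 0\<close> are norms of nontrivial powers of \<open>t\<^sub>0\<close> and
    vanish, and \<open>i = 0\<close> leaves \<open>q\<close> times \<open>v\<close>.\<close>
  have "\<exists>j<q. e j \<noteq> 0"
  proof (rule ccontr)
    assume "\<not> ?thesis"
    then have "0 = (\<Sum>j<q. e j)" by simp
    also have "\<dots> = (\<Sum>i<q. \<Sum>j<q. w i j)" unfolding e_def by (rule sum.swap)
    also have "\<dots> = (\<Sum>i<q. if i = 0 then of_nat q * v else 0)"
    proof (intro sum.cong refl)
      fix i assume i: "i \<in> {..<q}"
      show "(\<Sum>j<q. w i j) = (if i = 0 then of_nat q * v else 0)"
      proof (cases "i = 0")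
        case False
        let ?g = "t\<^sub>0 [^] ((q - 1) * i)"
        have g: "?g \<in> carrier G" using t0 by simp
        have "\<not> trivial ?g"
        proof
          assume "trivial ?g"
          moreover have "?g \<otimes> t\<^sub>0 [^] i = t\<^sub>0 [^] (q * i)"
            using t0 q_pos by (cases q) (simp_all add: nat_pow_mult add.commute)
          ultimately have "trivial (t\<^sub>0 [^] i)"
            using triv[OF t0, of _ i] t0 rho_L[of "t\<^sub>0 [^] i"] unfolding trivial_def
            by (metis nat_pow_closed rho_mult)
          then show False using t0_order False i by auto
        qed
        then have "(\<Sum>j<q. \<rho> (?g [^] j) (\<rho> (u [^] i) v)) = 0"
          by (rule norm_zero[OF g trivial_q[OF g]]) (use u v rho_L in auto)
        moreover have "w i j = \<rho> (?g [^] j) (\<rho> (u [^] i) v)" for j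
          using t0 u by (simp add: w_def rho_mult nat_pow_pow)
        ultimately show ?thesis using False by simp
      qed (use t0 in \<open>simp add: w_def\<close>)
    qed
    finally show False using q_pos \<open>v \<noteq> 0\<close> by simp
  qed
  then obtain j where j: "e j \<noteq> 0" by blast
  let ?h = "t\<^sub>0 [^] j"
  have h: "?h \<in> carrier G" using t0 by simp
  \<comment> \<open>A single eigenvector suffices: \<open>inv ?h \<otimes> u\<close> fixes it and
    therefore acts trivially on all of \<open>L\<close>.\<close>
  have "\<rho> (inv ?h \<otimes> u) (e j) = e j"
    using h u e_eigen[of j] by (simp add: rho_mult flip: rho_mult[of "inv ?h" ?h])
  then have "trivial (inv ?h \<otimes> u)"
    by (rule fixed_imp_trivial[OF m_closed[OF inv_closed[OF h] u] eL j])
  then have "\<rho> u x = \<rho> ?h x" if "x \<in> L" for x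
  proof -
    have "\<rho> ?h (\<rho> (inv ?h \<otimes> u) x) = \<rho> u x"
      using h u by (simp add: m_assoc[symmetric] flip: rho_mult)
    then show ?thesis using \<open>trivial (inv ?h \<otimes> u)\<close> that by (simp add: trivial_def)
  qed
  then show ?thesis by blast
qed

section \<open>Integer polynomials in \<open>t\<^sub>0\<close>\<close>

text \<open>The operator \<open>P(t\<^sub>0)\<close>. Computing with polynomials avoids a ring of
  operators, which would be a copy of the cyclotomic integers of level \<open>p ^ a\<close>.\<close>

definition ev :: "int poly \<Rightarrow> 'b \<Rightarrow> 'b" where
  "ev P x = (\<Sum>i\<le>degree P. of_int (coeff P i) * \<rho> (t\<^sub>0 [^] i) x)"

lemma ev_bound: "degree P \<le> n \<Longrightarrow> ev P x = (\<Sum>i\<le>n. of_int (coeff P i) * \<rho> (t\<^sub>0 [^] i) x)"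
  unfolding ev_def by (rule sum.mono_neutral_left) (auto simp: coeff_eq_0)

lemma ev_add [simp]: "ev (P + Q) x = ev P x + ev Q x"
proof -
  let ?n = "max (degree P) (degree Q)"
  have "ev (P + Q) x = (\<Sum>i\<le>?n. of_int (coeff (P + Q) i) * \<rho> (t\<^sub>0 [^] i) x)"
    by (rule ev_bound) (rule degree_add_le_max)
  then show ?thesis
    by (simp add: ev_bound[of P ?n] ev_bound[of Q ?n] distrib_right sum.distrib)
qed

lemma ev_smult [simp]: "ev (smult c P) x = of_int c * ev P x"
  by (simp add: ev_bound[of "smult c P" "degree P"] degree_smult_le ev_def sum_distrib_left mult.assoc)

lemma ev_const [simp]: "ev [:c:] x = of_int c * x"
  by (simp add: ev_def)

lemma ev_0 [simp]: "ev 0 x = 0"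
  by (simp add: ev_def)

lemma ev_uminus [simp]: "ev (- P) x = - ev P x"
  using ev_smult[of "-1" P x] by simp

lemma ev_minus [simp]: "ev (P - Q) x = ev P x - ev Q x"
  using ev_add[of P "- Q" x] by simp

lemma ev_sum: "ev (sum f I) x = (\<Sum>i\<in>I. ev (f i) x)"
  by (induction I rule: infinite_finite_induct) auto

lemma ev_pCons: "ev (pCons c P) x = of_int c * x + \<rho> t\<^sub>0 (ev P x)"
proof -
  have "ev (pCons c P) x = (\<Sum>i\<le>Suc (degree P). of_int (coeff (pCons c P) i) * \<rho> (t\<^sub>0 [^] i) x)"
    by (rule ev_bound) (rule degree_pCons_le)
  also have "\<dots> = of_int c * x + (\<Sum>i\<le>degree P. of_int (coeff P i) * \<rho> (t\<^sub>0 [^] Suc i) x)"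
    by (simp only: sum.atMost_Suc_shift) simp
  also have "(\<Sum>i\<le>degree P. of_int (coeff P i) * \<rho> (t\<^sub>0 [^] Suc i) x) = \<rho> t\<^sub>0 (ev P x)"
    unfolding ev_def rho_sum by (intro sum.cong) (use t0 in \<open>auto simp: m_comm rho_mult[symmetric]\<close>)
  finally show ?thesis .
qed

lemma ev_of_int_right: "ev P (of_int k * x) = of_int k * ev P x"
  by (simp add: ev_def sum_distrib_left mult.left_commute)

lemma ev_mult: "ev (P * Q) x = ev P (ev Q x)"
  by (induction P rule: pCons_induct) (simp_all add: ev_pCons)

lemma ev_L: "x \<in> L \<Longrightarrow> ev P x \<in> L"
  unfolding ev_def using t0 by (intro add_subgroup_sum[OF L] add_subgroup_of_int[OF L] rho_L) auto

lemma ev_monom: "ev (monom 1 i) x = \<rho> (t\<^sub>0 [^] i) x"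
  using t0 by (induction i) (auto simp: monom_0 monom_Suc ev_pCons m_comm rho_mult[symmetric])

abbreviation \<pi> :: "'b \<Rightarrow> 'b" where "\<pi> x \<equiv> \<rho> t\<^sub>0 x - x"

lemma ev_pi: "ev [:-1, 1:] x = \<pi> x"
  by (simp add: ev_pCons)

text \<open>As \<open>X - 1\<close> acts as \<pi>, divisibility by \<pi> can be read off from the
  value of a polynomial at 1.\<close>

lemma pi_factor:
  assumes "poly P 1 = 0" shows "\<exists>Q. P = [:-1, 1:] * Q \<and> (\<forall>x. ev P x = \<pi> (ev Q x))"
proof -
  have "[:-1, 1:] dvd P" using assms poly_eq_0_iff_dvd[of P 1] by simp
  then obtain Q where "P = [:-1, 1:] * Q" by (elim dvdE)
  then show ?thesis by (intro exI[of _ Q]) (simp only: ev_mult ev_pi simp_thms)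
qed

lemma rho_pi:
  assumes "g \<in> carrier G" "x \<in> L" shows "\<rho> g x - x \<in> \<pi> ` L"
proof -
  obtain j :: nat where j: "\<rho> g x = \<rho> (t\<^sub>0 [^] j) x" using acts_as_power assms by blast
  obtain Q where "ev (monom 1 j - 1) x = \<pi> (ev Q x)"
    using pi_factor[of "monom 1 j - 1"] by (auto simp: poly_monom)
  then have "\<rho> g x - x = \<pi> (ev Q x)" by (simp add: ev_monom j one_pCons)
  then show ?thesis using ev_L assms by blast
qed

lemma t0_not_trivial: "\<not> trivial t\<^sub>0"
proof
  assume "trivial t\<^sub>0"
  then have "trivial (t\<^sub>0 [^] (p ^ (a - 1)))" by (rule trivial_power[OF t0])
  then show False using t0_nontrivial by (auto simp: trivial_def)
qed

lemma pi_inj: "x \<in> L \<Longrightarrow> \<pi> x = 0 \<Longrightarrow> x = 0"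
  using fixed_imp_trivial[OF t0] t0_not_trivial by auto

text \<open>The sum in \<open>?P\<close> is the cyclotomic polynomial of level \<open>p ^ a\<close>.
  It acts as zero by \<open>norm_zero\<close> and has value \<open>p\<close> at 1, so
  \<open>?P\<close> acts as \<open>p\<close> and vanishes at 1.\<close>

lemma p_factor: "\<exists>Q. \<forall>x \<in> L. of_nat p * x = \<pi> (ev Q x)"
proof -
  let ?P = "[:int p:] - (\<Sum>j<p. monom 1 (p ^ (a - 1) * j))"
  have "poly ?P 1 = 0" by (simp add: poly_sum poly_monom)
  then obtain Q where Q: "\<And>x. ev ?P x = \<pi> (ev Q x)" using pi_factor by blast
  let ?g = "t\<^sub>0 [^] (p ^ (a - 1))"
  have g: "?g \<in> carrier G" using t0 by simp
  have "trivial (?g [^] p)"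
    using trivial_q[OF t0] t0 a by (simp add: nat_pow_pow q_def power_eq_if[of p a] mult.commute)
  moreover have "\<not> trivial ?g" using t0_nontrivial by (auto simp: trivial_def)
  ultimately have "(\<Sum>j<p. ev (monom 1 (p ^ (a - 1) * j)) x) = 0" if "x \<in> L" for x
    using norm_zero[OF g _ _ that] t0 by (simp add: ev_monom nat_pow_pow)
  then have e: "ev ?P x = of_nat p * x" if "x \<in> L" for x
    using that by (simp only: ev_minus ev_sum ev_const of_int_of_nat_eq diff_zero)
  have "of_nat p * x = \<pi> (ev Q x)" if "x \<in> L" for x
    by (rule trans[OF sym[OF e[OF that]] Q])
  then show ?thesis by blast
qed

lemma p_pi: assumes "x \<in> L" shows "of_nat p * x \<in> \<pi> ` L"
proof -
  obtain Q where "\<forall>x \<in> L. of_nat p * x = \<pi> (ev Q x)" using p_factor by blast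
  then show ?thesis using assms ev_L[OF assms, of Q] by blast
qed

text \<open>The Frobenius congruence and the trivial action of \<open>t\<^sub>0 [^] q\<close> make
  the power \<open>q\<close> of \<pi> divisible by \<open>p\<close>; what is divisible by all powers
  of \<pi> is then divisible by all powers of \<open>p\<close>.\<close>

lemma pi_separated:
  assumes x: "x \<in> L" and j: "\<And>j. \<exists>y \<in> L. x = ev ([:-1, 1:] ^ j) y" shows "x = 0"
proof (rule separated[OF x])
  have "of_nat p dvd ([:-1, 1:] + 1) ^ (p ^ a) - [:-1, 1:] ^ (p ^ a) - (1 :: int poly)"
    by (rule prime_dvd_power_add_1[OF p])
  also have "[:-1, 1:] + 1 = (monom 1 1 :: int poly)" by (simp add: one_pCons monom_altdef)
  finally obtain R where "monom 1 q - [:-1, 1:] ^ q - (1 :: int poly) = of_nat p * R"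
    by (auto simp: dvd_def monom_power q_def)
  then have R: "[:-1, 1:] ^ q = monom 1 q - (1 :: int poly) - of_nat p * R" by (simp add: algebra_simps)
  have pq: "\<exists>z \<in> L. ev ([:-1, 1:] ^ q) y = of_nat p * z" if y: "y \<in> L" for y
  proof -
    have "ev ([:-1, 1:] ^ q) y = \<rho> (t\<^sub>0 [^] q) y - y - of_int (int p) * ev R y"
      unfolding R by (simp add: ev_monom one_pCons of_nat_poly)
    also have "\<rho> (t\<^sub>0 [^] q) y = y" using trivial_q[OF t0] y by (simp add: trivial_def)
    finally have "ev ([:-1, 1:] ^ q) y = of_nat p * (- ev R y)" by simp
    then show ?thesis using ev_L[OF y] add_subgroupD(3)[OF L] by blast
  qed
  have main: "\<exists>z \<in> L. ev ([:-1, 1:] ^ (q * j)) y = of_nat (p ^ j) * z" if y: "y \<in> L" for y j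
  proof (induction j)
    case (Suc j)
    then obtain z where z: "z \<in> L" "ev ([:-1, 1:] ^ (q * j)) y = of_int (int (p ^ j)) * z" by auto
    obtain z' where z': "z' \<in> L" "ev ([:-1, 1:] ^ q) z = of_nat p * z'" using pq[OF z(1)] by blast
    have "ev ([:-1, 1:] ^ (q * Suc j)) y = ev ([:-1, 1:] ^ q) (ev ([:-1, 1:] ^ (q * j)) y)"
      by (simp add: power_add ev_mult)
    also have "\<dots> = of_nat (p ^ Suc j) * z'"
      unfolding z(2) ev_of_int_right z'(2) by (simp add: mult_ac)
    finally show ?case using z' by blast
  qed (use y in \<open>auto simp: one_pCons\<close>)
  show "\<exists>z \<in> L. x = of_nat (p ^ i) * z" for i
  proof -
    obtain y where "y \<in> L" "x = ev ([:-1, 1:] ^ (q * i)) y" using j by blast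
    then show ?thesis using main[of y i] by simp
  qed
qed

lemma sub_pi: "add_subgroup (\<pi> ` L)"
  by (rule add_subgroup_image[OF L]) simp

text \<open>Because \<open>p\<close> annihilates \<open>L / \<pi> L\<close>, integers prime to
  \<open>p\<close> act invertibly there, by Bezout.\<close>

lemma coprime_pi:
  assumes "\<not> int p dvd c" "v \<in> L" "of_int c * v \<in> \<pi> ` L" shows "v \<in> \<pi> ` L"
proof -
  have "coprime (int p) c" using assms(1) p by (intro prime_imp_coprime) auto
  then obtain m n where mn: "m * int p + n * c = 1" using bezout_int[of "int p" c] by (auto simp: coprime_iff_gcd_eq_1)
  have "v = of_int (m * int p + n * c) * v" by (simp add: mn)
  also have "\<dots> = of_int m * (of_nat p * v) + of_int n * (of_int c * v)" by (simp add: algebra_simps)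
  also have "\<dots> \<in> \<pi> ` L"
    by (intro add_subgroupD(4)[OF sub_pi] add_subgroup_of_int[OF sub_pi] p_pi assms)
  finally show ?thesis .
qed

text \<open>Otherwise every vector would be divisible by all powers of \<pi>, and \<open>L\<close>
  would be zero, against \<open>t0_nontrivial\<close>.\<close>

lemma exists_not_pi: "\<exists>v \<in> L. v \<notin> \<pi> ` L"
proof (rule ccontr)
  assume "\<not> ?thesis"
  then have sur: "\<exists>y \<in> L. x = \<pi> y" if "x \<in> L" for x using that by blast
  have "\<exists>y \<in> L. x = ev ([:-1, 1:] ^ j) y" if "x \<in> L" for x j
    using that
  proof (induction j arbitrary: x)
    case (Suc j)
    obtain y where y: "y \<in> L" "x = \<pi> y" using sur Suc.prems by blast
    obtain z where z: "z \<in> L" "y = ev ([:-1, 1:] ^ j) z" using Suc.IH[OF y(1)] by blast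
    have "x = ev ([:-1, 1:] * [:-1, 1:] ^ j) z" unfolding ev_mult ev_pi y(2) z(2) ..
    then show ?case using z(1) unfolding power_Suc by blast
  qed (auto simp: one_pCons)
  then have zero: "x = 0" if "x \<in> L" for x using pi_separated[OF that] that by blast
  obtain x where "x \<in> L" "\<rho> (t\<^sub>0 [^] (p ^ (a - 1))) x \<noteq> x" using t0_nontrivial by blast
  then show False using zero[of x] by simp
qed

end

context irreducible_coefficients
begin

text \<open>Descent: if \<open>x\<close> were not congruent to a multiple of \<open>v\<close>, then a nonzero integer multiple of \<open>x\<close>
  lying in the submodule generated by \<open>v\<close> would be divisible by arbitrarily high powers of \<open>\<pi>\<close>.\<close>

lemma congruent_multiple:
  assumes v: "v \<in> L" "v \<notin> \<pi> ` L" and x: "x \<in> L"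
  shows "\<exists>c::int. x - of_int c * v \<in> \<pi> ` L"
proof (rule ccontr)
  assume none: "\<not> ?thesis"
  let ?N = "range (\<lambda>B. ev B v)"
  have "\<exists>k::int. k \<noteq> 0 \<and> of_int k * x \<in> ?N"
  proof (rule torsion[OF _ _ _ _ x])
    show "add_subgroup ?N"
      unfolding add_subgroup_def
    proof (intro conjI ballI)
      show "0 \<in> ?N" by (rule range_eqI[of _ _ 0]) simp
      fix y z assume "y \<in> ?N" "z \<in> ?N"
      then obtain A B where "y = ev A v" "z = ev B v" by blast
      then show "y - z \<in> ?N" by (intro range_eqI[of _ _ "A - B"]) simp
    qed
    show "?N \<subseteq> L" using ev_L[OF v(1)] by blast
    have "v = ev [:1:] v" unfolding ev_const by simp
    then have "v \<in> ?N" by (rule range_eqI)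
    moreover have "v \<noteq> 0" using v(2) add_subgroupD(1)[OF sub_pi] by blast
    ultimately show "?N \<noteq> {0}" by blast
    fix g y assume g: "g \<in> carrier G" and "y \<in> ?N"
    then obtain A where A: "y = ev A v" by blast
    obtain j :: nat where j: "\<And>x. x \<in> L \<Longrightarrow> \<rho> g x = \<rho> (t\<^sub>0 [^] j) x" using acts_as_power[OF g] by blast
    have "\<rho> g y = ev (monom 1 j * A) v" unfolding A ev_mult ev_monom by (rule j[OF ev_L[OF v(1)]])
    then show "\<rho> g y \<in> ?N" by blast
  qed
  then obtain k :: int and B0 where k: "k \<noteq> 0" "of_int k * x = ev B0 v" by blast
  obtain Qp where Qp: "\<And>y. y \<in> L \<Longrightarrow> of_nat p * y = \<pi> (ev Qp y)" using p_factor by blast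
  have split: "\<exists>A'. \<forall>y. ev A y = of_int (poly A 1) * y + \<pi> (ev A' y)" for A
  proof -
    have "poly (A - [:poly A 1:]) 1 = 0" by simp
    from pi_factor[OF this] obtain A' where "\<forall>y. ev (A - [:poly A 1:]) y = \<pi> (ev A' y)" by (elim exE conjE)
    then have A': "ev A y - of_int (poly A 1) * y = \<pi> (ev A' y)" for y
      unfolding ev_minus ev_const by (rule spec)
    show ?thesis
    proof (intro exI allI)
      fix y show "ev A y = of_int (poly A 1) * y + \<pi> (ev A' y)"
        using A'[of y] by (metis add.commute diff_add_cancel)
    qed
  qed
  have divide: "\<exists>A1. \<forall>y \<in> L. ev A y = \<pi> (ev A1 y)" if "int p dvd poly A 1" for A
  proof -
    from split[of A] obtain A' where A': "\<forall>y. ev A y = of_int (poly A 1) * y + \<pi> (ev A' y)" by (elim exE)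
    obtain c where c: "poly A 1 = int p * c" using \<open>int p dvd poly A 1\<close> by (elim dvdE)
    show ?thesis
    proof (intro exI ballI)
      fix y assume y: "y \<in> L"
      have "of_int (poly A 1) * y = of_int c * \<pi> (ev Qp y)"
        unfolding Qp[OF y, symmetric] c by (simp add: mult_ac)
      then have "ev A y = of_int c * \<pi> (ev Qp y) + \<pi> (ev A' y)"
        using A'[rule_format, of y] by (simp only:)
      also have "\<dots> = \<pi> (ev (smult c Qp + A') y)"
        unfolding ev_add ev_smult rho_simps rho_of_int by (simp add: algebra_simps)
      finally show "ev A y = \<pi> (ev (smult c Qp + A') y)" .
    qed
  qed
  \<comment> \<open>The descent keeps \<open>k\<close> factored as \<open>A\<close> times
    \<open>j\<close> copies of \<pi>, and keeps the relation between \<open>x\<close> and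
    \<open>v\<close> with these copies cancelled. It starts from \<open>A = k\<close> and
    \<open>B = B0\<close>.\<close>
  have main: "\<exists>A B. (\<forall>y \<in> L. of_int k * y = ev ([:-1, 1:] ^ j) (ev A y)) \<and> ev A x = ev B v" for j
  proof (induction j)
    case 0
    have "\<forall>y \<in> L. of_int k * y = ev ([:-1, 1:] ^ 0) (ev [:k:] y)" by (simp add: one_pCons)
    moreover have "ev [:k:] x = ev B0 v" using k by simp
    ultimately show ?case by blast
  next
    case (Suc j)
    then obtain A B where A: "\<And>y. y \<in> L \<Longrightarrow> of_int k * y = ev ([:-1, 1:] ^ j) (ev A y)" and AB: "ev A x = ev B v" by blast
    from split[of A] obtain A' where A': "\<forall>y. ev A y = of_int (poly A 1) * y + \<pi> (ev A' y)" by (elim exE)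
    from split[of B] obtain B' where B': "\<forall>y. ev B y = of_int (poly B 1) * y + \<pi> (ev B' y)" by (elim exE)
    have pA: "\<pi> (ev A' x) \<in> \<pi> ` L" by (rule imageI[OF ev_L[OF x]])
    have pB: "\<pi> (ev B' v) \<in> \<pi> ` L" by (rule imageI[OF ev_L[OF v(1)]])
    have "of_int (poly A 1) * x + \<pi> (ev A' x) = of_int (poly B 1) * v + \<pi> (ev B' v)"
      using AB A'[rule_format, of x] B'[rule_format, of v] by (simp only:)
    then have "of_int (poly A 1) * x - of_int (poly B 1) * v = \<pi> (ev B' v) - \<pi> (ev A' x)"
      by (simp add: algebra_simps)
    also have "\<dots> \<in> \<pi> ` L" by (rule add_subgroupD(2)[OF sub_pi pB pA])
    finally have 1: "of_int (poly A 1) * x - of_int (poly B 1) * v \<in> \<pi> ` L" .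
    \<comment> \<open>Were the value of \<open>A\<close> at 1 prime to \<open>p\<close>, the
      relation could be solved for \<open>x\<close> modulo \<pi>, making it an integer multiple of
      \<open>v\<close>.\<close>
    have pdA: "int p dvd poly A 1"
    proof (rule ccontr)
      assume "\<not> int p dvd poly A 1"
      then have "coprime (int p) (poly A 1)" using p by (intro prime_imp_coprime) auto
      then obtain m n where mn: "m * int p + n * poly A 1 = 1"
        using bezout_int[of "int p" "poly A 1"] by (auto simp: coprime_iff_gcd_eq_1)
      have "x = of_int (m * int p + n * poly A 1) * x" by (simp add: mn)
      then have "x - of_int (n * poly B 1) * v =
          of_int m * (of_nat p * x) + of_int n * (of_int (poly A 1) * x - of_int (poly B 1) * v)"
        by (simp add: algebra_simps)
      also have "\<dots> \<in> \<pi> ` L"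
        by (intro add_subgroupD(4)[OF sub_pi] add_subgroup_of_int[OF sub_pi] 1 p_pi x)
      finally show False using none by blast
    qed
    have "of_int (poly A 1) * x \<in> \<pi> ` L"
    proof -
      obtain c where c: "poly A 1 = int p * c" using pdA by (elim dvdE)
      have "of_int (poly A 1) * x = of_int c * (of_nat p * x)" by (simp add: c mult_ac)
      also have "\<dots> \<in> \<pi> ` L" by (intro add_subgroup_of_int[OF sub_pi] p_pi x)
      finally show ?thesis .
    qed
    \<comment> \<open>With the left side divisible by \<pi>, so is the right side; since
      \<open>v\<close> is not, \<open>p\<close> divides the value of \<open>B\<close> at 1.\<close>
    from add_subgroupD(2)[OF sub_pi this 1] have "of_int (poly B 1) * v \<in> \<pi> ` L" by simp
    then have pdB: "int p dvd poly B 1" using coprime_pi v by blast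
    obtain A1 where A1: "\<And>y. y \<in> L \<Longrightarrow> ev A y = \<pi> (ev A1 y)" using divide[OF pdA] by (elim exE) blast
    obtain B1 where B1: "\<And>y. y \<in> L \<Longrightarrow> ev B y = \<pi> (ev B1 y)" using divide[OF pdB] by (elim exE) blast
    \<comment> \<open>Both sides have gained a factor \<pi>, which cancels by injectivity.\<close>
    have "\<pi> (ev A1 x - ev B1 v) = \<pi> (ev A1 x) - \<pi> (ev B1 v)" by simp
    also have "\<dots> = 0" unfolding A1[OF x, symmetric] B1[OF v(1), symmetric] AB by (rule diff_self)
    finally have "ev A1 x - ev B1 v = 0"
      by (rule pi_inj[OF add_subgroupD(2)[OF L ev_L[OF x] ev_L[OF v(1)]]])
    then have "ev A1 x = ev B1 v" by (simp only: right_minus_eq)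
    moreover have "of_int k * y = ev ([:-1, 1:] ^ Suc j) (ev A1 y)" if "y \<in> L" for y
      unfolding power_Suc2 ev_mult[of _ "[:-1, 1:]"] ev_pi A[OF that] A1[OF that] ..
    ultimately show ?case by blast
  qed
  \<comment> \<open>Now \<open>x = 0\<close>, which is congruent to \<open>0 * v\<close> and
    contradicts the assumption.\<close>
  have "of_int k * x = 0"
  proof (rule pi_separated)
    show "of_int k * x \<in> L" by (rule add_subgroup_of_int[OF L x])
    show "\<exists>y \<in> L. of_int k * x = ev ([:-1, 1:] ^ j) y" for j
      using main[of j] ev_L[OF x] x by blast
  qed
  then have "x - of_int 0 * v = 0" using k(1) by simp
  then have "x - of_int 0 * v \<in> \<pi> ` L" using add_subgroupD(1)[OF sub_pi] by (simp only:)
  then show False using none by blast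
qed

text \<open>The multiples of one \<open>v\<close> outside the image of \<pi> represent all classes
  by \<open>congruent_multiple\<close>; \<open>p_pi\<close> reduces the factor modulo
  \<open>p\<close>, and \<open>coprime_pi\<close> separates the remaining ones.\<close>

lemma index_pi: "has_index L (\<pi> ` L) p"
proof -
  obtain v where v: "v \<in> L" "v \<notin> \<pi> ` L" using exists_not_pi by blast
  have p0: "p > 0" using prime_gt_0_nat[OF p] .
  let ?T = "(\<lambda>c. of_nat c * v) ` {..<p}"
  have eq: "c = c'" if "c < p" "c' < p" "of_nat c * v - of_nat c' * v \<in> \<pi> ` L" for c c' :: nat
  proof -
    have "of_int (int c - int c') * v \<in> \<pi> ` L" using that(3) by (simp add: left_diff_distrib)
    then have "int p dvd int c - int c'" using coprime_pi v by blast
    then have "int c mod int p = int c' mod int p" by (simp add: mod_eq_dvd_iff)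
    then show ?thesis using that by simp
  qed
  have inj: "inj_on (\<lambda>c. of_nat c * v) {..<p}"
    using eq add_subgroupD(1)[OF sub_pi] by (intro inj_onI) (metis diff_self lessThan_iff)
  have "transversal L (\<pi> ` L) ?T"
    unfolding transversal_def
  proof (intro conjI ballI)
    show "?T \<subseteq> L" using add_subgroup_of_int[OF L v(1), of "int c" for c] by auto
    fix x assume "x \<in> L"
    then obtain c :: int where c: "x - of_int c * v \<in> \<pi> ` L" using congruent_multiple v by blast
    define r where "r = nat (c mod int p)"
    have r: "r < p" "int r = c mod int p" using p0 by (simp_all add: r_def nat_less_iff)
    have "c = int p * (c div int p) + int r" by (simp add: r(2))
    then have "(of_int c :: 'b) = of_nat p * of_int (c div int p) + of_nat r"
      by (metis of_int_add of_int_mult of_int_of_nat_eq)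
    then have "x - of_nat r * v = (x - of_int c * v) + of_int (c div int p) * (of_nat p * v)"
      by (simp add: algebra_simps)
    also have "\<dots> \<in> \<pi> ` L"
      by (intro add_subgroupD(4)[OF sub_pi] add_subgroup_of_int[OF sub_pi] c p_pi v)
    finally have xr: "x - of_nat r * v \<in> \<pi> ` L" .
    show "\<exists>!t. t \<in> ?T \<and> x - t \<in> \<pi> ` L"
    proof (rule ex1I[of _ "of_nat r * v"])
      show "of_nat r * v \<in> ?T \<and> x - of_nat r * v \<in> \<pi> ` L" using r xr by blast
      fix t assume t: "t \<in> ?T \<and> x - t \<in> \<pi> ` L"
      then obtain c' where c': "c' < p" "t = of_nat c' * v" "x - of_nat c' * v \<in> \<pi> ` L" by blast
      have "(x - of_nat c' * v) - (x - of_nat r * v) \<in> \<pi> ` L" by (rule add_subgroupD(2)[OF sub_pi c'(3) xr])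
      then have "of_nat r * v - of_nat c' * v \<in> \<pi> ` L" by simp
      then show "t = of_nat r * v" using eq[OF r(1) c'(1)] c'(2) by blast
    qed
  qed
  then show ?thesis using card_image[OF inj] by (auto simp: has_index_def)
qed

end

section \<open>Submodules of irreducible lattices have torsion quotients\<close>

lemma comm_group_rat_group: "comm_group rat_group"
proof (rule comm_groupI)
  fix x assume "x \<in> carrier rat_group"
  show "\<exists>y\<in>carrier rat_group. y \<otimes>\<^bsub>rat_group\<^esub> x = \<one>\<^bsub>rat_group\<^esub>"
    by (rule bexI[of _ "- x"]) (auto simp: rat_group_def)
qed (auto simp: rat_group_def)

interpretation rat_group: comm_group rat_group
  by (rule comm_group_rat_group)

lemma rat_group_simps [simp]:
  "carrier rat_group = UNIV" "x \<otimes>\<^bsub>rat_group\<^esub> y = x + y" "\<one>\<^bsub>rat_group\<^esub> = 0"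
  by (auto simp: rat_group_def)

lemma inv_rat_group [simp]: "inv\<^bsub>rat_group\<^esub> x = - x"
  by (rule rat_group.inv_equality) auto

lemma int_pow_rat_group [simp]: "x [^]\<^bsub>rat_group\<^esub> (k::int) = of_int k * x"
proof -
  have nat: "x [^]\<^bsub>rat_group\<^esub> (n::nat) = of_nat n * x" for n
    by (induction n) (auto simp: algebra_simps)
  show ?thesis
  proof (cases k rule: int_cases2)
    case (nonneg n)
    then show ?thesis by (simp add: int_pow_int nat)
  next
    case (nonpos n)
    then show ?thesis by (simp add: rat_group.int_pow_neg_int nat)
  qed
qed

lemma rat_quotient:
  fixes q :: rat obtains a b :: int where "q = of_int a / of_int b" "b > 0"
proof (cases "quotient_of q")
  case (Pair a b)
  then show ?thesis using that[of a b] quotient_of_div[OF Pair] quotient_of_denom_pos[OF Pair] by simp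
qed

text \<open>It allows two pure tensors to be rewritten with the same rational factor, so that their
  sum is again pure.\<close>

lemma rat_common_denominator:
  obtains u :: rat and a b :: int where "q = of_int a * u" "q' = of_int b * u"
proof -
  obtain a b :: int where q: "q = of_int a / of_int b" "b > 0" by (rule rat_quotient[of q])
  obtain a' b' :: int where q': "q' = of_int a' / of_int b'" "b' > 0" by (rule rat_quotient[of q'])
  show ?thesis
    by (rule that[of "a * b'" "1 / (of_int b * of_int b')" "a' * b"]) (use q q' in \<open>simp_all add: field_simps\<close>)
qed

section \<open>Pure tensors with rational factor\<close>

context comm_group
begin

abbreviation "free_pairs \<equiv> free_Abelian_group (carrier rat_group \<times> carrier G)"
abbreviation "null \<equiv> tensor_null rat_group G"
abbreviation "tens \<equiv> tensor_group rat_group G"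

definition tensor_of :: "rat \<Rightarrow> 'a \<Rightarrow> (rat \<times> 'a \<Rightarrow>\<^sub>0 int) set" where
  "tensor_of q x = null #>\<^bsub>free_pairs\<^esub> frag_of (q, x)"

lemma relator_left: "x \<in> carrier G \<Longrightarrow>
    frag_of (q + q', x) - frag_of (q, x) - frag_of (q', x) \<in> tensor_relators rat_group G"
  unfolding tensor_relators_def by (rule UnI1) force

lemma relator_right: "x \<in> carrier G \<Longrightarrow> y \<in> carrier G \<Longrightarrow>
    frag_of (q, x \<otimes> y) - frag_of (q, x) - frag_of (q, y) \<in> tensor_relators rat_group G"
  unfolding tensor_relators_def by (rule UnI2) auto

lemma relator_cases:
  assumes "c \<in> tensor_relators rat_group G"
  obtains q q' x where "c = frag_of (q + q', x) - frag_of (q, x) - frag_of (q', x)" "x \<in> carrier G"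
    | q x y where "c = frag_of (q, x \<otimes> y) - frag_of (q, x) - frag_of (q, y)" "x \<in> carrier G" "y \<in> carrier G"
  using assms by (auto simp: tensor_relators_def)

lemma relators_subset: "tensor_relators rat_group G \<subseteq> carrier free_pairs"
proof
  fix c assume "c \<in> tensor_relators rat_group G"
  moreover have "Poly_Mapping.keys (a - b - c) \<subseteq> S"
    if "Poly_Mapping.keys a \<subseteq> S" "Poly_Mapping.keys b \<subseteq> S" "Poly_Mapping.keys c \<subseteq> S" for a b c :: "rat \<times> 'a \<Rightarrow>\<^sub>0 int" and S
    using that keys_diff[of "a - b" c] keys_diff[of a b] by blast
  ultimately show "c \<in> carrier free_pairs" by (elim relator_cases) auto
qed

lemma subgroup_null: "subgroup null free_pairs"
  unfolding tensor_null_def by (rule group.generate_is_subgroup[OF group_free_Abelian_group relators_subset])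

lemma normal_null: "null \<lhd> free_pairs"
  by (rule comm_group.subgroup_imp_normal[OF abelian_free_Abelian_group subgroup_null])

lemma comm_group_tens: "comm_group tens"
  unfolding tensor_group_def by (rule comm_group.abelian_FactGroup[OF abelian_free_Abelian_group subgroup_null])

lemma coset_hom: "(\<lambda>c. null #>\<^bsub>free_pairs\<^esub> c) \<in> hom free_pairs tens"
  unfolding tensor_group_def by (rule normal.r_coset_hom_Mod[OF normal_null])

lemma coset_alt: "null #>\<^bsub>free_pairs\<^esub> c = (\<lambda>h. h + c) ` null"
  by (auto simp: r_coset_def)

lemma null_closed: "c \<in> null \<Longrightarrow> c' \<in> null \<Longrightarrow> c + c' \<in> null" "0 \<in> null" "c \<in> null \<Longrightarrow> - c \<in> null"
  using subgroup.m_closed[OF subgroup_null] subgroup.one_closed[OF subgroup_null]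
    subgroup.m_inv_closed[OF subgroup_null] subgroup.mem_carrier[OF subgroup_null] by auto

lemma coset_eq_iff: "null #>\<^bsub>free_pairs\<^esub> c = null #>\<^bsub>free_pairs\<^esub> c' \<longleftrightarrow> c - c' \<in> null"
proof
  assume "null #>\<^bsub>free_pairs\<^esub> c = null #>\<^bsub>free_pairs\<^esub> c'"
  then have "0 + c \<in> (\<lambda>h. h + c') ` null" using null_closed(2) unfolding coset_alt by blast
  then show "c - c' \<in> null" by auto
next
  assume c: "c - c' \<in> null"
  show "null #>\<^bsub>free_pairs\<^esub> c = null #>\<^bsub>free_pairs\<^esub> c'"
    unfolding coset_alt
  proof (intro equalityI image_subsetI)
    fix h assume "h \<in> null"
    then have "h + (c - c') \<in> null" "h + - (c - c') \<in> null"
      using null_closed(1)[OF _ c, of h] null_closed(1)[OF _ null_closed(3)[OF c], of h] by auto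
    then show "h + c \<in> (\<lambda>h. h + c') ` null" "h + c' \<in> (\<lambda>h. h + c) ` null"
      by (auto intro: image_eqI[rotated])
  qed
qed

lemma tensor_of_closed: "x \<in> carrier G \<Longrightarrow> tensor_of q x \<in> carrier tens"
  unfolding tensor_of_def by (rule hom_in_carrier[OF coset_hom]) simp

lemma tensor_of_hom_right: "tensor_of q \<in> hom G tens"
proof (rule homI)
  fix x y assume xy: "x \<in> carrier G" "y \<in> carrier G"
  have "frag_of (q, x \<otimes> y) - frag_of (q, x) - frag_of (q, y) \<in> null"
    unfolding tensor_null_def using xy by (intro generate.incl relator_right)
  then have "tensor_of q (x \<otimes> y) = null #>\<^bsub>free_pairs\<^esub> (frag_of (q, x) + frag_of (q, y))"
    unfolding tensor_of_def coset_eq_iff by (simp add: diff_diff_eq)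
  then show "tensor_of q (x \<otimes> y) = tensor_of q x \<otimes>\<^bsub>tens\<^esub> tensor_of q y"
    using hom_mult[OF coset_hom, of "frag_of (q, x)" "frag_of (q, y)"] xy by (simp add: tensor_of_def)
qed (rule tensor_of_closed)

lemma tensor_of_hom_left: "x \<in> carrier G \<Longrightarrow> (\<lambda>q. tensor_of q x) \<in> hom rat_group tens"
proof (rule homI)
  fix q q' assume x: "x \<in> carrier G"
  have "frag_of (q + q', x) - frag_of (q, x) - frag_of (q', x) \<in> null"
    unfolding tensor_null_def using x by (intro generate.incl relator_left)
  then have "tensor_of (q + q') x = null #>\<^bsub>free_pairs\<^esub> (frag_of (q, x) + frag_of (q', x))"
    unfolding tensor_of_def coset_eq_iff by (simp add: diff_diff_eq)
  then show "tensor_of (q \<otimes>\<^bsub>rat_group\<^esub> q') x = tensor_of q x \<otimes>\<^bsub>tens\<^esub> tensor_of q' x"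
    using hom_mult[OF coset_hom, of "frag_of (q, x)" "frag_of (q', x)"] x by (simp add: tensor_of_def)
qed (rule tensor_of_closed)

lemma group_tens: "group tens"
  using comm_group_tens by (rule comm_group.axioms(2))

lemma tensor_of_int: "x \<in> carrier G \<Longrightarrow> tensor_of (of_int k * q) x = tensor_of q (x [^] (k::int))"
  using hom_int_pow[OF tensor_of_hom_left[of x] _ rat_group.is_group group_tens, of q k]
    hom_int_pow[OF tensor_of_hom_right _ is_group group_tens, of x q k] by simp

text \<open>The map on the free group takes relators to relators and hence \<open>null\<close> into
  itself; multiplying the elementwise image by \<open>null\<close> therefore fills exactly one
  coset.\<close>

lemma tensor_map_tensor_of:
  assumes f: "\<And>q q'. f (q + q') = f q + f q'" and h: "h \<in> hom G G" and x: "x \<in> carrier G"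
  shows "tensor_map rat_group G f h (tensor_of q x) = tensor_of (f q) (h x)"
proof -
  define E where "E = frag_extend (frag_of \<circ> map_prod f h)"
  have hc: "h x \<in> carrier G" if "x \<in> carrier G" for x using hom_in_carrier[OF h that] .
  have add: "E (c + c') = E c + E c'" for c c' by (simp add: E_def frag_extend_add)
  have "E \<in> hom free_pairs free_pairs"
  proof (rule homI)
    fix c assume "c \<in> carrier free_pairs"
    then have "Poly_Mapping.keys c \<subseteq> UNIV \<times> carrier G" by simp
    then have "map_prod f h z \<in> UNIV \<times> carrier G" if "z \<in> Poly_Mapping.keys c" for z
      using that hc by (cases z) auto
    moreover have "Poly_Mapping.keys (E c) \<subseteq> (\<Union>z\<in>Poly_Mapping.keys c. {map_prod f h z})"
      using keys_frag_extend[of "frag_of \<circ> map_prod f h" c] by (simp add: E_def)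
    ultimately have "Poly_Mapping.keys (E c) \<subseteq> UNIV \<times> carrier G" by blast
    then show "E c \<in> carrier free_pairs" by simp
  qed (simp add: add)
  then interpret E: group_hom free_pairs free_pairs E
    by (simp add: group_hom_def group_hom_axioms_def)
  have "E ` tensor_relators rat_group G \<subseteq> tensor_relators rat_group G"
  proof
    fix c assume "c \<in> E ` tensor_relators rat_group G"
    then obtain z where z: "z \<in> tensor_relators rat_group G" "c = E z" by (elim imageE)
    from z(1) show "c \<in> tensor_relators rat_group G"
    proof (cases rule: relator_cases)
      case (1 q q' x)
      have "c = frag_of (f q + f q', h x) - frag_of (f q, h x) - frag_of (f q', h x)"
        unfolding z(2) 1(1) E_def by (simp add: frag_extend_diff f)
      then show ?thesis using relator_left[OF hc[OF 1(2)]] by simp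
    next
      case (2 q x y)
      have "c = frag_of (f q, h x \<otimes> h y) - frag_of (f q, h x) - frag_of (f q, h y)"
        unfolding z(2) 2(1) E_def using hom_mult[OF h 2(2,3)] by (simp add: frag_extend_diff)
      then show ?thesis using relator_right[OF hc[OF 2(2)] hc[OF 2(3)]] by simp
    qed
  qed
  then have "E ` null \<subseteq> null"
    unfolding tensor_null_def E.generate_img[OF relators_subset, symmetric]
    by (rule group.mono_generate[OF group_free_Abelian_group])
  then have En: "E c \<in> null" if "c \<in> null" for c using that by blast
  have Ex: "E (b + frag_of (q, x)) = E b + frag_of (f q, h x)" for b unfolding add by (simp add: E_def)
  have "tensor_map rat_group G f h (tensor_of q x) = (\<Union>a\<in>null. \<Union>b\<in>null. {a + (E b + frag_of (f q, h x))})"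
    unfolding tensor_map_def tensor_of_def coset_alt E_def[symmetric] set_mult_def mult_free_Abelian_group image_image Ex
    by (simp add: UNION_singleton_eq_range)
  also have "\<dots> = (\<lambda>c. c + frag_of (f q, h x)) ` null"
  proof (intro equalityI subsetI)
    fix y assume "y \<in> (\<Union>a\<in>null. \<Union>b\<in>null. {a + (E b + frag_of (f q, h x))})"
    then obtain a b where "a \<in> null" "b \<in> null" "y = (a + E b) + frag_of (f q, h x)" by (auto simp: add.assoc)
    then show "y \<in> (\<lambda>c. c + frag_of (f q, h x)) ` null" using null_closed(1)[OF _ En] by blast
  next
    fix y assume "y \<in> (\<lambda>c. c + frag_of (f q, h x)) ` null"
    then obtain c where c: "c \<in> null" "y = c + frag_of (f q, h x)" by blast
    have "y = c + (E 0 + frag_of (f q, h x))" using c(2) by (simp add: E_def)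
    then show "y \<in> (\<Union>a\<in>null. \<Union>b\<in>null. {a + (E b + frag_of (f q, h x))})" using c(1) null_closed(2) by blast
  qed
  finally show ?thesis unfolding tensor_of_def[of "f q"] coset_alt .
qed

text \<open>A homomorphism to the integers extends to a rational coordinate function on the tensor product.\<close>

lemma tensor_of_coordinate:
  assumes c: "\<And>x y. x \<in> carrier G \<Longrightarrow> y \<in> carrier G \<Longrightarrow> c (x \<otimes> y) = c x + (c y :: int)"
    and eq: "tensor_of q x = tensor_of q' y" and xy: "x \<in> carrier G" "y \<in> carrier G"
  shows "q * of_int (c x) = q' * of_int (c y)"
proof -
  obtain f where f: "f \<in> hom free_pairs rat_group"
    "\<And>z. z \<in> carrier rat_group \<times> carrier G \<Longrightarrow> f (frag_of z) = (\<lambda>(q, x). q * of_int (c x)) z"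
    using rat_group.free_Abelian_group_universal[of "\<lambda>(q, x). q * of_int (c x)" "carrier rat_group \<times> carrier G"] by auto
  interpret f: group_hom free_pairs rat_group f
    using f(1) by (simp add: group_hom_def group_hom_axioms_def)
  have add: "f (a + b) = f a + f b" if "a \<in> carrier free_pairs" "b \<in> carrier free_pairs" for a b
    using f.hom_mult[OF that] by simp
  have diff: "f (a - b) = f a - f b" if "a \<in> carrier free_pairs" "b \<in> carrier free_pairs" for a b
  proof -
    have "a - b \<in> carrier free_pairs" using that keys_diff[of a b] by auto
    from add[OF this that(2)] show ?thesis by simp
  qed
  have fof: "f (frag_of (q, x)) = q * of_int (c x)" if "x \<in> carrier G" for q x using f(2)[of "(q, x)"] that by simp
  have "tensor_relators rat_group G \<subseteq> kernel free_pairs rat_group f"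
  proof
    fix z assume z: "z \<in> tensor_relators rat_group G"
    have m: "frag_of (q, x) - frag_of (q', y) \<in> carrier free_pairs" "frag_of (q, x) \<in> carrier free_pairs"
      if "x \<in> carrier G" "y \<in> carrier G" for q q' x y
      using that keys_diff[of "frag_of (q, x)" "frag_of (q', y)"] by auto
    from z have "f z = 0"
    proof (cases rule: relator_cases)
      case (1 q q' x)
      then have "f z = (q + q') * of_int (c x) - q * of_int (c x) - q' * of_int (c x)"
        unfolding 1(1) by (simp only: diff m fof)
      then show ?thesis by (simp add: algebra_simps)
    next
      case (2 q x y)
      then have "f z = q * of_int (c (x \<otimes> y)) - q * of_int (c x) - q * of_int (c y)"
        unfolding 2(1) by (simp only: diff m fof m_closed)
      then show ?thesis unfolding c[OF 2(2,3)] by (simp add: algebra_simps)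
    qed
    then show "z \<in> kernel free_pairs rat_group f" using subsetD[OF relators_subset z] by (simp add: kernel_def)
  qed
  then have "null \<subseteq> kernel free_pairs rat_group f"
    unfolding tensor_null_def by (rule group.generate_subgroup_incl[OF group_free_Abelian_group _ f.subgroup_kernel])
  moreover have "frag_of (q, x) - frag_of (q', y) \<in> null"
    using eq unfolding tensor_of_def coset_eq_iff .
  ultimately have "f (frag_of (q, x) - frag_of (q', y)) = 0" by (auto simp: kernel_def)
  then show ?thesis using xy by (simp add: diff fof)
qed

end

text \<open>The rational span of \<open>N\<close> is stable and not zero, so it is the whole module;
  then \<open>1 \<otimes> y\<close> is a rational multiple of some element of \<open>N\<close>, and
  clearing the denominator gives \<open>k\<close>.\<close>

lemma irreducible_lattice_torsion:
  assumes irr: "irreducible_lattice G M \<phi>"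
    and N: "subgroup N M" "N \<noteq> {\<one>\<^bsub>M\<^esub>}" and stable: "\<And>g x. g \<in> carrier G \<Longrightarrow> x \<in> N \<Longrightarrow> \<phi> g x \<in> N"
    and y: "y \<in> carrier M"
  shows "\<exists>k::int. k \<noteq> 0 \<and> y [^]\<^bsub>M\<^esub> k \<in> N"
proof -
  interpret G_lattice G M \<phi> using irr by (simp add: irreducible_lattice_def)
  have NM: "x \<in> carrier M" if "x \<in> N" for x using subgroup.mem_carrier[OF N(1) that] .
  have hom: "\<phi> g \<in> hom M M" if "g \<in> carrier G" for g
    using hom_in_carrier[OF action_hom that] by (simp add: AutoGroup_def auto_def)
  obtain r :: nat and \<psi> where \<psi>: "\<psi> \<in> iso M (free_Abelian_group {..<r})"
    using free_finite_rank by (auto simp: is_iso_def)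
  \<comment> \<open>The integer coordinates detect equality in \<open>M\<close> and extend to
    rational coordinates on the tensor product; through them relations between tensors return to
    \<open>M\<close>.\<close>
  define c where "c j x = Poly_Mapping.lookup (\<psi> x) j" for j x
  have \<psi>h: "\<psi> \<in> hom M (free_Abelian_group {..<r})" and inj: "inj_on \<psi> (carrier M)"
    using \<psi> by (auto simp: iso_def bij_betw_def)
  have c: "c j (x \<otimes>\<^bsub>M\<^esub> y) = c j x + c j y" if "x \<in> carrier M" "y \<in> carrier M" for j x y
    using hom_mult[OF \<psi>h that] by (simp add: c_def lookup_add)
  have c_pow: "c j (x [^]\<^bsub>M\<^esub> (k::int)) = k * c j x" if "x \<in> carrier M" for j x k
    using hom_int_pow[OF \<psi>h that M.is_group group_free_Abelian_group, of k] hom_in_carrier[OF \<psi>h that]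
    by (simp add: c_def)
  have c_eq: "x = y" if "x \<in> carrier M" "y \<in> carrier M" "\<And>j. c j x = c j y" for x y
    using inj that by (auto simp: inj_on_def c_def intro: poly_mapping_eqI)
  let ?V = "tensor_group rat_group M" and ?t = "M.tensor_of"
  \<comment> \<open>Pure tensors already form a subgroup, so the span of \<open>N\<close> needs no
    sums.\<close>
  define S where "S = {?t q x | q x. x \<in> N}"
  have SI: "?t q x \<in> S" if "x \<in> N" for q x using that unfolding S_def by blast
  interpret V: comm_group ?V by (rule M.comm_group_tens)
  have tens_hom: "group_hom M ?V (?t q)" for q
    using M.tensor_of_hom_right by (simp add: group_hom_def group_hom_axioms_def)
  have S_sub: "subgroup S ?V"
  proof (rule V.subgroupI)
    show "S \<subseteq> carrier ?V" using NM by (auto simp: S_def M.tensor_of_closed)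
    show "S \<noteq> {}" using subgroup.one_closed[OF N(1)] by (auto simp: S_def)
    fix a assume "a \<in> S"
    then obtain q x where a: "a = ?t q x" "x \<in> N" by (auto simp: S_def)
    then show "inv\<^bsub>?V\<^esub> a \<in> S"
      using group_hom.hom_inv[OF tens_hom NM[OF a(2)], of q] SI[OF subgroup.m_inv_closed[OF N(1) a(2)], of q]
      by simp
    fix b assume "b \<in> S"
    then obtain q' x' where b: "b = ?t q' x'" "x' \<in> N" by (auto simp: S_def)
    obtain u :: rat and i j :: int where u: "q = of_int i * u" "q' = of_int j * u" by (rule rat_common_denominator)
    have "a = ?t u (x [^]\<^bsub>M\<^esub> i)" "b = ?t u (x' [^]\<^bsub>M\<^esub> j)"
      using a b NM M.tensor_of_int by (auto simp: u)
    moreover have n: "x [^]\<^bsub>M\<^esub> i \<in> N" "x' [^]\<^bsub>M\<^esub> j \<in> N"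
      using a b M.subgroup_int_pow_closed[OF N(1)] by auto
    ultimately have "a \<otimes>\<^bsub>?V\<^esub> b = ?t u (x [^]\<^bsub>M\<^esub> i \<otimes>\<^bsub>M\<^esub> x' [^]\<^bsub>M\<^esub> j)"
      using hom_mult[OF M.tensor_of_hom_right NM[OF n(1)] NM[OF n(2)], of u] by simp
    then show "a \<otimes>\<^bsub>?V\<^esub> b \<in> S" using SI[OF subgroup.m_closed[OF N(1) n]] by simp
  qed
  have S_scale: "tensor_map rat_group M (\<lambda>r. q * r) (\<lambda>x. x) z \<in> S" if zS: "z \<in> S" for q z
  proof -
    obtain q' x where z: "z = ?t q' x" "x \<in> N" using zS unfolding S_def by blast
    have "tensor_map rat_group M (\<lambda>r. q * r) (\<lambda>x. x) z = ?t (q * q') x"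
      unfolding z(1) by (rule M.tensor_map_tensor_of) (use NM[OF z(2)] in \<open>auto simp: distrib_left hom_def\<close>)
    then show ?thesis using z by (auto simp: S_def)
  qed
  have S_act: "tensor_map rat_group M (\<lambda>r. r) (\<phi> g) z \<in> S" if zS: "z \<in> S" and g: "g \<in> carrier G" for g z
  proof -
    obtain q' x where z: "z = ?t q' x" "x \<in> N" using zS unfolding S_def by blast
    have "tensor_map rat_group M (\<lambda>r. r) (\<phi> g) z = ?t q' (\<phi> g x)"
      unfolding z(1) by (rule M.tensor_map_tensor_of) (use NM[OF z(2)] hom[OF g] in auto)
    then show ?thesis using z stable[OF g] by (auto simp: S_def)
  qed
  have simple: "subgroup S ?V \<and>
      (\<forall>q. \<forall>z \<in> S. tensor_map rat_group M (\<lambda>r. q * r) (\<lambda>x. x) z \<in> S) \<and>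
      (\<forall>g \<in> carrier G. \<forall>z \<in> S. tensor_map rat_group M (\<lambda>r. r) (\<phi> g) z \<in> S) \<longrightarrow>
      S = {\<one>\<^bsub>?V\<^esub>} \<or> S = carrier ?V"
    using irr unfolding irreducible_lattice_def simple_QG_module_def by (elim conjE) (erule spec)
  have "S = {\<one>\<^bsub>?V\<^esub>} \<or> S = carrier ?V"
    by (rule mp[OF simple], intro conjI allI ballI S_sub S_scale S_act)
  then show ?thesis
  proof
    assume S1: "S = {\<one>\<^bsub>?V\<^esub>}"
    obtain x where x: "x \<in> N" "x \<noteq> \<one>\<^bsub>M\<^esub>" using N subgroup.one_closed[OF N(1)] by blast
    have one: "\<one>\<^bsub>M\<^esub> \<in> N" by (rule subgroup.one_closed[OF N(1)])
    have eq: "?t 1 x = ?t 1 \<one>\<^bsub>M\<^esub>" using SI[OF x(1), of 1] SI[OF one, of 1] unfolding S1 by simp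
    have "c j x = c j \<one>\<^bsub>M\<^esub>" for j
      using M.tensor_of_coordinate[where c = "c j", OF c eq NM[OF x(1)] NM[OF one]] by simp
    then have "x = \<one>\<^bsub>M\<^esub>" by (rule c_eq[OF NM[OF x(1)] NM[OF one]])
    then show ?thesis using x(2) by contradiction
  next
    assume "S = carrier ?V"
    then have "?t 1 y \<in> S" using M.tensor_of_closed[OF y] by simp
    then obtain q x where qx: "?t 1 y = ?t q x" "x \<in> N" unfolding S_def by blast
    obtain a b :: int where q: "q = of_int a / of_int b" "b > 0" by (rule rat_quotient[of q])
    have "c j (y [^]\<^bsub>M\<^esub> b) = c j (x [^]\<^bsub>M\<^esub> a)" for j
    proof -
      have "of_int (c j y) = q * of_int (c j x)"
        using M.tensor_of_coordinate[where c = "c j", OF c qx(1) y NM[OF qx(2)]] by simp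
      then have "of_int (b * c j y) = (of_int (a * c j x) :: rat)" using q by (simp add: field_simps)
      then show ?thesis unfolding c_pow[OF y] c_pow[OF NM[OF qx(2)]] by (simp only: of_int_eq_iff)
    qed
    then have "y [^]\<^bsub>M\<^esub> b = x [^]\<^bsub>M\<^esub> a" by (intro c_eq M.int_pow_closed y NM qx(2))
    then have "y [^]\<^bsub>M\<^esub> b \<in> N" using M.subgroup_int_pow_closed[OF N(1) qx(2)] by simp
    then show ?thesis using q(2) by (intro exI[of _ b]) simp
  qed
qed

section \<open>Finite elementary abelian groups\<close>

text \<open>Linear independence over the field with \<open>p\<close> elements, in multiplicative
  form: a vector outside the image of \<open>h\<close> becomes the image of one more basis
  vector.\<close>

lemma elementary_abelian_extend:
  assumes A: "comm_group A" and p: "Factorial_Ring.prime (p::nat)"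
    and exponent: "\<And>x. x \<in> carrier A \<Longrightarrow> x [^]\<^bsub>A\<^esub> p = \<one>\<^bsub>A\<^esub>"
    and h: "h \<in> hom (product_group {..<k::nat} (\<lambda>_. integer_mod_group p)) A"
      "inj_on h (carrier (product_group {..<k} (\<lambda>_. integer_mod_group p)))"
    and x: "x \<in> carrier A" "x \<notin> h ` carrier (product_group {..<k} (\<lambda>_. integer_mod_group p))"
  shows "\<exists>h' \<in> hom (product_group {..<Suc k} (\<lambda>_. integer_mod_group p)) A.
    inj_on h' (carrier (product_group {..<Suc k} (\<lambda>_. integer_mod_group p)))"
proof -
  interpret A: comm_group A by (rule A)
  let ?Z = "integer_mod_group p"
  let ?P = "\<lambda>k. product_group {..<k::nat} (\<lambda>_. ?Z)"
  have p1: "p > 1" using p prime_gt_1_nat by blast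
  have cZ: "carrier ?Z = {0..<int p}" using p1 by (simp add: carrier_integer_mod_group)
  have grp: "group (?P k)" for k by simp
  interpret h: group_hom "?P k" A h
    using h(1) by (simp add: group_hom_def group_hom_axioms_def)
  have pow_mod: "x [^]\<^bsub>A\<^esub> (c mod int p) = x [^]\<^bsub>A\<^esub> c" for c :: int
  proof -
    have "x [^]\<^bsub>A\<^esub> c = x [^]\<^bsub>A\<^esub> (int p * (c div int p) + c mod int p)" by simp
    also have "\<dots> = (x [^]\<^bsub>A\<^esub> int p) [^]\<^bsub>A\<^esub> (c div int p) \<otimes>\<^bsub>A\<^esub> x [^]\<^bsub>A\<^esub> (c mod int p)"
      using x(1) by (simp only: A.int_pow_mult A.int_pow_pow)
    also have "x [^]\<^bsub>A\<^esub> int p = \<one>\<^bsub>A\<^esub>" using exponent[OF x(1)] by (simp add: int_pow_int)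
    finally show ?thesis using x(1) by simp
  qed
  define r where "r f = restrict f {..<k}" for f :: "nat \<Rightarrow> int"
  define h' where "h' f = h (r f) \<otimes>\<^bsub>A\<^esub> x [^]\<^bsub>A\<^esub> f k" for f
  have r: "r f \<in> carrier (?P k)" and fk: "f k \<in> {0..<int p}" if "f \<in> carrier (?P (Suc k))" for f
    using that by (auto simp: r_def cZ PiE_iff)
  have hr: "h (r f) \<in> carrier A" if "f \<in> carrier (?P (Suc k))" for f
    by (rule h.hom_closed[OF r[OF that]])
  have hom: "h' \<in> hom (?P (Suc k)) A"
  proof (rule homI)
    fix f assume f: "f \<in> carrier (?P (Suc k))"
    show "h' f \<in> carrier A" unfolding h'_def using hr[OF f] x(1) by simp
    fix g assume g: "g \<in> carrier (?P (Suc k))"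
    have "r (f \<otimes>\<^bsub>?P (Suc k)\<^esub> g) = r f \<otimes>\<^bsub>?P k\<^esub> r g"
      by (auto simp: r_def restrict_def)
    moreover have "(f \<otimes>\<^bsub>?P (Suc k)\<^esub> g) k = (f k + g k) mod int p"
      by simp
    ultimately show "h' (f \<otimes>\<^bsub>?P (Suc k)\<^esub> g) = h' f \<otimes>\<^bsub>A\<^esub> h' g"
      unfolding h'_def
      using h.hom_mult[OF r[OF f] r[OF g]] hr[OF f] hr[OF g] x(1)
      by (simp only: pow_mod A.int_pow_mult) (simp add: A.m_ac)
  qed
  have "f = g" if f: "f \<in> carrier (?P (Suc k))" and g: "g \<in> carrier (?P (Suc k))" and eq: "h' f = h' g" for f g
  proof -
    have "f k = g k"
    proof (rule ccontr)
      assume ne: "f k \<noteq> g k"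
      let ?c = "f k - g k"
      have "\<not> int p dvd ?c"
      proof
        assume "int p dvd ?c"
        then have "f k mod int p = g k mod int p" by (simp add: mod_eq_dvd_iff)
        then show False using ne fk[OF f] fk[OF g] by simp
      qed
      \<comment> \<open>A nonzero difference of the new coordinates is invertible modulo
        \<open>p\<close>; with its inverse \<open>n\<close>, the relation expresses \<open>x\<close>
        by the image of \<open>h\<close>.\<close>
      then have "coprime (int p) ?c" using p by (intro prime_imp_coprime) auto
      then obtain m n where mn: "m * int p + n * ?c = 1" using bezout_int[of "int p" ?c] by (auto simp: coprime_iff_gcd_eq_1)
      have "x [^]\<^bsub>A\<^esub> f k = inv\<^bsub>A\<^esub> h (r f) \<otimes>\<^bsub>A\<^esub> (h (r f) \<otimes>\<^bsub>A\<^esub> x [^]\<^bsub>A\<^esub> f k)"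
        using hr[OF f] x(1) by (simp add: A.m_assoc[symmetric])
      also have "\<dots> = inv\<^bsub>A\<^esub> h (r f) \<otimes>\<^bsub>A\<^esub> (h (r g) \<otimes>\<^bsub>A\<^esub> x [^]\<^bsub>A\<^esub> g k)"
        using eq by (simp add: h'_def)
      finally have xf: "x [^]\<^bsub>A\<^esub> f k = (inv\<^bsub>A\<^esub> h (r f) \<otimes>\<^bsub>A\<^esub> h (r g)) \<otimes>\<^bsub>A\<^esub> x [^]\<^bsub>A\<^esub> g k"
        using hr[OF f] hr[OF g] x(1) by (simp add: A.m_assoc)
      let ?y = "inv\<^bsub>?P k\<^esub> (r f) \<otimes>\<^bsub>?P k\<^esub> r g"
      have y: "?y \<in> carrier (?P k)" using r[OF f] r[OF g] group.inv_closed[OF grp] monoid.m_closed[OF group.is_monoid[OF grp]] by blast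
      have "x [^]\<^bsub>A\<^esub> ?c = x [^]\<^bsub>A\<^esub> f k \<otimes>\<^bsub>A\<^esub> inv\<^bsub>A\<^esub> (x [^]\<^bsub>A\<^esub> g k)"
        using x(1) by (simp add: A.int_pow_diff)
      also have "\<dots> = inv\<^bsub>A\<^esub> h (r f) \<otimes>\<^bsub>A\<^esub> h (r g)"
        unfolding xf using hr[OF f] hr[OF g] x(1) by (simp add: A.m_assoc)
      also have "\<dots> = h ?y" using h.hom_mult[OF group.inv_closed[OF grp r[OF f]] r[OF g]] h.hom_inv[OF r[OF f]] by simp
      finally have xc: "x [^]\<^bsub>A\<^esub> ?c = h ?y" .
      have "x = x [^]\<^bsub>A\<^esub> (m * int p + n * ?c)" using x(1) by (simp only: mn A.int_pow_1)
      also have "\<dots> = x [^]\<^bsub>A\<^esub> (?c * n)" 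
        using pow_mod[of "m * int p + n * ?c"] pow_mod[of "?c * n"] by (simp add: mult.commute)
      also have "\<dots> = h (?y [^]\<^bsub>?P k\<^esub> n)"
        using x(1) h.hom_int_pow[OF y, of n] xc by (simp only: A.int_pow_pow[symmetric])
      finally have "x \<in> h ` carrier (?P k)" using group.int_pow_closed[OF grp y] by blast
      then show False using x(2) by contradiction
    qed
    have "h (r f) = h (r g)"
      using eq hr[OF f] hr[OF g] x(1) unfolding h'_def \<open>f k = g k\<close> by simp
    then have "r f = r g" using h(2) r[OF f] r[OF g] by (auto simp: inj_on_def)
    then have "f i = g i" if "i < k" for i using that by (metis r_def restrict_apply' lessThan_iff)
    with \<open>f k = g k\<close> have "f i = g i" if "i \<in> {..<Suc k}" for i using that by (auto simp: less_Suc_eq)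
    then show ?thesis using f g by (intro PiE_ext[of f "{..<Suc k}" "\<lambda>_. carrier ?Z" g]) auto
  qed
  then have "inj_on h' (carrier (?P (Suc k)))" by (intro inj_onI)
  then show ?thesis using hom by blast
qed

text \<open>While \<open>k < r\<close> the image has fewer elements than the group, so another
  independent vector exists; at \<open>k = r\<close> counting makes the embedding
  surjective.\<close>

lemma elementary_abelian_iso:
  assumes A: "comm_group A" and p: "Factorial_Ring.prime (p::nat)"
    and exponent: "\<And>x. x \<in> carrier A \<Longrightarrow> x [^]\<^bsub>A\<^esub> p = \<one>\<^bsub>A\<^esub>"
    and card: "card (carrier A) = p ^ r"
  shows "A \<cong> product_group {..<r} (\<lambda>_. integer_mod_group p)"
proof -
  interpret A: comm_group A by (rule A)
  let ?P = "\<lambda>k. product_group {..<k::nat} (\<lambda>_. integer_mod_group p)"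
  have p1: "p > 1" using p prime_gt_1_nat by blast
  have fin: "finite (carrier A)" using card p1 by (metis card.infinite less_nat_zero_code power_eq_0_iff)
  have cP: "card (carrier (?P k)) = p ^ k" for k
    using p1 by (simp add: card_PiE carrier_integer_mod_group)
  have "\<exists>h \<in> hom (?P k) A. inj_on h (carrier (?P k))" if "k \<le> r" for k
    using that
  proof (induction k)
    case 0
    have "(\<lambda>_. \<one>\<^bsub>A\<^esub>) \<in> hom (?P 0) A" by (auto intro: homI)
    moreover have "inj_on (\<lambda>_. \<one>\<^bsub>A\<^esub>) (carrier (?P 0))" by simp
    ultimately show ?case by blast
  next
    case (Suc k)
    then obtain h where h: "h \<in> hom (?P k) A" "inj_on h (carrier (?P k))" by auto
    have "card (h ` carrier (?P k)) < card (carrier A)"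
      unfolding card_image[OF h(2)] cP card using Suc.prems p1 by simp
    then have "\<not> carrier A \<subseteq> h ` carrier (?P k)"
      using hom_carrier[OF h(1)] by (metis less_irrefl subset_antisym)
    then obtain x where "x \<in> carrier A" "x \<notin> h ` carrier (?P k)" by blast
    then show ?case using elementary_abelian_extend[OF A p exponent h] by blast
  qed
  then obtain h where h: "h \<in> hom (?P r) A" "inj_on h (carrier (?P r))" by blast
  have "h ` carrier (?P r) = carrier A"
    using card_subset_eq[OF fin hom_carrier[OF h(1)]] card_image[OF h(2)] cP[of r] card by simp
  then have "h \<in> iso (?P r) A" using h by (simp add: iso_def bij_betw_def)
  then have "?P r \<cong> A" by (auto simp: is_iso_def)
  then show ?thesis by (rule group.iso_sym[rotated]) simp
qed

section \<open>The bar complex of a lattice\<close>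

text \<open>The passage from the additive index to a quotient group: \<Psi> pulls a transversal back
  to representatives of the cosets of \<open>N\<close>, which gives the order.\<close>

lemma quotient_elementary_abelian:
  fixes \<Psi> :: "'x \<Rightarrow> 'y::ab_group_add"
  assumes B: "comm_group B" and \<Psi>: "\<And>x y. x \<in> carrier B \<Longrightarrow> y \<in> carrier B \<Longrightarrow> \<Psi> (x \<otimes>\<^bsub>B\<^esub> y) = \<Psi> x + \<Psi> y"
    and inj: "inj_on \<Psi> (carrier B)" and Z: "Z \<subseteq> carrier B" and NZ: "N \<subseteq> Z"
    and sub: "add_subgroup (\<Psi> ` Z)" "add_subgroup (\<Psi> ` N)"
    and p: "Factorial_Ring.prime p" and index: "has_index (\<Psi> ` Z) (\<Psi> ` N) (p ^ r)"
    and exponent: "\<And>c. c \<in> \<Psi> ` Z \<Longrightarrow> (\<Sum>i<p. c) \<in> \<Psi> ` N"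
  shows "subgroup_generated B Z Mod N \<cong> product_group {..<r} (\<lambda>_. integer_mod_group p)"
proof -
  interpret B: comm_group B by (rule B)
  have one: "\<Psi> \<one>\<^bsub>B\<^esub> = 0" using \<Psi>[of "\<one>\<^bsub>B\<^esub>" "\<one>\<^bsub>B\<^esub>"] by simp
  have inv: "\<Psi> (inv\<^bsub>B\<^esub> x) = - \<Psi> x" if "x \<in> carrier B" for x
    using \<Psi>[of x "inv\<^bsub>B\<^esub> x"] that one by (simp add: eq_neg_iff_add_eq_0 add.commute)
  have pow: "\<Psi> (x [^]\<^bsub>B\<^esub> (n::nat)) = (\<Sum>i<n. \<Psi> x)" if "x \<in> carrier B" for x n
    by (induction n) (use that one \<Psi> in auto)
  have mem: "x \<in> S \<longleftrightarrow> \<Psi> x \<in> \<Psi> ` S" if "x \<in> carrier B" "S \<subseteq> carrier B" for x S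
    by (rule inj_on_image_mem_iff[OF inj that, symmetric])
  have subgroup: "subgroup S B" if S: "S \<subseteq> carrier B" "add_subgroup (\<Psi> ` S)" for S
  proof (rule B.subgroupI[OF S(1)])
    show "S \<noteq> {}" using add_subgroupD(1)[OF S(2)] by auto
    fix x assume x: "x \<in> S"
    then have xB: "x \<in> carrier B" using S(1) by blast
    have "\<Psi> (inv\<^bsub>B\<^esub> x) \<in> \<Psi> ` S"
      unfolding inv[OF xB] by (rule add_subgroupD(3)[OF S(2) imageI[OF x]])
    then show "inv\<^bsub>B\<^esub> x \<in> S" unfolding mem[OF B.inv_closed[OF xB] S(1)] .
    fix y assume y: "y \<in> S"
    then have yB: "y \<in> carrier B" using S(1) by blast
    have "\<Psi> (x \<otimes>\<^bsub>B\<^esub> y) \<in> \<Psi> ` S"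
      unfolding \<Psi>[OF xB yB] by (rule add_subgroupD(4)[OF S(2) imageI[OF x] imageI[OF y]])
    then show "x \<otimes>\<^bsub>B\<^esub> y \<in> S" unfolding mem[OF B.m_closed[OF xB yB] S(1)] .
  qed
  have NB: "N \<subseteq> carrier B" using NZ Z by blast
  let ?A = "subgroup_generated B Z"
  have subZ: "subgroup Z B" and subNB: "subgroup N B" using subgroup Z NB sub by auto
  interpret A: comm_group ?A by (rule B.abelian_subgroup_generated[OF B])
  have cA: "carrier ?A = Z" by (rule subgroup.carrier_subgroup_generated_subgroup[OF subZ])
  have subN: "subgroup N ?A"
    using subNB NZ by (simp add: B.subgroup_subgroup_generated_iff cA)
  interpret H: comm_group "?A Mod N" by (rule A.abelian_FactGroup[OF subN])
  interpret N: normal N ?A by (rule A.subgroup_imp_normal[OF subN])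
  have coset: "N #>\<^bsub>?A\<^esub> a = N #>\<^bsub>?A\<^esub> b \<longleftrightarrow> \<Psi> a - \<Psi> b \<in> \<Psi> ` N" if a: "a \<in> Z" and b: "b \<in> Z" for a b
  proof
    assume "N #>\<^bsub>?A\<^esub> a = N #>\<^bsub>?A\<^esub> b"
    then have "a \<in> N #>\<^bsub>?A\<^esub> b" using A.rcos_self[OF _ subN, of a] a cA by simp
    then obtain n where n: "n \<in> N" "a = n \<otimes>\<^bsub>B\<^esub> b" by (auto simp: r_coset_def)
    have "\<Psi> a = \<Psi> n + \<Psi> b" unfolding n(2) by (rule \<Psi>[OF subsetD[OF NB n(1)] subsetD[OF Z b]])
    then show "\<Psi> a - \<Psi> b \<in> \<Psi> ` N" using n(1) by simp
  next
    assume "\<Psi> a - \<Psi> b \<in> \<Psi> ` N"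
    then obtain n where n: "n \<in> N" "\<Psi> a = \<Psi> n + \<Psi> b" by (auto simp: algebra_simps)
    have nb: "n \<in> carrier B" "b \<in> carrier B" using n(1) b NB Z by auto
    have "\<Psi> a = \<Psi> (n \<otimes>\<^bsub>B\<^esub> b)" unfolding n(2) by (rule \<Psi>[OF nb, symmetric])
    then have "a = n \<otimes>\<^bsub>B\<^esub> b" using inj subsetD[OF Z a] B.m_closed[OF nb] by (intro inj_onD[OF inj])
    then have "a \<in> N #>\<^bsub>?A\<^esub> b" using n(1) by (auto simp: r_coset_def)
    then show "N #>\<^bsub>?A\<^esub> a = N #>\<^bsub>?A\<^esub> b" using A.repr_independence[OF _ _ subN, of a b] b cA by simp
  qed
  have cH: "carrier (?A Mod N) = (\<lambda>a. N #>\<^bsub>?A\<^esub> a) ` Z" by (simp add: carrier_FactGroup cA)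
  obtain T where T0: "transversal (\<Psi> ` Z) (\<Psi> ` N) T" and cardT: "card T = p ^ r"
    using index unfolding has_index_def by blast
  note T1 = T0[unfolded transversal_def, THEN conjunct1] and T2 = T0[unfolded transversal_def, THEN conjunct2]
  define S where "S = {z \<in> Z. \<Psi> z \<in> T}"
  have ST: "\<Psi> ` S = T" using T1 by (auto simp: S_def)
  have SB: "S \<subseteq> carrier B" using Z unfolding S_def by blast
  have "inj_on \<Psi> S" by (rule inj_on_subset[OF inj SB])
  from card_image[OF this] have cardS: "card S = p ^ r" unfolding ST cardT by simp
  have injS: "inj_on (\<lambda>a. N #>\<^bsub>?A\<^esub> a) S"
  proof (rule inj_onI)
    fix a b assume ab: "a \<in> S" "b \<in> S" "N #>\<^bsub>?A\<^esub> a = N #>\<^bsub>?A\<^esub> b"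
    then have "\<Psi> a - \<Psi> b \<in> \<Psi> ` N" using coset[of a b] by (simp add: S_def)
    moreover have "\<Psi> a - \<Psi> a \<in> \<Psi> ` N" using add_subgroupD(1)[OF sub(2)] by simp
    moreover have "\<Psi> a \<in> \<Psi> ` Z" "\<Psi> a \<in> T" "\<Psi> b \<in> T" using ab by (auto simp: S_def)
    ultimately have "\<Psi> a = \<Psi> b" using T2 by blast
    then show "a = b" using ab SB by (intro inj_onD[OF inj]) auto
  qed
  have imS: "(\<lambda>a. N #>\<^bsub>?A\<^esub> a) ` S = (\<lambda>a. N #>\<^bsub>?A\<^esub> a) ` Z"
  proof (intro equalityI image_subsetI)
    fix a assume a: "a \<in> Z"
    from bspec[OF T2 imageI[OF a]] obtain t where t: "t \<in> T" "\<Psi> a - t \<in> \<Psi> ` N" by (elim ex1E conjE)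
    from t(1) obtain b where b: "b \<in> S" "t = \<Psi> b" unfolding ST[symmetric] by (elim imageE)
    then have "b \<in> Z" by (simp add: S_def)
    then have "N #>\<^bsub>?A\<^esub> a = N #>\<^bsub>?A\<^esub> b" using coset[OF a, of b] t(2) unfolding b(2) by (simp only:)
    then show "N #>\<^bsub>?A\<^esub> a \<in> (\<lambda>a. N #>\<^bsub>?A\<^esub> a) ` S" using b(1) by (rule image_eqI)
  next
    fix a assume "a \<in> S"
    then have "a \<in> Z" by (simp add: S_def)
    then show "N #>\<^bsub>?A\<^esub> a \<in> (\<lambda>a. N #>\<^bsub>?A\<^esub> a) ` Z" by (rule imageI)
  qed
  have "card (carrier (?A Mod N)) = p ^ r"
    unfolding cH imS[symmetric] card_image[OF injS] by (rule cardS)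
  moreover have "x [^]\<^bsub>?A Mod N\<^esub> p = \<one>\<^bsub>?A Mod N\<^esub>" if xH: "x \<in> carrier (?A Mod N)" for x
  proof -
    from xH obtain a where a: "a \<in> Z" "x = N #>\<^bsub>?A\<^esub> a" unfolding cH by (elim imageE)
    interpret q: group_hom ?A "?A Mod N" "\<lambda>a. N #>\<^bsub>?A\<^esub> a"
      using N.r_coset_hom_Mod by (simp add: group_hom_def group_hom_axioms_def)
    have pw: "a [^]\<^bsub>?A\<^esub> p = a [^]\<^bsub>B\<^esub> p" by (simp add: pow_subgroup_generated)
    have aB: "a [^]\<^bsub>B\<^esub> p \<in> carrier B" using subsetD[OF Z a(1)] by simp
    have "\<Psi> (a [^]\<^bsub>B\<^esub> p) \<in> \<Psi> ` N"
      unfolding pow[OF subsetD[OF Z a(1)]] by (rule exponent[OF imageI[OF a(1)]])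
    then have n: "a [^]\<^bsub>?A\<^esub> p \<in> N" unfolding pw mem[OF aB NB] .
    have "x [^]\<^bsub>?A Mod N\<^esub> p = N #>\<^bsub>?A\<^esub> (a [^]\<^bsub>?A\<^esub> p)"
      unfolding a(2) by (rule q.hom_nat_pow[symmetric]) (simp only: cA a(1))
    also have "\<dots> = N" by (rule A.coset_join2[OF subgroup.mem_carrier[OF subN n] subN n])
    finally show ?thesis by simp
  qed
  ultimately show ?thesis by (intro elementary_abelian_iso[OF H.comm_group_axioms p])
qed

text \<open>The inverse turns the left action used in the bar complex into multiplication of coefficients
  by the first entry of a tuple.\<close>

locale lattice_coordinates = G_module G M \<phi>
  for G :: "('g, 'c) monoid_scheme" (structure) and M :: "('m, 'd) monoid_scheme" and \<phi> +
  fixes r :: nat and \<psi> :: "'m \<Rightarrow> (nat \<Rightarrow>\<^sub>0 int)"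
  assumes comm: "comm_group G" and \<psi>: "\<psi> \<in> iso M (free_Abelian_group {..<r})"
begin

definition "L = carrier (free_Abelian_group {..<r})"

definition \<psi>_inv :: "(nat \<Rightarrow>\<^sub>0 int) \<Rightarrow> 'm" where "\<psi>_inv = inv_into (carrier M) \<psi>"

text \<open>Basis vectors from \<open>r\<close> on are fixed, so that the laws of
  \<open>coefficients\<close> hold on the whole type and not only on \<open>L\<close>.\<close>

definition \<rho> :: "'g \<Rightarrow> (nat \<Rightarrow>\<^sub>0 int) \<Rightarrow> (nat \<Rightarrow>\<^sub>0 int)" where
  "\<rho> g = frag_extend (\<lambda>j. if j < r then \<psi> (\<phi> (inv g) (\<psi>_inv (frag_of j))) else frag_of j)"

lemma psi_hom: "\<psi> \<in> hom M (free_Abelian_group {..<r})"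
  using \<psi> by (simp add: iso_def)

lemma psi_bij: "bij_betw \<psi> (carrier M) L"
  using \<psi> by (simp add: iso_def L_def)

lemma psi_closed: "x \<in> carrier M \<Longrightarrow> \<psi> x \<in> L"
  using psi_bij by (auto simp: bij_betw_def)

lemma psi_mult: "x \<in> carrier M \<Longrightarrow> y \<in> carrier M \<Longrightarrow> \<psi> (x \<otimes>\<^bsub>M\<^esub> y) = \<psi> x + \<psi> y"
  using hom_mult[OF psi_hom] by simp

lemma psi_inj: "x \<in> carrier M \<Longrightarrow> y \<in> carrier M \<Longrightarrow> \<psi> x = \<psi> y \<Longrightarrow> x = y"
  using psi_bij by (auto simp: bij_betw_def inj_on_def)

lemma psi_psi_inv: "y \<in> L \<Longrightarrow> \<psi> (\<psi>_inv y) = y"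
  unfolding \<psi>_inv_def by (rule bij_betw_inv_into_right[OF psi_bij])

lemma psi_inv_psi: "x \<in> carrier M \<Longrightarrow> \<psi>_inv (\<psi> x) = x"
  unfolding \<psi>_inv_def by (rule bij_betw_inv_into_left[OF psi_bij])

lemma psi_inv_closed: "y \<in> L \<Longrightarrow> \<psi>_inv y \<in> carrier M"
  unfolding \<psi>_inv_def using bij_betw_inv_into[OF psi_bij] by (auto simp: bij_betw_def)

lemma psi_inv_hom: "\<psi>_inv \<in> hom (free_Abelian_group {..<r}) M"
  using M.iso_set_sym[OF \<psi>] by (simp add: iso_def \<psi>_inv_def)

lemma phi_auto: "g \<in> carrier G \<Longrightarrow> \<phi> g \<in> auto M"
  using hom_in_carrier[OF action_hom] by (simp add: AutoGroup_def)

lemma phi_hom: "g \<in> carrier G \<Longrightarrow> \<phi> g \<in> hom M M"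
  using phi_auto by (simp add: auto_def)

lemma phi_closed: "g \<in> carrier G \<Longrightarrow> x \<in> carrier M \<Longrightarrow> \<phi> g x \<in> carrier M"
  using hom_in_carrier[OF phi_hom] .

lemma phi_mult:
  assumes "g \<in> carrier G" "h \<in> carrier G" "x \<in> carrier M"
  shows "\<phi> (g \<otimes> h) x = \<phi> g (\<phi> h x)"
proof -
  have "\<phi> (g \<otimes> h) = \<phi> g \<otimes>\<^bsub>AutoGroup M\<^esub> \<phi> h" using hom_mult[OF action_hom] assms by simp
  then show ?thesis
    using phi_auto[OF assms(1)] phi_auto[OF assms(2)] assms(3)
    by (simp add: AutoGroup_def BijGroup_def auto_def compose_def)
qed

lemma phi_one: assumes "x \<in> carrier M" shows "\<phi> \<one> x = x"
proof -
  have "\<phi> \<one> (\<phi> \<one> x) = \<phi> \<one> x" using phi_mult[of \<one> \<one> x] assms by simp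
  moreover have "inj_on (\<phi> \<one>) (carrier M)" using phi_auto[of \<one>] by (simp add: auto_def Bij_def bij_betw_def)
  ultimately show ?thesis using phi_closed[of \<one> x] assms by (auto simp: inj_on_def)
qed

lemma L_subgroup: "add_subgroup L"
  unfolding add_subgroup_def L_def
proof (intro conjI ballI)
  fix x y assume "x \<in> carrier (free_Abelian_group {..<r})" "y \<in> carrier (free_Abelian_group {..<r})"
  then show "x - y \<in> carrier (free_Abelian_group {..<r})" using keys_diff[of x y] by auto
qed simp

lemma rho_alt:
  assumes g: "g \<in> carrier G" and y: "y \<in> L" shows "\<rho> g y = \<psi> (\<phi> (inv g) (\<psi>_inv y))"
proof -
  have F: "(\<lambda>y. \<psi> (\<phi> (inv g) (\<psi>_inv y))) \<in> hom (free_Abelian_group {..<r}) (free_Abelian_group {..<r})"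
    using Group.hom_compose[OF psi_inv_hom Group.hom_compose[OF phi_hom[of "inv g"] psi_hom]] g by (simp add: comp_def)
  have "Poly_Mapping.keys y \<subseteq> {..<r}" using y by (simp add: L_def)
  then show ?thesis
  proof (rule free_Abelian_group_induct)
    show "\<rho> g 0 = \<psi> (\<phi> (inv g) (\<psi>_inv 0))" using hom_frag_diff[OF F, of 0 0] by (simp add: \<rho>_def)
  next
    fix x y assume "Poly_Mapping.keys x \<subseteq> {..<r}" "Poly_Mapping.keys y \<subseteq> {..<r}"
      "\<rho> g x = \<psi> (\<phi> (inv g) (\<psi>_inv x))" "\<rho> g y = \<psi> (\<phi> (inv g) (\<psi>_inv y))"
    then show "\<rho> g (x - y) = \<psi> (\<phi> (inv g) (\<psi>_inv (x - y)))"
      using hom_frag_diff[OF F, of x y] by (simp add: \<rho>_def frag_extend_diff)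
  next
    fix j assume "j \<in> {..<r}"
    then show "\<rho> g (frag_of j) = \<psi> (\<phi> (inv g) (\<psi>_inv (frag_of j)))" by (simp add: \<rho>_def)
  qed
qed

lemma rho_closed: "g \<in> carrier G \<Longrightarrow> y \<in> L \<Longrightarrow> \<rho> g y \<in> L"
  by (simp add: rho_alt psi_closed phi_closed psi_inv_closed)

lemma rho_psi: "g \<in> carrier G \<Longrightarrow> x \<in> carrier M \<Longrightarrow> \<rho> g (\<psi> x) = \<psi> (\<phi> (inv g) x)"
  by (simp add: rho_alt psi_closed psi_inv_psi)

lemma frag_of_L: "frag_of j \<in> L \<longleftrightarrow> j < r"
  by (simp add: L_def)

sublocale coefficients G \<rho> L
proof unfold_locales
  fix g x y show "\<rho> g (x - y) = \<rho> g x - \<rho> g y" by (simp add: \<rho>_def frag_extend_diff)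
next
  fix g h x assume gh: "g \<in> carrier G" "h \<in> carrier G"
  interpret G: comm_group G by (rule comm)
  show "\<rho> (g \<otimes> h) x = \<rho> g (\<rho> h x)"
  proof (induction x rule: frag_induct)
    case (2 j)
    show ?case
    proof (cases "j < r")
      case True
      let ?y = "\<psi>_inv (frag_of j)"
      have y: "?y \<in> carrier M" using psi_inv_closed True frag_of_L by blast
      \<comment> \<open>Commutativity lets inversion respect products, so the inverted action is
        again a left action.\<close>
      have inv: "inv (g \<otimes> h) = inv g \<otimes> inv h" using gh by (simp add: G.inv_mult)
      have j: "\<psi> ?y = frag_of j" using psi_psi_inv True frag_of_L by blast
      have "\<rho> (g \<otimes> h) (\<psi> ?y) = \<rho> g (\<rho> h (\<psi> ?y))"
        using gh y by (simp add: rho_psi phi_closed inv phi_mult)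
      then show ?thesis unfolding j .
    qed (simp add: \<rho>_def)
  qed (simp only: \<rho>_def frag_extend_0 frag_extend_diff)+
next
  fix x show "\<rho> \<one> x = x"
  proof (induction x rule: frag_induct)
    case (2 j)
    show ?case
    proof (cases "j < r")
      case True
      let ?y = "\<psi>_inv (frag_of j)"
      have y: "?y \<in> carrier M" using psi_inv_closed True frag_of_L by blast
      have j: "\<psi> ?y = frag_of j" using psi_psi_inv True frag_of_L by blast
      have "\<rho> \<one> (\<psi> ?y) = \<psi> ?y" using y by (simp add: rho_psi phi_one)
      then show ?thesis unfolding j .
    qed (simp add: \<rho>_def)
  qed (simp only: \<rho>_def frag_extend_0 frag_extend_diff)+
next
  show "add_subgroup L" by (rule L_subgroup)
next
  fix g x assume "g \<in> carrier G" "x \<in> L"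
  then show "\<rho> g x \<in> L" by (rule rho_closed)
qed

end

locale finite_lattice_coordinates = lattice_coordinates G M \<phi> r \<psi>
  for G :: "('g, 'c) monoid_scheme" (structure) and M :: "('m, 'd) monoid_scheme" and \<phi> r \<psi> +
  assumes finite_G: "finite (carrier G)"
begin

lemma finite_tuples: "finite (tuples n G)"
  using finite_lists_length_eq[OF finite_G, of n] by (simp add: tuples_def conj_commute)

text \<open>As \<open>G\<close> is finite, bar chains are all extensional functions on tuples; in
  coordinates they become finitely supported functions with values in \<open>L\<close>.\<close>

definition \<Psi> :: "nat \<Rightarrow> ('g list \<Rightarrow> 'm) \<Rightarrow> ('g list \<Rightarrow>\<^sub>0 (nat \<Rightarrow>\<^sub>0 int))" where
  "\<Psi> n c = (\<Sum>xs\<in>tuples n G. Poly_Mapping.single xs (\<psi> (c xs)))"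

lemma carrier_bar_chains: "carrier (bar_chains G M n) = tuples n G \<rightarrow>\<^sub>E carrier M"
  using finite_tuples[of n] M.is_group by (auto simp: bar_chains_def carrier_sum_group)

lemma comm_group_bar_chains: "comm_group (bar_chains G M n)"
proof (rule group.group_comm_groupI)
  show "group (bar_chains G M n)" unfolding bar_chains_def by (rule sum_group) (rule M.is_group)
  fix x y assume "x \<in> carrier (bar_chains G M n)" "y \<in> carrier (bar_chains G M n)"
  then show "x \<otimes>\<^bsub>bar_chains G M n\<^esub> y = y \<otimes>\<^bsub>bar_chains G M n\<^esub> x"
    unfolding carrier_bar_chains by (auto simp: bar_chains_def PiE_iff M.m_comm intro: restrict_ext)
qed

lemma lookup_Psi: "Poly_Mapping.lookup (\<Psi> n c) xs = (if xs \<in> tuples n G then \<psi> (c xs) else 0)"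
  using finite_tuples[of n] by (simp add: \<Psi>_def lookup_sum lookup_single when_def)

lemma Psi_mult:
  assumes "c \<in> carrier (bar_chains G M n)" "c' \<in> carrier (bar_chains G M n)"
  shows "\<Psi> n (c \<otimes>\<^bsub>bar_chains G M n\<^esub> c') = \<Psi> n c + \<Psi> n c'"
proof (rule poly_mapping_eqI)
  fix xs
  have "xs \<in> tuples n G \<Longrightarrow> c xs \<in> carrier M" "xs \<in> tuples n G \<Longrightarrow> c' xs \<in> carrier M"
    using assms by (auto simp: carrier_bar_chains)
  then show "Poly_Mapping.lookup (\<Psi> n (c \<otimes>\<^bsub>bar_chains G M n\<^esub> c')) xs = Poly_Mapping.lookup (\<Psi> n c + \<Psi> n c') xs"
    by (simp add: lookup_Psi lookup_add bar_chains_def psi_mult)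
qed

lemma Psi_inj: "inj_on (\<Psi> n) (carrier (bar_chains G M n))"
proof (rule inj_onI)
  fix c c' assume c: "c \<in> carrier (bar_chains G M n)" "c' \<in> carrier (bar_chains G M n)" "\<Psi> n c = \<Psi> n c'"
  show "c = c'"
  proof (rule PiE_ext[OF c(1)[unfolded carrier_bar_chains] c(2)[unfolded carrier_bar_chains]])
    fix xs assume xs: "xs \<in> tuples n G"
    have "\<psi> (c xs) = \<psi> (c' xs)" using lookup_Psi[of n c xs] lookup_Psi[of n c' xs] c(3) xs by simp
    moreover have "c xs \<in> carrier M" "c' xs \<in> carrier M" using c xs by (auto simp: carrier_bar_chains)
    ultimately show "c xs = c' xs" using psi_inj by blast
  qed
qed

lemma Psi_image: "\<Psi> n ` carrier (bar_chains G M n) = module_chains L (tuples n G)"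
proof (intro equalityI subsetI)
  fix y assume "y \<in> \<Psi> n ` carrier (bar_chains G M n)"
  then obtain c where c: "c \<in> carrier (bar_chains G M n)" "y = \<Psi> n c" by blast
  have "Poly_Mapping.keys y \<subseteq> tuples n G" by (auto simp: c(2) in_keys_iff lookup_Psi split: if_splits)
  moreover have "Poly_Mapping.lookup y xs \<in> L" for xs
    using c(1) psi_closed add_subgroupD(1)[OF L_subgroup] by (auto simp: c(2) lookup_Psi carrier_bar_chains)
  ultimately show "y \<in> module_chains L (tuples n G)" by (simp add: module_chains_def)
next
  fix y assume y: "y \<in> module_chains L (tuples n G)"
  then have yL: "Poly_Mapping.lookup y xs \<in> L" for xs by (simp add: module_chains_def)
  let ?c = "\<lambda>xs\<in>tuples n G. \<psi>_inv (Poly_Mapping.lookup y xs)"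
  have c: "?c \<in> carrier (bar_chains G M n)"
    unfolding carrier_bar_chains using psi_inv_closed yL by auto
  have "\<Psi> n ?c = y"
  proof (rule poly_mapping_eqI)
    fix xs
    have "xs \<notin> tuples n G \<Longrightarrow> Poly_Mapping.lookup y xs = 0"
      using y by (auto simp: module_chains_def in_keys_iff)
    then show "Poly_Mapping.lookup (\<Psi> n ?c) xs = Poly_Mapping.lookup y xs"
      by (simp add: lookup_Psi psi_psi_inv[OF yL])
  qed
  from this[symmetric] c show "y \<in> \<Psi> n ` carrier (bar_chains G M n)" by (rule image_eqI)
qed

lemma Psi_one: "\<Psi> n \<one>\<^bsub>bar_chains G M n\<^esub> = 0"
proof -
  interpret B: comm_group "bar_chains G M n" by (rule comm_group_bar_chains)
  show ?thesis using Psi_mult[OF B.one_closed B.one_closed] by simp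
qed

lemma Psi_inv:
  assumes "c \<in> carrier (bar_chains G M n)" shows "\<Psi> n (inv\<^bsub>bar_chains G M n\<^esub> c) = - \<Psi> n c"
proof -
  interpret B: comm_group "bar_chains G M n" by (rule comm_group_bar_chains)
  have "\<Psi> n (inv\<^bsub>bar_chains G M n\<^esub> c) + \<Psi> n c = 0"
    unfolding Psi_mult[OF B.inv_closed[OF assms] assms, symmetric] B.l_inv[OF assms] by (rule Psi_one)
  then show ?thesis by (simp only: eq_neg_iff_add_eq_0)
qed

lemma Psi_sign:
  assumes "c \<in> carrier (bar_chains G M n)"
  shows "\<Psi> n (c [^]\<^bsub>bar_chains G M n\<^esub> ((-1) ^ i :: int)) = (if even i then \<Psi> n c else - \<Psi> n c)"
proof -
  interpret B: comm_group "bar_chains G M n" by (rule comm_group_bar_chains)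
  show ?thesis
  proof (cases "even i")
    case True
    then show ?thesis using assms by (simp add: B.int_pow_1)
  next
    case False
    then have "c [^]\<^bsub>bar_chains G M n\<^esub> ((-1) ^ i :: int) = inv\<^bsub>bar_chains G M n\<^esub> c"
      using assms B.int_pow_neg[of c 1] by (simp add: B.int_pow_1)
    then show ?thesis using False Psi_inv[OF assms] by simp
  qed
qed

lemma Psi_finprod:
  assumes "finite I" "\<And>i. i \<in> I \<Longrightarrow> f i \<in> carrier (bar_chains G M n)"
  shows "\<Psi> n (finprod (bar_chains G M n) f I) = (\<Sum>i\<in>I. \<Psi> n (f i))"
proof -
  interpret B: comm_group "bar_chains G M n" by (rule comm_group_bar_chains)
  show ?thesis
    using assms
  proof (induction I rule: finite_induct)
    case empty
    then show ?case by (simp add: Psi_one)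
  next
    case (insert i I)
    then have f: "f \<in> I \<rightarrow> carrier (bar_chains G M n)" "f i \<in> carrier (bar_chains G M n)" by auto
    have "\<Psi> n (finprod (bar_chains G M n) f (insert i I)) = \<Psi> n (f i \<otimes>\<^bsub>bar_chains G M n\<^esub> finprod (bar_chains G M n) f I)"
      using B.finprod_insert[OF insert.hyps(1,2) f] by simp
    also have "\<dots> = \<Psi> n (f i) + \<Psi> n (finprod (bar_chains G M n) f I)"
      by (rule Psi_mult[OF f(2) B.finprod_closed[OF f(1)]])
    finally show ?case using insert by simp
  qed
qed

lemma bar_single_closed: "m \<in> carrier M \<Longrightarrow> bar_single G M n xs m \<in> carrier (bar_chains G M n)"
  by (auto simp: carrier_bar_chains bar_single_def)

lemma psi_one: "\<psi> \<one>\<^bsub>M\<^esub> = 0"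
  using psi_mult[of "\<one>\<^bsub>M\<^esub>" "\<one>\<^bsub>M\<^esub>"] by simp

lemma Psi_single: "xs \<in> tuples n G \<Longrightarrow> \<Psi> n (bar_single G M n xs m) = Poly_Mapping.single xs (\<psi> m)"
  by (rule poly_mapping_eqI) (auto simp: lookup_Psi bar_single_def lookup_single when_def psi_one)

definition bar_term :: "nat \<Rightarrow> 'g list \<Rightarrow> 'm \<Rightarrow> nat \<Rightarrow> 'g list \<Rightarrow> 'm" where
  "bar_term n xs m i = bar_single G M n (bar_face G i xs) (if i = 0 then \<phi> (inv (hd xs)) m else m)
      [^]\<^bsub>bar_chains G M n\<^esub> ((-1) ^ i :: int)"

lemma bar_term_closed:
  assumes "xs \<in> tuples (Suc n) G" "m \<in> carrier M" shows "bar_term n xs m i \<in> carrier (bar_chains G M n)"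
proof -
  interpret B: comm_group "bar_chains G M n" by (rule comm_group_bar_chains)
  have "hd xs \<in> carrier G" using assms(1) by (cases xs) (auto simp: tuples_def)
  then have "(if i = 0 then \<phi> (inv (hd xs)) m else m) \<in> carrier M" using assms(2) phi_closed by auto
  then show ?thesis unfolding bar_term_def by (intro B.int_pow_closed bar_single_closed)
qed

text \<open>The inverse in the first term of the boundary is the one built into \<rho>, so the
  defining complex is \<open>bar_d\<close> tensored with \<open>L\<close>.\<close>

lemma Psi_bar_terms:
  assumes xs: "xs \<in> tuples (Suc n) G" and m: "m \<in> carrier M"
  shows "(\<Sum>i\<in>{0..Suc n}. \<Psi> n (bar_term n xs m i)) = tensor \<rho> (\<psi> m) (bar_d G xs)"
proof -
  have h: "hd xs \<in> carrier G" and ne: "xs \<noteq> []" and len: "length xs = Suc n" using xs by (cases xs; auto simp: tuples_def)+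
  have f: "bar_face G i xs \<in> tuples n G" if "i \<le> Suc n" for i by (rule G.bar_face_in_tuples[OF xs that])
  have t0: "\<Psi> n (bar_term n xs m 0) = tensor \<rho> (\<psi> m) (frag_of (hd xs, tl xs))"
  proof -
    have "\<Psi> n (bar_term n xs m 0) = Poly_Mapping.single (bar_face G 0 xs) (\<psi> (\<phi> (inv (hd xs)) m))"
      unfolding bar_term_def using f[of 0] phi_closed[OF G.inv_closed[OF h] m]
      by (simp add: Psi_sign[OF bar_single_closed, where i = 0, simplified] Psi_single)
    then show ?thesis by (simp add: rho_psi[OF h m] bar_face_def)
  qed
  have tS: "\<Psi> n (bar_term n xs m (Suc i)) = tensor \<rho> (\<psi> m) (frag_cmul ((-1) ^ Suc i) (frag_of (\<one>, bar_face G (Suc i) xs)))"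
    if "i \<le> n" for i
  proof -
    have "\<Psi> n (bar_term n xs m (Suc i)) = (if even (Suc i) then Poly_Mapping.single (bar_face G (Suc i) xs) (\<psi> m)
        else - Poly_Mapping.single (bar_face G (Suc i) xs) (\<psi> m))"
      unfolding bar_term_def Psi_sign[OF bar_single_closed[OF m], of n "bar_face G (Suc i) xs" "Suc i"]
      using f[of "Suc i"] that by (simp only: nat.distinct if_False Psi_sign[OF bar_single_closed[OF m]] Psi_single[OF f] Suc_le_mono)
    then show ?thesis by (cases "even i") simp_all
  qed
  have "(\<Sum>i\<in>{0..Suc n}. \<Psi> n (bar_term n xs m i)) = \<Psi> n (bar_term n xs m 0) + (\<Sum>i\<le>n. \<Psi> n (bar_term n xs m (Suc i)))"
    unfolding atLeast0AtMost by (rule sum.atMost_Suc_shift)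
  also have "(\<Sum>i\<le>n. \<Psi> n (bar_term n xs m (Suc i))) =
      (\<Sum>i<Suc n. tensor \<rho> (\<psi> m) (frag_cmul ((-1) ^ Suc i) (frag_of (\<one>, bar_face G (Suc i) xs))))"
    unfolding lessThan_Suc_atMost by (rule sum.cong[OF refl]) (rule tS, simp)
  also have "\<dots> = tensor \<rho> (\<psi> m) (\<Sum>i<Suc n. frag_cmul ((-1) ^ Suc i) (frag_of (\<one>, bar_face G (Suc i) xs)))"
    by (rule tensor_sum[symmetric]) simp
  finally show ?thesis unfolding t0 bar_d_def len using ne by (simp only: if_False tensor_simps(3))
qed

lemma bar_boundary_alt:
  "bar_boundary G M \<phi> n c = gfinprod (bar_chains G M n)
     (\<lambda>xs. finprod (bar_chains G M n) (bar_term n xs (c xs)) {0..Suc n}) (tuples (Suc n) G)"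
  unfolding bar_boundary_def bar_term_def ..

lemma bar_boundary_closed_Psi:
  assumes "c \<in> carrier (bar_chains G M (Suc n))"
  shows "bar_boundary G M \<phi> n c \<in> carrier (bar_chains G M n)"
    and "\<Psi> n (bar_boundary G M \<phi> n c) = extend_coeffs \<rho> (bar_d G) (\<Psi> (Suc n) c)"
proof -
  interpret B: comm_group "bar_chains G M n" by (rule comm_group_bar_chains)
  have cM: "c xs \<in> carrier M" if "xs \<in> tuples (Suc n) G" for xs
    using assms that by (auto simp: carrier_bar_chains)
  have inner: "finprod (bar_chains G M n) (bar_term n xs (c xs)) {0..Suc n} \<in> carrier (bar_chains G M n)"
    if "xs \<in> tuples (Suc n) G" for xs
    by (rule B.finprod_closed) (use bar_term_closed[OF that cM[OF that]] in blast)
  have eq: "bar_boundary G M \<phi> n c = finprod (bar_chains G M n)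
     (\<lambda>xs. finprod (bar_chains G M n) (bar_term n xs (c xs)) {0..Suc n}) (tuples (Suc n) G)"
    unfolding bar_boundary_alt by (rule B.gfinprod_eq_finprod[OF finite_tuples]) (use inner in blast)
  show "bar_boundary G M \<phi> n c \<in> carrier (bar_chains G M n)"
    unfolding eq by (rule B.finprod_closed) (use inner in blast)
  have "\<Psi> n (bar_boundary G M \<phi> n c) =
      (\<Sum>xs\<in>tuples (Suc n) G. \<Psi> n (finprod (bar_chains G M n) (bar_term n xs (c xs)) {0..Suc n}))"
    unfolding eq by (rule Psi_finprod[OF finite_tuples inner])
  also have "\<dots> = (\<Sum>xs\<in>tuples (Suc n) G. tensor \<rho> (\<psi> (c xs)) (bar_d G xs))"
  proof (rule sum.cong[OF refl])
    fix xs assume xs: "xs \<in> tuples (Suc n) G"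
    have "\<Psi> n (finprod (bar_chains G M n) (bar_term n xs (c xs)) {0..Suc n}) = (\<Sum>i\<in>{0..Suc n}. \<Psi> n (bar_term n xs (c xs) i))"
      by (rule Psi_finprod) (use bar_term_closed[OF xs cM[OF xs]] in auto)
    also have "\<dots> = tensor \<rho> (\<psi> (c xs)) (bar_d G xs)" by (rule Psi_bar_terms[OF xs cM[OF xs]])
    finally show "\<Psi> n (finprod (bar_chains G M n) (bar_term n xs (c xs)) {0..Suc n}) = tensor \<rho> (\<psi> (c xs)) (bar_d G xs)" .
  qed
  also have "\<dots> = extend_coeffs \<rho> (bar_d G) (\<Psi> (Suc n) c)"
    unfolding \<Psi>_def extend_coeffs_sum extend_coeffs_simps(2) ..
  finally show "\<Psi> n (bar_boundary G M \<phi> n c) = extend_coeffs \<rho> (bar_d G) (\<Psi> (Suc n) c)" .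
qed

sublocale bar: resolution_with_coefficients G "\<lambda>n. tuples n G" "bar_d G" \<rho> L
  by (intro resolution_with_coefficients.intro resolution_with_coefficients_axioms.intro G.bar_resolution coefficients_axioms comm)

lemma Psi_boundaries:
  "\<Psi> n ` bar_boundary G M \<phi> n ` carrier (bar_chains G M (Suc n)) = bar.boundaries n"
proof -
  have "\<Psi> n ` bar_boundary G M \<phi> n ` carrier (bar_chains G M (Suc n)) =
      (\<lambda>c. extend_coeffs \<rho> (bar_d G) (\<Psi> (Suc n) c)) ` carrier (bar_chains G M (Suc n))"
    unfolding image_image by (rule image_cong[OF refl]) (rule bar_boundary_closed_Psi(2))
  also have "\<dots> = extend_coeffs \<rho> (bar_d G) ` \<Psi> (Suc n) ` carrier (bar_chains G M (Suc n))"
    unfolding image_image ..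
  finally show ?thesis unfolding Psi_image bar.boundaries_def .
qed

lemma bar_cycles_alt:
  "bar_cycles G M \<phi> n = {c \<in> carrier (bar_chains G M n). extend_coeffs \<rho> (bar_d G) (\<Psi> n c) = 0}"
proof (cases n)
  case 0
  have "extend_coeffs \<rho> (bar_d G) (\<Psi> 0 c) = 0" if "c \<in> carrier (bar_chains G M 0)" for c
    by (rule bar.boundary_0) (use that Psi_image[of 0] in blast)
  then show ?thesis unfolding 0 bar_cycles_def by (simp only: nat.case) blast
next
  case (Suc k)
  interpret B: comm_group "bar_chains G M k" by (rule comm_group_bar_chains)
  have "bar_boundary G M \<phi> k c = \<one>\<^bsub>bar_chains G M k\<^esub> \<longleftrightarrow> extend_coeffs \<rho> (bar_d G) (\<Psi> (Suc k) c) = 0"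
    if c: "c \<in> carrier (bar_chains G M (Suc k))" for c
    unfolding bar_boundary_closed_Psi(2)[OF c, symmetric]
    using inj_onD[OF Psi_inj _ bar_boundary_closed_Psi(1)[OF c] B.one_closed] Psi_one by metis
  then show ?thesis unfolding Suc bar_cycles_def kernel_def by (simp only: nat.case) blast
qed

lemma Psi_cycles: "\<Psi> n ` bar_cycles G M \<phi> n = bar.cycles n"
proof -
  have "\<Psi> n ` {c \<in> carrier (bar_chains G M n). extend_coeffs \<rho> (bar_d G) (\<Psi> n c) = 0} =
      {y \<in> \<Psi> n ` carrier (bar_chains G M n). extend_coeffs \<rho> (bar_d G) y = 0}" by blast
  then show ?thesis unfolding bar_cycles_alt Psi_image bar.cycles_def .
qed

lemma group_homology_elementary_abelian:
  assumes p: "Factorial_Ring.prime p" and index: "has_index (bar.cycles n) (bar.boundaries n) (p ^ k)"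
    and exponent: "\<And>c. c \<in> bar.cycles n \<Longrightarrow> (\<Sum>i<p. c) \<in> bar.boundaries n"
  shows "group_homology n G M \<phi> \<cong> product_group {..<k} (\<lambda>_. integer_mod_group p)"
  unfolding group_homology_def
proof (rule quotient_elementary_abelian[OF comm_group_bar_chains Psi_mult Psi_inj])
  let ?N = "bar_boundary G M \<phi> n ` carrier (bar_chains G M (Suc n))"
  show Z: "bar_cycles G M \<phi> n \<subseteq> carrier (bar_chains G M n)" unfolding bar_cycles_alt by blast
  show "?N \<subseteq> bar_cycles G M \<phi> n"
  proof
    fix x assume "x \<in> ?N"
    then obtain c where c: "c \<in> carrier (bar_chains G M (Suc n))" "x = bar_boundary G M \<phi> n c" by blast
    have "\<Psi> n x \<in> bar.boundaries n" using c Psi_boundaries by blast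
    then have "\<Psi> n x \<in> bar.cycles n" using bar.boundaries_subset by blast
    then show "x \<in> bar_cycles G M \<phi> n"
      using bar_boundary_closed_Psi(1)[OF c(1)] unfolding bar_cycles_alt bar.cycles_def c(2) by blast
  qed
qed (simp_all only: Psi_cycles Psi_boundaries bar.add_subgroup_cycles bar.add_subgroup_boundaries p index exponent)

end

section \<open>The arithmetic hypotheses for a concrete lattice, and assembly\<close>

lemma lookup_of_int_mult:
  fixes y :: "nat \<Rightarrow>\<^sub>0 int"
  shows "Poly_Mapping.lookup (of_int k * y) i = k * Poly_Mapping.lookup y i"
  by (induction k rule: int_induct[of _ 0]) (simp_all add: distrib_right left_diff_distrib lookup_add lookup_minus)

lemma p_adically_separated:
  fixes x :: "nat \<Rightarrow>\<^sub>0 int"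
  assumes p: "p > (1::nat)" and x: "\<And>j. \<exists>y. x = of_nat (p ^ j) * y" shows "x = 0"
proof (rule poly_mapping_eqI)
  fix i
  let ?c = "Poly_Mapping.lookup x i"
  \<comment> \<open>The absolute value of the entry serves as exponent: that power of
    \<open>p\<close> exceeds the entry, and can divide it only if it is zero.\<close>
  obtain y where "x = of_nat (p ^ nat \<bar>?c\<bar>) * y" using x by blast
  then have "?c = int (p ^ nat \<bar>?c\<bar>) * Poly_Mapping.lookup y i"
    using lookup_of_int_mult[of "int (p ^ nat \<bar>?c\<bar>)" y i] by simp
  then have dvd: "int (p ^ nat \<bar>?c\<bar>) dvd ?c" by (rule dvdI)
  show "?c = Poly_Mapping.lookup 0 i"
  proof (rule ccontr)
    assume "?c \<noteq> Poly_Mapping.lookup 0 i"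
    then have "int (p ^ nat \<bar>?c\<bar>) \<le> \<bar>?c\<bar>" using dvd_imp_le_int[OF _ dvd] by simp
    then have "p ^ nat \<bar>?c\<bar> \<le> nat \<bar>?c\<bar>" by linarith
    moreover have "nat \<bar>?c\<bar> < 2 ^ nat \<bar>?c\<bar>" by (rule less_exp)
    moreover have "(2::nat) ^ nat \<bar>?c\<bar> \<le> p ^ nat \<bar>?c\<bar>" using p by (intro power_mono) auto
    ultimately show False by linarith
  qed
qed

lemma power_product_induct:
  assumes "\<And>t N i. (t, N) \<in> set us \<Longrightarrow> P (t [^]\<^bsub>G\<^esub> (i::nat))" "P \<one>\<^bsub>G\<^esub>"
    and "\<And>g h. P g \<Longrightarrow> P h \<Longrightarrow> P (g \<otimes>\<^bsub>G\<^esub> h)"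
  shows "P (power_product G us is)"
  using assms(1)
proof (induction us arbitrary: "is")
  case (Cons u us)
  then show ?case
    by (cases u; cases "is") (auto intro!: assms(2,3))
qed (simp add: assms(2))

context finite_lattice_coordinates
begin

lemma psi_int_pow:
  assumes "y \<in> carrier M" shows "\<psi> (y [^]\<^bsub>M\<^esub> (k::int)) = of_int k * \<psi> y"
proof (rule poly_mapping_eqI)
  fix i
  have "\<psi> (y [^]\<^bsub>M\<^esub> k) = frag_cmul k (\<psi> y)"
    using hom_int_pow[OF psi_hom assms M.is_group group_free_Abelian_group, of k] hom_in_carrier[OF psi_hom assms] by simp
  then show "Poly_Mapping.lookup (\<psi> (y [^]\<^bsub>M\<^esub> k)) i = Poly_Mapping.lookup (of_int k * \<psi> y) i"
    by (simp add: lookup_of_int_mult)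
qed

text \<open>Stability under \<rho> and under \<phi> agree, since the two actions differ by inverting
  the group element.\<close>

lemma torsion_quotient:
  assumes irr: "irreducible_lattice G M \<phi>" and N: "add_subgroup N" "N \<subseteq> L" "N \<noteq> {0}"
    and stable: "\<And>g y. g \<in> carrier G \<Longrightarrow> y \<in> N \<Longrightarrow> \<rho> g y \<in> N" and x: "x \<in> L"
  shows "\<exists>k::int. k \<noteq> 0 \<and> of_int k * x \<in> N"
proof -
  let ?N = "{y \<in> carrier M. \<psi> y \<in> N}"
  have inv: "\<psi> (inv\<^bsub>M\<^esub> y) = - \<psi> y" if "y \<in> carrier M" for y
    using psi_mult[of y "inv\<^bsub>M\<^esub> y"] that psi_one by (simp add: eq_neg_iff_add_eq_0 add.commute)
  have "subgroup ?N M"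
  proof (rule M.subgroupI)
    have "\<one>\<^bsub>M\<^esub> \<in> ?N" using add_subgroupD(1)[OF N(1)] psi_one by simp
    then show "?N \<noteq> {}" by blast
    fix a assume a: "a \<in> ?N"
    then show "inv\<^bsub>M\<^esub> a \<in> ?N" using inv add_subgroupD(3)[OF N(1)] by simp
    fix b assume "b \<in> ?N"
    then show "a \<otimes>\<^bsub>M\<^esub> b \<in> ?N" using a psi_mult add_subgroupD(4)[OF N(1)] by simp
  qed blast
  moreover have "?N \<noteq> {\<one>\<^bsub>M\<^esub>}"
  proof -
    obtain y where y: "y \<in> N" "y \<noteq> 0" using N(3) add_subgroupD(1)[OF N(1)] by blast
    then have "y \<in> L" using N(2) by blast
    then have "\<psi>_inv y \<in> ?N" "\<psi>_inv y \<noteq> \<one>\<^bsub>M\<^esub>"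
      using psi_inv_closed psi_psi_inv[of y] y psi_one by auto
    then show ?thesis by blast
  qed
  moreover have "\<phi> g y \<in> ?N" if g: "g \<in> carrier G" and y: "y \<in> ?N" for g y
  proof -
    have "\<psi> (\<phi> g y) = \<rho> (inv g) (\<psi> y)" using rho_psi[of "inv g" y] g y by simp
    then show ?thesis using stable[of "inv g" "\<psi> y"] g y phi_closed by simp
  qed
  ultimately obtain k :: int where k: "k \<noteq> 0" "\<psi>_inv x [^]\<^bsub>M\<^esub> k \<in> ?N"
    using irreducible_lattice_torsion[OF irr _ _ _ psi_inv_closed[OF x]] by blast
  then have "of_int k * x \<in> N" using psi_int_pow[OF psi_inv_closed[OF x], of k] psi_psi_inv[OF x] by simp
  then show ?thesis using k(1) by blast
qed

text \<open>Hypothesis \<open>gens\<close> admits every enumeration of \<open>K\<close>, because the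
  generator that must come first is found only in the course of the proof.\<close>

theorem irreducible_lattice_homology:
  fixes t :: "'i \<Rightarrow> 'g" and e :: "'i \<Rightarrow> nat"
  assumes p: "Factorial_Ring.prime p" and irr: "irreducible_lattice G M \<phi>" and nontriv: "nontrivial_action G M \<phi>"
    and K: "finite K" and e: "\<And>k. k \<in> K \<Longrightarrow> e k \<ge> 1"
    and gens: "\<And>ks. distinct ks \<Longrightarrow> set ks = K \<Longrightarrow> abelian_generators G (map (\<lambda>k. (t k, p ^ e k)) ks)"
  shows "\<exists>k::nat. of_nat k = nu n (card K) \<and>
    group_homology n G M \<phi> \<cong> product_group {..<k} (\<lambda>_. integer_mod_group p)"
proof -
  interpret G: comm_group G by (rule comm)
  have p1: "p > 1" using p prime_gt_1_nat by blast
  obtain ks0 where ks0: "distinct ks0" "set ks0 = K" using finite_distinct_list[OF K] by blast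
  interpret g0: abelian_generators G "map (\<lambda>k. (t k, p ^ e k)) ks0" by (rule gens[OF ks0])
  have t: "t k \<in> carrier G" "t k [^] (p ^ e k) = \<one>" if "k \<in> K" for k
    using g0.ts[of "t k" "p ^ e k"] that ks0(2) by auto
  have generate: "P g" if g: "g \<in> carrier G" and P: "\<And>k i. k \<in> K \<Longrightarrow> P (t k [^] (i::nat))" "P \<one>"
      "\<And>g h. P g \<Longrightarrow> P h \<Longrightarrow> P (g \<otimes> h)" for P g
  proof -
    from g obtain "is" where "g = power_product G (map (\<lambda>k. (t k, p ^ e k)) ks0) is"
      unfolding bij_betw_imp_surj_on[OF g0.bij, symmetric] by (elim imageE)
    moreover have "P (power_product G (map (\<lambda>k. (t k, p ^ e k)) ks0) is)" for "is"
      by (rule power_product_induct) (use P ks0(2) in auto)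
    ultimately show ?thesis by simp
  qed
  define triv where "triv b \<longleftrightarrow> (\<forall>k \<in> K. \<forall>x \<in> L. \<rho> (t k [^] (p ^ b)) x = x)" for b
  have all_triv: "\<rho> (g [^] (p ^ b)) x = x" if b: "triv b" and g: "g \<in> carrier G" and x: "x \<in> L" for b g x
  proof -
    let ?P = "\<lambda>g. g \<in> carrier G \<and> (\<forall>x \<in> L. \<rho> (g [^] (p ^ b)) x = x)"
    have "?P g"
    proof (rule generate[OF g])
      fix k and i :: nat assume k: "k \<in> K"
      have "\<rho> ((t k [^] (p ^ b)) [^] i) x = x" if "x \<in> L" for x
        by (induction i) (use t(1)[OF k] k b that in \<open>simp_all add: triv_def rho_mult\<close>)
      then show "?P (t k [^] i)" using t(1)[OF k] by (simp add: G.nat_pow_pow mult.commute)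
    next
      fix g h assume "?P g" "?P h"
      then show "?P (g \<otimes> h)" by (simp add: G.nat_pow_distrib rho_mult)
    qed simp
    then show ?thesis using x by blast
  qed
  have "triv (Max (insert 0 (e ` K)))"
    unfolding triv_def
  proof (intro ballI)
    fix k x assume k: "k \<in> K" and x: "x \<in> L"
    have "e k \<le> Max (insert 0 (e ` K))" using K k by (intro Max_ge) auto
    then have "p ^ Max (insert 0 (e ` K)) = p ^ e k * p ^ (Max (insert 0 (e ` K)) - e k)"
      by (simp flip: power_add)
    then have "t k [^] (p ^ Max (insert 0 (e ` K))) = (t k [^] (p ^ e k)) [^] (p ^ (Max (insert 0 (e ` K)) - e k))"
      using t(1)[OF k] by (simp add: G.nat_pow_pow)
    then show "\<rho> (t k [^] (p ^ Max (insert 0 (e ` K)))) x = x" using t(2)[OF k] by simp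
  qed
  \<comment> \<open>Minimality of \<open>a\<close> yields a generator \<open>t k0\<close> whose
    power with exponent \<open>p ^ (a - 1)\<close> still acts nontrivially; it becomes
    \<open>t\<^sub>0\<close>. That \<open>a\<close> is positive is the nontriviality of the
    action.\<close>
  define a where "a = (LEAST b. triv b)"
  have a: "triv a" unfolding a_def by (rule LeastI) fact
  have "\<not> triv 0"
  proof
    assume t0: "triv 0"
    obtain g x where gx: "g \<in> carrier G" "x \<in> carrier M" "\<phi> g x \<noteq> x"
      using nontriv by (auto simp: nontrivial_action_def)
    have "\<rho> (inv g) (\<psi> x) = \<psi> x"
      using all_triv[OF t0 G.inv_closed[OF gx(1)] psi_closed[OF gx(2)]] gx(1) by simp
    then have "\<psi> (\<phi> g x) = \<psi> x" using rho_psi[of "inv g" x] gx by simp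
    then show False using psi_inj[OF phi_closed[OF gx(1,2)] gx(2)] gx(3) by blast
  qed
  then have a0: "a > 0" using a by (cases a) auto
  then have "\<not> triv (a - 1)" unfolding a_def by (intro not_less_Least) simp
  then obtain k0 where k0: "k0 \<in> K" "\<exists>x \<in> L. \<rho> (t k0 [^] (p ^ (a - 1))) x \<noteq> x" by (auto simp: triv_def)
  interpret irr: irreducible_coefficients G \<rho> L p a "t k0"
  proof unfold_locales
    show "\<exists>k::int. k \<noteq> 0 \<and> of_int k * x \<in> N"
      if "add_subgroup N" "N \<subseteq> L" "N \<noteq> {0}" "\<And>g y. g \<in> carrier G \<Longrightarrow> y \<in> N \<Longrightarrow> \<rho> g y \<in> N" "x \<in> L" for N x
      by (rule torsion_quotient[OF irr that])
    show "x = 0" if "x \<in> L" "\<And>j. \<exists>y \<in> L. x = of_nat (p ^ j) * y" for x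
      by (rule p_adically_separated[OF p1]) (use that(2) in blast)
    show "\<rho> (g [^] (p ^ a)) x = x" if "g \<in> carrier G" "x \<in> L" for g x by (rule all_triv[OF a that])
  qed (use p t(1)[OF k0(1)] a0 k0(2) in auto)
  obtain ks where ks: "distinct ks" "set ks = K - {k0}" using finite_distinct_list[of "K - {k0}"] K by blast
  define us where "us = map (\<lambda>k. (t k, p ^ e k)) ks"
  define ts where "ts = map (\<lambda>k. (t k, p ^ e k)) (k0 # ks)"
  have k0ks: "distinct (k0 # ks)" "set (k0 # ks) = K" using ks k0 by auto
  have len: "length ts = card K" using distinct_card[OF k0ks(1)] k0ks(2) by (simp add: ts_def)
  interpret gen: abelian_generators G ts unfolding ts_def by (rule gens[OF k0ks])
  interpret kos: koszul_coefficients G ts \<rho> L p "t k0" "p ^ e k0" us "\<lambda>x. \<rho> (t k0) x - x"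
  proof unfold_locales
    show "ts = (t k0, p ^ e k0) # us" by (simp add: ts_def us_def)
    show "p dvd N" if "(s, N) \<in> set ts" for s N
    proof -
      obtain k where k: "k \<in> K" "N = p ^ e k" using \<open>(s, N) \<in> set ts\<close> k0ks(2) unfolding ts_def by auto
      then show ?thesis using e[OF k(1)] by (simp add: dvd_power)
    qed
  qed (use irr.pi_inj irr.rho_pi irr.p_pi irr.index_pi p1 in auto)
  interpret two: two_resolutions_with_coefficients G "multidegrees (length ts)" "koszul_d G ts"
      "\<lambda>n. tuples n G" "bar_d G" \<rho> L
    by (intro two_resolutions_with_coefficients.intro two_resolutions.intro
        two_resolutions_with_coefficients_axioms.intro gen.koszul_resolution G.bar_resolution coefficients_axioms comm)
  have ne: "multidegrees (length ts) 0 \<noteq> {}" "tuples 0 G \<noteq> {}"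
    using finite_multidegrees card_multidegrees[of "length ts" 0] by (auto simp: tuples_def)
  obtain k where k: "of_nat k = nu n (length ts)" "has_index (kos.K.cycles n) (kos.K.boundaries n) (p ^ k)"
    using kos.index_homology[of n] by blast
  have "group_homology n G M \<phi> \<cong> product_group {..<k} (\<lambda>_. integer_mod_group p)"
    by (rule group_homology_elementary_abelian[OF p two.homology_transfer(1)[OF ne k(2)]
          two.homology_transfer(2)[OF ne kos.p_cycles]])
  then show ?thesis using k(1) len by auto
qed

end

section \<open>Generators of a product of cyclic groups\<close>

text \<open>Exponents reduce modulo \<open>N\<close>, so \<open>N\<close> powers cover the carrier,
  and a surjection between finite sets of equal size is injective.\<close>

lemma (in group) cyclic_generator_bij:
  assumes "cyclic_group G" "Coset.order G = N" "N > 0"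
  obtains c where "c \<in> carrier G" "c [^] N = \<one>" "bij_betw (\<lambda>i::nat. c [^] i) {..<N} (carrier G)"
proof -
  have fin: "finite (carrier G)" using assms(2,3) card_gt_0_iff[of "carrier G"] by (simp add: Coset.order_def)
  obtain c where c: "c \<in> carrier G" and range: "carrier G = range (\<lambda>n::int. c [^] n)"
    using assms(1) unfolding cyclic_group by (elim bexE)
  have one: "c [^] N = \<one>" using comm_group.power_order_eq_one[OF cyclic_imp_abelian_group[OF assms(1)] fin c] assms(2) by (simp add: Coset.order_def)
  have "c [^] k = c [^] nat (k mod int N)" for k :: int
  proof -
    have "c [^] k = c [^] (int N * (k div int N) + k mod int N)" by simp
    also have "\<dots> = (c [^] int N) [^] (k div int N) \<otimes> c [^] (k mod int N)"
      using c by (simp only: int_pow_mult int_pow_pow)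
    also have "\<dots> = c [^] (k mod int N)" using c one by (simp add: int_pow_int)
    also have "\<dots> = c [^] int (nat (k mod int N))" using assms(3) by simp
    finally show ?thesis by (simp only: int_pow_int)
  qed
  moreover have "nat (k mod int N) < N" for k using assms(3) by (simp add: nat_less_iff)
  ultimately have "carrier G \<subseteq> (\<lambda>i::nat. c [^] i) ` {..<N}" unfolding range by blast
  then have surj: "(\<lambda>i::nat. c [^] i) ` {..<N} = carrier G" using c by auto
  then have "inj_on (\<lambda>i::nat. c [^] i) {..<N}" using assms(2) by (intro eq_card_imp_inj_on) (auto simp: Coset.order_def)
  then show ?thesis using that[OF c one] surj by (simp add: bij_betw_def)
qed

lemma product_group_nat_pow:
  "f \<in> carrier (product_group I C) \<Longrightarrow>
    f [^]\<^bsub>product_group I C\<^esub> (i::nat) = (\<lambda>j\<in>I. f j [^]\<^bsub>C j\<^esub> i)"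
  by (induction i) (auto intro!: restrict_ext simp: nat_pow_def)

lemma comm_group_product_group:
  assumes "\<And>k. k \<in> I \<Longrightarrow> comm_group (C k)"
  shows "comm_group (product_group I C)"
proof (rule group.group_comm_groupI)
  show "group (product_group I C)" using assms by (simp add: comm_group.axioms)
  show "x \<otimes>\<^bsub>product_group I C\<^esub> y = y \<otimes>\<^bsub>product_group I C\<^esub> x"
    if "x \<in> carrier (product_group I C)" "y \<in> carrier (product_group I C)" for x y
    using that by (auto intro!: restrict_ext comm_monoid.m_comm comm_group.axioms assms simp: PiE_iff)
qed

locale cyclic_factors =
  fixes I :: "'i set" and C :: "'i \<Rightarrow> ('a, 'c) monoid_scheme" and N :: "'i \<Rightarrow> nat" and c :: "'i \<Rightarrow> 'a"
  assumes factors: "\<And>k. k \<in> I \<Longrightarrow> comm_group (C k)"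
    and c: "\<And>k. k \<in> I \<Longrightarrow> c k \<in> carrier (C k)" "\<And>k. k \<in> I \<Longrightarrow> c k [^]\<^bsub>C k\<^esub> N k = \<one>\<^bsub>C k\<^esub>"
    and c_bij: "\<And>k. k \<in> I \<Longrightarrow> bij_betw (\<lambda>i::nat. c k [^]\<^bsub>C k\<^esub> i) {..<N k} (carrier (C k))"
begin

definition embedded :: "'i \<Rightarrow> 'i \<Rightarrow> 'a" where
  "embedded k = (\<lambda>j\<in>I. if j = k then c k else \<one>\<^bsub>C j\<^esub>)"

lemma factor_group: "k \<in> I \<Longrightarrow> group (C k)" by (simp add: factors comm_group.axioms)

lemma factor_monoid: "k \<in> I \<Longrightarrow> Group.monoid (C k)" by (simp add: factor_group group.is_monoid)

lemma embedded_closed: "k \<in> I \<Longrightarrow> embedded k \<in> carrier (product_group I C)"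
  by (auto simp: embedded_def c factor_monoid monoid.one_closed)

lemma embedded_pow:
  "k \<in> I \<Longrightarrow> embedded k [^]\<^bsub>product_group I C\<^esub> (i::nat) = (\<lambda>j\<in>I. if j = k then c k [^]\<^bsub>C k\<^esub> i else \<one>\<^bsub>C j\<^esub>)"
  unfolding product_group_nat_pow[OF embedded_closed]
  by (rule restrict_ext) (simp add: embedded_def monoid.nat_pow_one[OF factor_monoid])

text \<open>For the induction \<open>ks\<close> may list only some of the factors; the association
  list records which coordinates have received an exponent, the others being trivial.\<close>

lemma power_product_embedded:
  assumes "distinct ks" "set ks \<subseteq> I" "length is = length ks"
  shows "power_product (product_group I C) (map (\<lambda>k. (embedded k, N k)) ks) is =
    (\<lambda>j\<in>I. case map_of (zip ks is) j of None \<Rightarrow> \<one>\<^bsub>C j\<^esub> | Some i \<Rightarrow> c j [^]\<^bsub>C j\<^esub> i)"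
  using assms
proof (induction ks arbitrary: "is")
  case (Cons k ks)
  then obtain i js where js: "is = i # js" "length js = length ks" by (cases "is") auto
  have k: "k \<in> I" "map_of (zip ks js) k = None" using Cons.prems js(2) by (auto simp: map_of_eq_None_iff set_zip)
  have pow: "c j [^]\<^bsub>C j\<^esub> (l::nat) \<in> carrier (C j)" if "j \<in> I" for j l
    using that by (intro monoid.nat_pow_closed factor_monoid c)
  have IH: "power_product (product_group I C) (map (\<lambda>k. (embedded k, N k)) ks) js =
    (\<lambda>j\<in>I. case map_of (zip ks js) j of None \<Rightarrow> \<one>\<^bsub>C j\<^esub> | Some i \<Rightarrow> c j [^]\<^bsub>C j\<^esub> i)"
    using Cons js by auto
  show ?case
    unfolding js(1) list.map power_product.simps IH embedded_pow[OF k(1)] mult_product_group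
    by (rule restrict_ext)
       (use k pow in \<open>auto simp: monoid.l_one[OF factor_monoid] monoid.r_one[OF factor_monoid]
          monoid.one_closed[OF factor_monoid] split: option.splits\<close>)
qed auto

lemma abelian_generators_embedded:
  assumes ks: "distinct ks" "set ks = I"
  shows "abelian_generators (product_group I C) (map (\<lambda>k. (embedded k, N k)) ks)"
proof (intro abelian_generators.intro abelian_generators_axioms.intro comm_group_product_group factors)
  fix t n assume "(t, n) \<in> set (map (\<lambda>k. (embedded k, N k)) ks)"
  then obtain k where k: "k \<in> I" "t = embedded k" "n = N k" using ks(2) by auto
  show "t \<in> carrier (product_group I C) \<and> t [^]\<^bsub>product_group I C\<^esub> n = \<one>\<^bsub>product_group I C\<^esub>"
    unfolding k(2,3) embedded_pow[OF k(1)] one_product_group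
    by (rule conjI[OF embedded_closed[OF k(1)]], rule restrict_ext) (simp add: c(2)[OF k(1)])
next
  let ?D = "{is. list_all2 (\<lambda>x i. i < snd x) (map (\<lambda>k. (embedded k, N k)) ks) is}"
  let ?f = "power_product (product_group I C) (map (\<lambda>k. (embedded k, N k)) ks)"
  have D: "is \<in> ?D \<longleftrightarrow> length is = length ks \<and> (\<forall>l<length ks. is ! l < N (ks ! l))" for "is"
    unfolding mem_Collect_eq list_all2_conv_all_nth by auto
  have f: "?f is = (\<lambda>j\<in>I. case map_of (zip ks is) j of None \<Rightarrow> \<one>\<^bsub>C j\<^esub> | Some i \<Rightarrow> c j [^]\<^bsub>C j\<^esub> i)"
    if "length is = length ks" for "is"
    by (rule power_product_embedded) (use ks that in auto)
  have f_nth: "?f is (ks ! l) = c (ks ! l) [^]\<^bsub>C (ks ! l)\<^esub> (is ! l)"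
    if "length is = length ks" "l < length ks" for "is" l
    using that ks nth_mem[OF that(2)] by (simp add: f map_of_zip_nth)
  show "bij_betw ?f ?D (carrier (product_group I C))"
  proof (rule bij_betwI')
    fix "is" js assume "is \<in> ?D" "js \<in> ?D"
    then have i: "length is = length ks" "\<And>l. l < length ks \<Longrightarrow> is ! l < N (ks ! l)"
      and j: "length js = length ks" "\<And>l. l < length ks \<Longrightarrow> js ! l < N (ks ! l)" unfolding D by simp_all
    show "?f is = ?f js \<longleftrightarrow> is = js"
    proof
      assume eq: "?f is = ?f js"
      show "is = js"
      proof (rule nth_equalityI)
        show "length is = length js" using i(1) j(1) by simp
        fix l assume "l < length is"
        then have l: "l < length ks" "ks ! l \<in> I" using i(1) ks(2) by auto
        have "c (ks ! l) [^]\<^bsub>C (ks ! l)\<^esub> (is ! l) = c (ks ! l) [^]\<^bsub>C (ks ! l)\<^esub> (js ! l)"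
          unfolding f_nth[OF i(1) l(1), symmetric] f_nth[OF j(1) l(1), symmetric] eq by (rule refl)
        then show "is ! l = js ! l"
          by (rule inj_onD[OF bij_betw_imp_inj_on[OF c_bij[OF l(2)]]])
             (use i(2)[OF l(1)] j(2)[OF l(1)] in simp_all)
      qed
    qed simp
  next
    fix "is" assume "is \<in> ?D"
    then have i: "length is = length ks" unfolding D by (rule conjunct1)
    have "(case map_of (zip ks is) j of None \<Rightarrow> \<one>\<^bsub>C j\<^esub> | Some i \<Rightarrow> c j [^]\<^bsub>C j\<^esub> i) \<in> carrier (C j)" if "j \<in> I" for j
      by (cases "map_of (zip ks is) j")
         (simp_all add: monoid.nat_pow_closed[OF factor_monoid[OF that] c(1)[OF that]] monoid.one_closed[OF factor_monoid[OF that]])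
    then show "?f is \<in> carrier (product_group I C)" unfolding f[OF i] by simp
  next
    fix g assume g: "g \<in> carrier (product_group I C)"
    define h where "h k = inv_into {..<N k} (\<lambda>i::nat. c k [^]\<^bsub>C k\<^esub> i) (g k)" for k
    have h: "h k < N k" "c k [^]\<^bsub>C k\<^esub> h k = g k" if "k \<in> I" for k
    proof -
      have gk: "g k \<in> (\<lambda>i::nat. c k [^]\<^bsub>C k\<^esub> i) ` {..<N k}"
        using bij_betw_imp_surj_on[OF c_bij[OF that]] g that by auto
      show "h k < N k" using inv_into_into[OF gk] by (simp add: h_def)
      show "c k [^]\<^bsub>C k\<^esub> h k = g k" using f_inv_into_f[OF gk] by (simp add: h_def)
    qed
    have "?f (map h ks) = (\<lambda>j\<in>I. g j)"
      unfolding f[OF length_map] map_of_zip_map by (rule restrict_ext) (simp add: h ks(2))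
    also have "(\<lambda>j\<in>I. g j) = g" using g by (simp add: PiE_restrict)
    finally have "g = ?f (map h ks)" by (rule sym)
    moreover have "map h ks \<in> ?D" unfolding D using h ks(2) by auto
    ultimately show "\<exists>is \<in> ?D. g = ?f is" by (rule bexI)
  qed
qed

end

theorem theorem4p1:
  fixes p s n :: nat
    and m :: "nat \<Rightarrow> nat"
    and C :: "nat \<Rightarrow> ('a, 'c) monoid_scheme"
    and M :: "('m, 'd) monoid_scheme"
    and \<phi> :: "(nat \<Rightarrow> 'a) \<Rightarrow> 'm \<Rightarrow> 'm"
  defines "G \<equiv> product_group {1..s} C"
  assumes "Factorial_Ring.prime p"
    and "s \<ge> 1"
    and "\<And>k. k \<in> {1..s} \<Longrightarrow> group (C k)"
    and "\<And>k. k \<in> {1..s} \<Longrightarrow> cyclic_group (C k)"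
    and "\<And>k. k \<in> {1..s} \<Longrightarrow> m k \<ge> 1"
    and "\<And>k. k \<in> {1..s} \<Longrightarrow> Coset.order (C k) = p ^ m k"
    and "irreducible_lattice G M \<phi>"
    and "nontrivial_action G M \<phi>"
  shows "\<exists>r::nat. of_nat r = nu n s \<and>
    group_homology n G M \<phi> \<cong> product_group {..<r} (\<lambda>_. integer_mod_group p)"
proof -
  have p: "p ^ m k > 0" for k using prime_gt_0_nat[OF assms(2)] by simp
  have "\<exists>c. c \<in> carrier (C k) \<and> c [^]\<^bsub>C k\<^esub> (p ^ m k) = \<one>\<^bsub>C k\<^esub> \<and>
      bij_betw (\<lambda>i::nat. c [^]\<^bsub>C k\<^esub> i) {..<p ^ m k} (carrier (C k))" if "k \<in> {1..s}" for k
    using group.cyclic_generator_bij[OF assms(4,5,7)[OF that] p] by blast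
  then obtain c where c: "\<And>k. k \<in> {1..s} \<Longrightarrow> c k \<in> carrier (C k) \<and> c k [^]\<^bsub>C k\<^esub> (p ^ m k) = \<one>\<^bsub>C k\<^esub> \<and>
      bij_betw (\<lambda>i::nat. c k [^]\<^bsub>C k\<^esub> i) {..<p ^ m k} (carrier (C k))"
    by metis
  interpret cyclic_factors "{1..s}" C "\<lambda>k. p ^ m k" c
    by (rule cyclic_factors.intro) (use c assms(4,5) in \<open>auto intro: group.cyclic_imp_abelian_group\<close>)
  have "finite (carrier (C k))" if "k \<in> {1..s}" for k
    using assms(7)[OF that] p[of k] card_gt_0_iff[of "carrier (C k)"] by (simp add: Coset.order_def)
  then have fin: "finite (carrier G)" unfolding G_def carrier_product_group by (intro finite_PiE) auto
  have lattice: "G_lattice G M \<phi>" using assms(8) by (simp add: irreducible_lattice_def)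
  then obtain r :: nat and \<psi> where \<psi>: "\<psi> \<in> iso M (free_Abelian_group {..<r})"
    using G_lattice.free_finite_rank[OF lattice] by (auto simp: is_iso_def)
  interpret lat: finite_lattice_coordinates G M \<phi> r \<psi>
  proof (intro finite_lattice_coordinates.intro lattice_coordinates.intro
      lattice_coordinates_axioms.intro finite_lattice_coordinates_axioms.intro)
    show "G_module G M \<phi>" by (rule G_lattice.axioms[OF lattice])
    show "comm_group G" unfolding G_def by (intro comm_group_product_group factors)
  qed (fact \<psi> fin)+
  have gens: "abelian_generators G (map (\<lambda>k. (embedded k, p ^ m k)) ks)" if "distinct ks" "set ks = {1..s}" for ks
    unfolding G_def by (rule abelian_generators_embedded[OF that])
  have "\<exists>k::nat. of_nat k = nu n (card {1..s}) \<and>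
      group_homology n G M \<phi> \<cong> product_group {..<k} (\<lambda>_. integer_mod_group p)"
    by (rule lat.irreducible_lattice_homology[OF assms(2,8,9) finite_atLeastAtMost assms(6) gens])
  then show ?thesis by simp
qed

end
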